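(* Let $n\geq 1$ and let $w\in F_n$ be a non-empty cyclically reduced word. If $P_n(w)$ is a redundant cyclic presentation then the group $G_n(w)$ either contains a non-abelian free subgroup or is solvable.
   Context: $F_n$ is the free group with basis $x_0,\ldots,x_{n-1}$; subscripts are taken modulo $n$; $\theta(x_i)=x_{i+1}$. $P_n(w)=\langle x_0,\ldots,x_{n-1}\mid w,\theta(w),\ldots,\theta^{n-1}(w)\rangle$ and $G_n(w)$ is the group it defines. A presentation with cyclically reduced relators is redundant if some relator $r$ is freely trivial or there is another relator $s$ such that $r$ is a cyclic permutation of $s$ or of $s^{-1}$. *)

theory Defs
  imports "HOL-Algebra.Solvable_Groups"
begin

section \<open>Words and free groups\<close>

text \<open>The letter \<open>(a, True)\<close> stands for the generator \<open>a\<close> and \<open>(a, False)\<close> for its inverse.\<close>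

type_synonym 'a letter = "'a \<times> bool"
type_synonym 'a word = "'a letter list"

definition inv_letter :: "'a letter \<Rightarrow> 'a letter" where
  "inv_letter x = (fst x, \<not> snd x)"

definition inv_word :: "'a word \<Rightarrow> 'a word" where
  "inv_word w = rev (map inv_letter w)"

definition reduced :: "'a word \<Rightarrow> bool" where
  "reduced w \<longleftrightarrow> successively (\<lambda>x y. y \<noteq> inv_letter x) w"

definition cyclically_reduced :: "'a word \<Rightarrow> bool" where
  "cyclically_reduced w \<longleftrightarrow> reduced w \<and> (w \<noteq> [] \<longrightarrow> hd w \<noteq> inv_letter (last w))"

fun cancel_cons :: "'a letter \<Rightarrow> 'a word \<Rightarrow> 'a word" where
  "cancel_cons x [] = [x]"
| "cancel_cons x (y # ys) = (if y = inv_letter x then ys else x # y # ys)"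

definition reduce :: "'a word \<Rightarrow> 'a word" where
  "reduce w = foldr cancel_cons w []"

definition free_group :: "'a set \<Rightarrow> 'a word monoid" where
  "free_group S = \<lparr>carrier = {w. reduced w \<and> fst ` set w \<subseteq> S},
                   monoid.mult = (\<lambda>u v. reduce (u @ v)),
                   one = []\<rparr>"

text \<open>Letting the basis range over sets of elements of the type of \<open>G\<close> loses no generality,
  because a basis of a free group \<open>G\<close> is a subset of its carrier.\<close>

definition is_free_group :: "('a, 'b) monoid_scheme \<Rightarrow> bool" where
  "is_free_group G \<longleftrightarrow> group G \<and> (\<exists>S :: 'a set. free_group S \<cong> G)"

definition contains_nonabelian_free_subgroup :: "('a, 'b) monoid_scheme \<Rightarrow> bool" where
  "contains_nonabelian_free_subgroup G \<longleftrightarrow>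
     (\<exists>H. subgroup H G \<and> is_free_group (G\<lparr>carrier := H\<rparr>) \<and> \<not> comm_group (G\<lparr>carrier := H\<rparr>))"


section \<open>Presentations\<close>

text \<open>The relators form a list, so that ``another relator'' means one at a different position.\<close>

type_synonym 'a presentation = "'a set \<times> 'a word list"

definition normal_closure :: "('a, 'b) monoid_scheme \<Rightarrow> 'a set \<Rightarrow> 'a set" where
  "normal_closure G R =
     generate G {g \<otimes>\<^bsub>G\<^esub> r \<otimes>\<^bsub>G\<^esub> inv\<^bsub>G\<^esub> g | g r. g \<in> carrier G \<and> r \<in> R}"

definition presented_group :: "'a presentation \<Rightarrow> 'a word set monoid" where
  "presented_group P =
     free_group (fst P) Mod normal_closure (free_group (fst P)) (reduce ` set (snd P))"

definition cyclic_permutation :: "'a word \<Rightarrow> 'a word \<Rightarrow> bool" where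
  "cyclic_permutation r s \<longleftrightarrow> (\<exists>k. r = rotate k s)"

text \<open>This notion is meant for presentations all of whose relators are cyclically reduced.\<close>

definition redundant :: "'a presentation \<Rightarrow> bool" where
  "redundant P \<longleftrightarrow>
     (\<exists>i < length (snd P).
        reduce (snd P ! i) = [] \<or>
        (\<exists>j < length (snd P). j \<noteq> i \<and>
           (cyclic_permutation (snd P ! i) (snd P ! j) \<or>
            cyclic_permutation (snd P ! i) (inv_word (snd P ! j)))))"


section \<open>Cyclic presentations\<close>

text \<open>The automorphism \<open>\<theta>\<close> permutes the generators and hence maps reduced words to
  reduced words letter by letter.\<close>

definition shift :: "nat \<Rightarrow> nat word \<Rightarrow> nat word" where
  "shift n = map (\<lambda>(i, e). ((i + 1) mod n, e))"

definition cyclic_presentation :: "nat \<Rightarrow> nat word \<Rightarrow> nat presentation" where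
  "cyclic_presentation n w = ({..<n}, map (\<lambda>k. (shift n ^^ k) w) [0..<n])"

definition cyclically_presented_group :: "nat \<Rightarrow> nat word \<Rightarrow> nat word set monoid" where
  "cyclically_presented_group n w = presented_group (cyclic_presentation n w)"


section \<open>The constructions yield groups\<close>

lemma inv_letter_inv_letter [simp]: "inv_letter (inv_letter x) = x"
  by (simp add: inv_letter_def)

lemma inv_letter_neq [simp]: "inv_letter x \<noteq> x" "x \<noteq> inv_letter x"
  by (auto simp: inv_letter_def prod_eq_iff)

lemma fst_inv_letter [simp]: "fst (inv_letter x) = fst x"
  by (simp add: inv_letter_def)

lemma reduced_Nil [simp]: "reduced []"
  by (simp add: reduced_def)

lemma reduced_Cons: "reduced (x # w) \<longleftrightarrow> reduced w \<and> (w \<noteq> [] \<longrightarrow> hd w \<noteq> inv_letter x)"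
  by (cases w) (auto simp: reduced_def)

lemma reduced_cancel_cons: "reduced w \<Longrightarrow> reduced (cancel_cons x w)"
  by (cases w) (auto simp: reduced_Cons)

lemma reduced_foldr: "reduced w \<Longrightarrow> reduced (foldr cancel_cons u w)"
  by (induction u) (auto intro: reduced_cancel_cons)

lemma reduced_reduce: "reduced (reduce w)"
  by (simp add: reduce_def reduced_foldr)

lemma reduce_reduced: "reduced w \<Longrightarrow> reduce w = w"
proof (induction w)
  case (Cons x w)
  then show ?case by (cases w) (auto simp: reduced_Cons reduce_def)
qed (simp add: reduce_def)

lemma cancel_cons_inverse: "reduced w \<Longrightarrow> cancel_cons x (cancel_cons (inv_letter x) w) = w"
proof (cases w)
  case (Cons y ys)
  assume "reduced w"
  with Cons show ?thesis by (cases ys) (auto simp: reduced_Cons)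
qed simp

lemma foldr_cancel_cons:
  assumes "reduced z"
  shows "foldr cancel_cons (cancel_cons x w) z = cancel_cons x (foldr cancel_cons w z)"
proof (cases w)
  case (Cons y ys)
  then show ?thesis
    using cancel_cons_inverse[OF reduced_foldr[OF assms], of x ys] by auto
qed simp

lemma foldr_reduce:
  "reduced z \<Longrightarrow> foldr cancel_cons (reduce u) z = foldr cancel_cons u z"
  by (induction u) (auto simp: reduce_def foldr_cancel_cons)

lemma reduce_append: "reduce (u @ v) = foldr cancel_cons u (reduce v)"
  by (simp add: reduce_def)

lemma reduce_reduce_append: "reduce (reduce u @ v) = reduce (u @ v)"
  "reduce (u @ reduce v) = reduce (u @ v)"
  by (simp_all add: reduce_append foldr_reduce reduced_reduce reduce_reduced)

lemma letters_reduce: "fst ` set (reduce w) \<subseteq> fst ` set w"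
proof (induction w)
  case (Cons x w)
  have "fst ` set (cancel_cons x v) \<subseteq> insert (fst x) (fst ` set v)" for v
    by (cases v) auto
  then have "fst ` set (reduce (x # w)) \<subseteq> insert (fst x) (fst ` set (reduce w))"
    by (simp add: reduce_def)
  also have "\<dots> \<subseteq> insert (fst x) (fst ` set w)"
    using Cons.IH by (rule insert_mono)
  finally show ?case by simp
qed (simp add: reduce_def)

lemma letters_inv_word: "fst ` set (inv_word w) = fst ` set w"
  by (simp add: inv_word_def image_image)

lemma reduce_inv_word_append: "reduce (inv_word w @ w) = []"
proof (induction w)
  case (Cons x w)
  have "reduce (inv_letter x # x # w) = reduce w"
    using cancel_cons_inverse[of "reduce w" "inv_letter x"]
    by (simp add: reduce_def reduced_foldr)
  then have "reduce (inv_word w @ (inv_letter x # x # w)) = reduce (inv_word w @ w)"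
    by (metis reduce_append)
  with Cons show ?case by (simp add: inv_word_def)
qed (simp add: inv_word_def reduce_def)

theorem group_free_group: "group (free_group S)"
proof (rule groupI)
  fix x y z assume "x \<in> carrier (free_group S)" "y \<in> carrier (free_group S)"
    "z \<in> carrier (free_group S)"
  then show "x \<otimes>\<^bsub>free_group S\<^esub> y \<otimes>\<^bsub>free_group S\<^esub> z =
      x \<otimes>\<^bsub>free_group S\<^esub> (y \<otimes>\<^bsub>free_group S\<^esub> z)"
    by (simp add: free_group_def reduce_reduce_append)
next
  fix x y assume "x \<in> carrier (free_group S)" "y \<in> carrier (free_group S)"
  then show "x \<otimes>\<^bsub>free_group S\<^esub> y \<in> carrier (free_group S)"
    using subset_trans[OF letters_reduce[of "x @ y"], of S]
    by (simp add: free_group_def reduced_reduce image_Un)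
next
  fix x assume x: "x \<in> carrier (free_group S)"
  have "fst ` set (reduce (inv_word x)) \<subseteq> S"
    using x subset_trans[OF letters_reduce[of "inv_word x"], of S]
    by (simp add: free_group_def letters_inv_word)
  then have "reduce (inv_word x) \<in> carrier (free_group S)"
    by (simp add: free_group_def reduced_reduce)
  moreover have "reduce (inv_word x) \<otimes>\<^bsub>free_group S\<^esub> x = \<one>\<^bsub>free_group S\<^esub>"
    by (simp add: free_group_def reduce_reduce_append reduce_inv_word_append)
  ultimately show "\<exists>y\<in>carrier (free_group S). y \<otimes>\<^bsub>free_group S\<^esub> x = \<one>\<^bsub>free_group S\<^esub>"
    by blast
qed (auto simp: free_group_def reduce_reduced)

lemma (in group) normal_normal_closure:
  assumes "R \<subseteq> carrier G"
  shows "normal_closure G R \<lhd> G"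
  unfolding normal_closure_def
proof (rule normal_generateI)
  let ?C = "{g \<otimes> r \<otimes> inv g | g r. g \<in> carrier G \<and> r \<in> R}"
  show "?C \<subseteq> carrier G" using assms by auto
  fix h g assume "h \<in> ?C" and g: "g \<in> carrier G"
  then obtain k r where "h = k \<otimes> r \<otimes> inv k" and k: "k \<in> carrier G" and r: "r \<in> R" by auto
  moreover have "r \<in> carrier G" using r assms by auto
  ultimately have "g \<otimes> h \<otimes> inv g = (g \<otimes> k) \<otimes> r \<otimes> inv (g \<otimes> k)"
    using g by (simp add: inv_mult_group m_assoc)
  then show "g \<otimes> h \<otimes> inv g \<in> ?C" using g k r by blast
qed

theorem group_presented_group:
  assumes "\<And>r. r \<in> set (snd P) \<Longrightarrow> fst ` set r \<subseteq> fst P"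
  shows "group (presented_group P)"
proof -
  have "reduce r \<in> carrier (free_group (fst P))" if "r \<in> set (snd P)" for r
    using subset_trans[OF letters_reduce assms[OF that]] by (simp add: free_group_def reduced_reduce)
  then have "reduce ` set (snd P) \<subseteq> carrier (free_group (fst P))"
    by blast
  then show ?thesis
    unfolding presented_group_def
    by (intro normal.factorgroup_is_group group.normal_normal_closure group_free_group)
qed

lemma letters_shift:
  "n \<ge> 1 \<Longrightarrow> fst ` set w \<subseteq> {..<n} \<Longrightarrow> fst ` set ((shift n ^^ k) w) \<subseteq> {..<n}"
  by (induction k) (auto simp: shift_def)

corollary group_cyclically_presented_group:
  assumes "n \<ge> 1" "w \<in> carrier (free_group {..<n})"
  shows "group (cyclically_presented_group n w)"
  unfolding cyclically_presented_group_def
proof (rule group_presented_group)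
  fix r assume "r \<in> set (snd (cyclic_presentation n w))"
  then obtain k where "r = (shift n ^^ k) w"
    by (auto simp: cyclic_presentation_def)
  then show "fst ` set r \<subseteq> fst (cyclic_presentation n w)"
    using letters_shift[of n w k] assms by (simp add: cyclic_presentation_def free_group_def)
qed

end

theory Submission
  imports Defs "HOL-Library.Countable_Set"
begin

text \<open>If some \<open>\<theta>\<^sup>p(w)\<close> is a cyclic permutation of \<open>w\<close> or its inverse, then for the least such
  \<open>p > 0\<close>, say \<open>d\<close>, a proper divisor of \<open>n\<close>, the first \<open>d \<le> n / 2\<close> relators suffice.

  For \<open>n \<ge> 3\<close> the deficiency is at least two. Some homomorphism from the group to the integers maps
  \<open>x\<^sub>0\<close> to 1. Mapping the generators of its kernel to powers of one element \<open>z\<close>, the relators become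
  linear equations, and a dimension count gives a nonzero solution with finite support. Using it
  twice, far apart and with two free generators in place of \<open>z\<close>, gives a quotient with a free
  subgroup (in the spirit of Baumslag and Pride).

  For \<open>n = 2\<close> the group has two generators and one relator, in which a suitable stable letter has
  exponent sum zero. So it is an HNN extension of a one-relator group with Magnus subgroups
  \<open>A\<close> and \<open>B\<close>, which are free by the Freiheitssatz. If both are proper then ping-pong gives a free
  subgroup. Otherwise either \<open>A\<close> has rank at least two, or the group is metabelian. The Freiheitssatz
  is proved by Magnus' induction on the length of the relator; when no exponent sum vanishes, one of
  the generators is itself made a power of the stable letter.\<close>

section \<open>Evaluation of words\<close>

text \<open>No normal form theorem for HNN extensions is proved. Freeness of a pair passes back from
  any homomorphic image, so it suffices to build, among the permutations of a set, a representation
  that satisfies the relators and in which the base group acts faithfully; ping-pong takes the place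
  of Britton's lemma. Solvability, in contrast, is proved in the presented group itself, from
  relations carried over from the base group. The map \<open>\<phi>\<close> to the integers comes
  from the period \<open>d\<close>: \<open>\<theta>^d(w)\<close> is up to rotation \<open>w\<close>
  or its inverse, with sign \<open>\<epsilon>\<close>, and \<open>\<phi>\<close> sends
  \<open>x_0\<close> to 1, \<open>x_d\<close> to \<open>- \<epsilon>\<close>, the rest to 0. So
  \<open>\<phi>\<close> need not vanish off the stable letter. Instead of a change of basis, the
  rewriting carries the corrections \<open>\<phi> a\<close>; the same device serves the
  Freiheitssatz when no exponent sum vanishes. The split at \<open>n = 2\<close> is forced: a proper
  divisor \<open>d\<close> of \<open>n\<close> satisfies \<open>n - d \<ge> 2\<close> except for
  \<open>n = 2\<close>, \<open>d = 1\<close>. For \<open>n = 1\<close> there is a single non-trivial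
  relator, hence no redundancy.\<close>

definition word_eval :: "('g, 'm) monoid_scheme \<Rightarrow> ('a \<Rightarrow> 'g) \<Rightarrow> 'a word \<Rightarrow> 'g" where
  "word_eval H f w =
     foldr (\<lambda>x g. (if snd x then f (fst x) else inv\<^bsub>H\<^esub> f (fst x)) \<otimes>\<^bsub>H\<^esub> g) w \<one>\<^bsub>H\<^esub>"

lemma word_eval_Nil [simp]: "word_eval H f [] = \<one>\<^bsub>H\<^esub>"
  and word_eval_Cons: "word_eval H f (x # w) =
    (if snd x then f (fst x) else inv\<^bsub>H\<^esub> f (fst x)) \<otimes>\<^bsub>H\<^esub> word_eval H f w"
  by (simp_all add: word_eval_def)

lemma inv_word_Nil [simp]: "inv_word [] = []"
  and inv_word_Cons: "inv_word (x # w) = inv_word w @ [inv_letter x]"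
  and inv_word_append: "inv_word (u @ v) = inv_word v @ inv_word u"
  by (simp_all add: inv_word_def)

lemma word_eval_cong:
  "(\<And>a. a \<in> fst ` set w \<Longrightarrow> f a = g a) \<Longrightarrow> word_eval H f w = word_eval H g w"
  by (induction w) (auto simp: word_eval_Cons)

lemma word_eval_map:
  "word_eval H f (map (\<lambda>(a, e). (h a, e)) w) = word_eval H (f \<circ> h) w"
  by (induction w) (auto simp: word_eval_Cons)

lemma letters_imageI: "w \<in> carrier (free_group S) \<Longrightarrow> f ` S \<subseteq> C \<Longrightarrow> f ` fst ` set w \<subseteq> C"
  by (simp add: free_group_def) blast

context group
begin

lemma word_eval_closed [intro, simp]:
  "f ` fst ` set w \<subseteq> carrier G \<Longrightarrow> word_eval G f w \<in> carrier G"
  by (induction w) (auto simp: word_eval_Cons)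

lemma word_eval_append:
  assumes "f ` fst ` set u \<subseteq> carrier G" "f ` fst ` set v \<subseteq> carrier G"
  shows "word_eval G f (u @ v) = word_eval G f u \<otimes> word_eval G f v"
  using assms
proof (induction u)
  case (Cons x u)
  then have "f (fst x) \<in> carrier G" "word_eval G f u \<in> carrier G" "word_eval G f v \<in> carrier G"
    by auto
  with Cons show ?case
    by (auto simp: word_eval_Cons m_assoc)
qed simp

lemma word_eval_singleton: "f a \<in> carrier G \<Longrightarrow> word_eval G f [(a, True)] = f a"
  by (simp add: word_eval_Cons)

lemma word_eval_inv_word:
  assumes "f ` fst ` set w \<subseteq> carrier G"
  shows "word_eval G f (inv_word w) = inv (word_eval G f w)"
  using assms
proof (induction w)
  case (Cons x w)
  then have x: "f (fst x) \<in> carrier G" and w: "word_eval G f w \<in> carrier G" "f ` fst ` set w \<subseteq> carrier G"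
    by auto
  have "word_eval G f (inv_word (x # w)) = inv (word_eval G f w) \<otimes> word_eval G f [inv_letter x]"
    using x w Cons.IH by (simp add: inv_word_Cons word_eval_append letters_inv_word)
  then show ?case
    using x w by (auto simp: word_eval_Cons inv_letter_def inv_mult_group)
qed simp

lemma word_eval_cancel_cons:
  assumes "f (fst x) \<in> carrier G" "f ` fst ` set w \<subseteq> carrier G"
  shows "word_eval G f (cancel_cons x w) = word_eval G f (x # w)"
proof (cases w)
  case (Cons y ys)
  then have *: "word_eval G f ys \<in> carrier G" "f (fst x) \<in> carrier G"
    using assms by auto
  then have "f (fst x) \<otimes> (inv (f (fst x)) \<otimes> word_eval G f ys) = word_eval G f ys"
    "inv (f (fst x)) \<otimes> (f (fst x) \<otimes> word_eval G f ys) = word_eval G f ys"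
    by (simp_all flip: m_assoc)
  then show ?thesis
    using Cons by (auto simp: word_eval_Cons inv_letter_def)
qed simp

lemma word_eval_reduce:
  assumes "f ` fst ` set w \<subseteq> carrier G"
  shows "word_eval G f (reduce w) = word_eval G f w"
  using assms
proof (induction w)
  case (Cons x w)
  have "f ` fst ` set (reduce w) \<subseteq> carrier G"
    using image_mono[OF letters_reduce[of w], of f] Cons.prems by auto
  then have "word_eval G f (cancel_cons x (reduce w)) = word_eval G f (x # w)"
    using Cons by (simp add: word_eval_cancel_cons word_eval_Cons)
  then show ?case by (simp add: reduce_def)
qed (simp add: reduce_def)

lemma word_eval_hom:
  assumes "f ` S \<subseteq> carrier G"
  shows "word_eval G f \<in> hom (free_group S) G"
proof (rule homI)
  fix u assume "u \<in> carrier (free_group S)"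
  then show "word_eval G f u \<in> carrier G"
    using assms by (intro word_eval_closed) (auto simp: free_group_def)
next
  fix u v assume "u \<in> carrier (free_group S)" "v \<in> carrier (free_group S)"
  then have "f ` fst ` set u \<subseteq> carrier G" "f ` fst ` set v \<subseteq> carrier G"
    using assms by (simp_all add: letters_imageI)
  then show "word_eval G f (u \<otimes>\<^bsub>free_group S\<^esub> v) = word_eval G f u \<otimes> word_eval G f v"
    by (simp add: free_group_def word_eval_append image_Un word_eval_reduce)
qed

lemma word_eval_normal_closure:
  assumes f: "f ` S \<subseteq> carrier G"
    and R: "R \<subseteq> carrier (free_group S)"
    and one: "\<And>r. r \<in> R \<Longrightarrow> word_eval G f r = \<one>"
    and w: "w \<in> normal_closure (free_group S) R"
  shows "word_eval G f w = \<one>"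
proof -
  interpret F: group "free_group S" by (rule group_free_group)
  interpret h: group_hom "free_group S" G "word_eval G f"
    by (intro group_hom.intro group_hom_axioms.intro word_eval_hom f F.group_axioms group_axioms)
  have "normal_closure (free_group S) R \<subseteq> kernel (free_group S) G (word_eval G f)"
    unfolding normal_closure_def
  proof (rule F.generate_subgroup_incl[OF _ h.subgroup_kernel], safe)
    fix g r assume g: "g \<in> carrier (free_group S)" and r: "r \<in> R"
    then have "r \<in> carrier (free_group S)" using R by auto
    then show "g \<otimes>\<^bsub>free_group S\<^esub> r \<otimes>\<^bsub>free_group S\<^esub> inv\<^bsub>free_group S\<^esub> g
        \<in> kernel (free_group S) G (word_eval G f)"
      using g one[OF r] by (simp add: kernel_def)
  qed
  then show ?thesis using w by (auto simp: kernel_def)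
qed

end

lemma (in group_hom) hom_word_eval:
  "f ` fst ` set w \<subseteq> carrier G \<Longrightarrow> h (word_eval G f w) = word_eval H (h \<circ> f) w"
  by (induction w) (auto simp: word_eval_Cons)

lemma inv_free_group_letter:
  assumes "a \<in> S"
  shows "inv\<^bsub>free_group S\<^esub> [(a, True)] = [(a, False)]"
proof -
  interpret F: group "free_group S" by (rule group_free_group)
  show ?thesis
    by (rule F.inv_equality)
      (use assms in \<open>auto simp: free_group_def reduce_def inv_letter_def reduced_def\<close>)
qed

lemma word_eval_free_group:
  assumes "fst ` set w \<subseteq> S"
  shows "word_eval (free_group S) (\<lambda>a. [(a, True)]) w = reduce w"
  using assms
proof (induction w)
  case (Cons x w)
  have "word_eval (free_group S) (\<lambda>a. [(a, True)]) (x # w) = reduce ([x] @ reduce w)"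
    using Cons inv_free_group_letter[of "fst x" S]
    by (cases x) (auto simp: word_eval_Cons free_group_def)
  also have "\<dots> = reduce (x # w)"
    by (simp only: reduce_reduce_append) simp
  finally show ?case .
qed (simp add: free_group_def reduce_def)

section \<open>Presented groups and their universal property\<close>

definition generator :: "'a presentation \<Rightarrow> 'a \<Rightarrow> 'a word set" where
  "generator P a = normal_closure (free_group (fst P)) (reduce ` set (snd P))
     #>\<^bsub>free_group (fst P)\<^esub> [(a, True)]"

lemma reduce_in_free_group: "fst ` set w \<subseteq> S \<Longrightarrow> reduce w \<in> carrier (free_group S)"
  using letters_reduce[of w] by (auto simp: free_group_def reduced_reduce)

locale presentation =
  fixes P :: "'a presentation"
  assumes relators: "\<And>r. r \<in> set (snd P) \<Longrightarrow> fst ` set r \<subseteq> fst P"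
begin

sublocale presented: group "presented_group P"
  by (rule group_presented_group) (rule relators)

abbreviation closure :: "'a word set" where
  "closure \<equiv> normal_closure (free_group (fst P)) (reduce ` set (snd P))"

lemma relators_carrier: "reduce ` set (snd P) \<subseteq> carrier (free_group (fst P))"
  using relators by (auto intro!: reduce_in_free_group)

sublocale closure: normal closure "free_group (fst P)"
  by (intro group.normal_normal_closure group_free_group relators_carrier)

sublocale proj: group_hom "free_group (fst P)" "presented_group P"
    "\<lambda>w. closure #>\<^bsub>free_group (fst P)\<^esub> w"
  using closure.r_coset_hom_Mod
  by (intro group_hom.intro group_hom_axioms.intro group_free_group presented.group_axioms)
    (simp add: presented_group_def)

lemma generator_closed: "a \<in> fst P \<Longrightarrow> generator P a \<in> carrier (presented_group P)"
  unfolding generator_def by (rule proj.hom_closed) (simp add: free_group_def reduced_def)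

lemma word_eval_generator:
  assumes "fst ` set w \<subseteq> fst P"
  shows "word_eval (presented_group P) (generator P) w = closure #>\<^bsub>free_group (fst P)\<^esub> reduce w"
proof -
  have "closure #>\<^bsub>free_group (fst P)\<^esub> reduce w
      = closure #>\<^bsub>free_group (fst P)\<^esub> word_eval (free_group (fst P)) (\<lambda>a. [(a, True)]) w"
    using assms by (simp add: word_eval_free_group)
  also have "\<dots> = word_eval (presented_group P) (generator P) w"
    using assms
    by (subst proj.hom_word_eval) (auto simp: free_group_def generator_def comp_def reduced_def intro!: word_eval_cong)
  finally show ?thesis ..
qed

lemma word_eval_generator_eq_one_iff:
  assumes "fst ` set w \<subseteq> fst P"
  shows "word_eval (presented_group P) (generator P) w = \<one>\<^bsub>presented_group P\<^esub>
    \<longleftrightarrow> reduce w \<in> closure"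
proof -
  have r: "reduce w \<in> carrier (free_group (fst P))"
    by (rule reduce_in_free_group) fact
  have "closure #>\<^bsub>free_group (fst P)\<^esub> reduce w = closure \<longleftrightarrow> reduce w \<in> closure"
    using closure.coset_join1[OF _ r] closure.coset_join2[OF r] closure.subgroup_axioms closure.subset
    by blast
  moreover have "\<one>\<^bsub>presented_group P\<^esub> = closure"
    by (simp add: presented_group_def FactGroup_def)
  ultimately show ?thesis
    using assms by (simp add: word_eval_generator)
qed

lemma generator_relator:
  assumes "r \<in> set (snd P)"
  shows "word_eval (presented_group P) (generator P) r = \<one>\<^bsub>presented_group P\<^esub>"
proof -
  interpret F: group "free_group (fst P)" by (rule group_free_group)
  have "reduce r \<in> carrier (free_group (fst P))"
    using assms relators_carrier by auto
  then have "reduce r \<in> {g \<otimes>\<^bsub>free_group (fst P)\<^esub> s \<otimes>\<^bsub>free_group (fst P)\<^esub> inv\<^bsub>free_group (fst P)\<^esub> g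
      |g s. g \<in> carrier (free_group (fst P)) \<and> s \<in> reduce ` set (snd P)}"
    using assms
    by (intro CollectI exI[of _ "\<one>\<^bsub>free_group (fst P)\<^esub>"] exI[of _ "reduce r"]) auto
  then have "reduce r \<in> closure"
    unfolding normal_closure_def by (rule generate.incl)
  then show ?thesis
    using word_eval_generator_eq_one_iff relators assms by blast
qed

lemma carrier_presented_group:
  assumes "g \<in> carrier (presented_group P)"
  obtains w where "w \<in> carrier (free_group (fst P))" "g = word_eval (presented_group P) (generator P) w"
proof -
  obtain w where w: "w \<in> carrier (free_group (fst P))" "g = closure #>\<^bsub>free_group (fst P)\<^esub> w"
    using assms by (auto simp: presented_group_def FactGroup_def RCOSETS_def)
  moreover have "fst ` set w \<subseteq> fst P" "reduce w = w"
    using w by (auto simp: free_group_def reduce_reduced)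
  ultimately show ?thesis
    by (intro that[of w]) (auto simp: word_eval_generator)
qed

text \<open>Von Dyck's theorem in the form used throughout: relations are transported word by word,
  without naming the induced homomorphism.\<close>

lemma word_eval_consequence:
  assumes H: "group H" and f: "f ` fst P \<subseteq> carrier H"
    and rel: "\<And>r. r \<in> set (snd P) \<Longrightarrow> word_eval H f r = \<one>\<^bsub>H\<^esub>"
    and w: "fst ` set w \<subseteq> fst P"
      "word_eval (presented_group P) (generator P) w = \<one>\<^bsub>presented_group P\<^esub>"
  shows "word_eval H f w = \<one>\<^bsub>H\<^esub>"
proof -
  interpret H: group H by fact
  have "reduce w \<in> closure" using w by (simp add: word_eval_generator_eq_one_iff)
  then have "word_eval H f (reduce w) = \<one>\<^bsub>H\<^esub>"
  proof (rule H.word_eval_normal_closure[OF f relators_carrier, rotated])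
    fix r assume "r \<in> reduce ` set (snd P)"
    then obtain r' where r': "r' \<in> set (snd P)" "r = reduce r'" by auto
    then show "word_eval H f r = \<one>\<^bsub>H\<^esub>"
      using rel[OF r'(1)] relators[OF r'(1)] f by (simp add: H.word_eval_reduce subset_trans[OF image_mono])
  qed
  moreover have "f ` fst ` set w \<subseteq> carrier H" using w(1) f by blast
  ultimately show ?thesis by (simp add: H.word_eval_reduce)
qed

end

section \<open>Free subgroups\<close>

text \<open>A family rather than a set, so that words may be written over any index type. Distinct
  indices have distinct values, because \<open>[(a, True), (b, False)]\<close> is reduced for
  \<open>a \<noteq> b\<close>.\<close>

definition free_family :: "('g, 'm) monoid_scheme \<Rightarrow> ('a \<Rightarrow> 'g) \<Rightarrow> 'a set \<Rightarrow> bool" where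
  "free_family G f S \<longleftrightarrow> f ` S \<subseteq> carrier G \<and>
     (\<forall>w. reduced w \<and> fst ` set w \<subseteq> S \<and> word_eval G f w = \<one>\<^bsub>G\<^esub> \<longrightarrow> w = [])"

lemma reduced_map_inj:
  assumes "inj_on h (fst ` set w)"
  shows "reduced (map (\<lambda>(a, e). (h a, e)) w) \<longleftrightarrow> reduced w"
  using assms
proof (induction w)
  case (Cons x w)
  note prems = Cons.prems
  from Cons have IH: "reduced (map (\<lambda>(a, e). (h a, e)) w) \<longleftrightarrow> reduced w"
    by (simp add: inj_on_subset[OF _ subset_insertI])
  show ?case
  proof (cases w)
    case Nil
    then show ?thesis by (simp add: reduced_def)
  next
    case (Cons y ys)
    then have "h (fst y) = h (fst x) \<longleftrightarrow> fst y = fst x"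
      using inj_on_eq_iff[OF prems, of "fst y" "fst x"] by simp
    then show ?thesis
      using IH Cons by (cases x; cases y) (simp add: reduced_Cons inv_letter_def)
  qed
qed simp

lemma (in group) free_family_inj:
  assumes "free_family G f S"
  shows "inj_on f S"
proof (rule inj_onI, rule ccontr)
  fix a b assume ab: "a \<in> S" "b \<in> S" "f a = f b" "a \<noteq> b"
  then have "f a \<in> carrier G" using assms by (auto simp: free_family_def)
  then have "word_eval G f [(a, True), (b, False)] = \<one>"
    using ab by (simp add: word_eval_Cons)
  moreover have "reduced [(a, True), (b, False)]"
    using ab by (simp add: reduced_def inv_letter_def)
  ultimately show False
    using assms ab unfolding free_family_def by fastforce
qed

lemma (in group) free_family_word_eval_inj:
  assumes "free_family G f S"
  shows "inj_on (word_eval G f) (carrier (free_group S))"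
proof -
  interpret F: group "free_group S" by (rule group_free_group)
  interpret h: group_hom "free_group S" G "word_eval G f"
    using assms
    by (intro group_hom.intro group_hom_axioms.intro word_eval_hom F.group_axioms group_axioms)
      (simp add: free_family_def)
  show ?thesis
  proof (rule h.inj_on_one_iff[THEN iffD2], safe)
    fix w assume "w \<in> carrier (free_group S)" "word_eval G f w = \<one>"
    then show "w = \<one>\<^bsub>free_group S\<^esub>"
      using assms by (auto simp: free_family_def free_group_def)
  qed
qed

text \<open>\<open>is_free_group\<close> asks for a basis in the type of the group, so the family is
  first reindexed by its own range.\<close>

lemma (in group) free_family_contains:
  fixes f :: "bool \<Rightarrow> 'a"
  assumes free: "free_family G f UNIV"
  shows "contains_nonabelian_free_subgroup G"
proof -
  define S where "S = range f"
  define g where "g = inv_into UNIV f"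
  have f: "f b \<in> carrier G" for b using free by (auto simp: free_family_def)
  have gf: "g (f b) = b" for b using free_family_inj[OF free] by (simp add: g_def)
  have g_inj: "inj_on g S" by (auto intro!: inj_onI simp: S_def gf)
  have fg: "f (g x) = x" if "x \<in> S" for x using that by (auto simp: S_def gf)
  have id: "free_family G (\<lambda>x. x) S"
    unfolding free_family_def
  proof (intro conjI allI impI)
    show "(\<lambda>x. x) ` S \<subseteq> carrier G" using f by (auto simp: S_def)
  next
    fix w assume w: "reduced w \<and> fst ` set w \<subseteq> S \<and> word_eval G (\<lambda>x. x) w = \<one>"
    have "inj_on g (fst ` set w)"
      using w g_inj inj_on_subset by blast
    then have "reduced (map (\<lambda>(a, e). (g a, e)) w)"
      using w by (simp add: reduced_map_inj)
    moreover have "word_eval G f (map (\<lambda>(a, e). (g a, e)) w) = \<one>"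
    proof -
      have "word_eval G (f \<circ> g) w = word_eval G (\<lambda>x. x) w"
        using w fg by (intro word_eval_cong) (simp add: subset_iff)
      then show ?thesis using w by (simp add: word_eval_map)
    qed
    ultimately have "map (\<lambda>(a, e). (g a, e)) w = []"
      using free unfolding free_family_def by blast
    then show "w = []" by simp
  qed
  interpret F: group "free_group S" by (rule group_free_group)
  interpret h: group_hom "free_group S" G "word_eval G (\<lambda>x. x)"
    using id
    by (intro group_hom.intro group_hom_axioms.intro word_eval_hom F.group_axioms group_axioms)
      (simp add: free_family_def)
  let ?H = "word_eval G (\<lambda>x. x) ` carrier (free_group S)"
  have H: "subgroup ?H G" by (rule h.img_is_subgroup)
  have iso: "word_eval G (\<lambda>x. x) \<in> iso (free_group S) (G\<lparr>carrier := ?H\<rparr>)"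
    using free_family_word_eval_inj[OF id] h.hom_mult by (auto simp: iso_def hom_def bij_betw_def)
  have "is_free_group (G\<lparr>carrier := ?H\<rparr>)"
    unfolding is_free_group_def is_iso_def
    using subgroup_imp_group[OF H] iso by blast
  moreover have "\<not> comm_group (G\<lparr>carrier := ?H\<rparr>)"
  proof
    assume "comm_group (G\<lparr>carrier := ?H\<rparr>)"
    then interpret C: comm_group "G\<lparr>carrier := ?H\<rparr>" .
    have in_H: "f b \<in> ?H" for b
      using word_eval_singleton[of "\<lambda>x. x" "f b"] f
      by (intro image_eqI[where x = "[(f b, True)]"]) (auto simp: free_group_def S_def reduced_def)
    have comm: "f True \<otimes> f False = f False \<otimes> f True"
      using C.m_comm in_H by simp
    \<comment> \<open>The commutator is a non-empty reduced word; commuting values would make it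
      trivial.\<close>
    have "word_eval G f [(True, True), (False, True), (True, False), (False, False)] =
        (f True \<otimes> f False) \<otimes> (inv (f True) \<otimes> inv (f False))"
      using f by (simp add: word_eval_Cons m_assoc)
    also have "inv (f True) \<otimes> inv (f False) = inv (f True \<otimes> f False)"
      using f comm by (simp add: inv_mult_group)
    also have "(f True \<otimes> f False) \<otimes> inv (f True \<otimes> f False) = \<one>"
      using f by simp
    finally have "word_eval G f [(True, True), (False, True), (True, False), (False, False)] = \<one>" .
    moreover have "reduced [(True, True), (False, True), (True, False), (False, False)]"
      by (simp add: reduced_def inv_letter_def)
    ultimately show False
      using free unfolding free_family_def by blast
  qed
  ultimately show ?thesis
    unfolding contains_nonabelian_free_subgroup_def using H by blast
qed

definition subst_word :: "('a \<Rightarrow> 'b word) \<Rightarrow> 'a word \<Rightarrow> 'b word" where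
  "subst_word u w = concat (map (\<lambda>(a, e). if e then u a else inv_word (u a)) w)"

lemma letters_subst_word: "fst ` set (subst_word u w) \<subseteq> (\<Union>a\<in>fst ` set w. fst ` set (u a))"
proof (induction w)
  case (Cons x w)
  have "fst ` set (subst_word u (x # w)) = fst ` set (u (fst x)) \<union> fst ` set (subst_word u w)"
    by (cases x) (simp add: subst_word_def image_Un letters_inv_word)
  then show ?case using Cons.IH by auto
qed (simp add: subst_word_def)

lemma (in group) word_eval_subst_word:
  assumes "\<And>a. f ` fst ` set (u a) \<subseteq> carrier G"
  shows "word_eval G f (subst_word u w) = word_eval G (\<lambda>a. word_eval G f (u a)) w"
proof (induction w)
  case (Cons x w)
  have "f ` fst ` set (subst_word u w) \<subseteq> carrier G"
    using letters_subst_word[of u w] assms by blast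
  then show ?case
    using Cons assms
    by (cases x) (auto simp: subst_word_def word_eval_Cons word_eval_append word_eval_inv_word letters_inv_word)
qed (simp add: subst_word_def)

text \<open>Free pairs lift from images: a relation between the lifted elements, spelled out in the
  generators by \<open>subst_word\<close>, would also hold between their images in
  \<open>H\<close>.\<close>

lemma (in presentation) contains_nonabelian_free_subgroupI:
  fixes u :: "bool \<Rightarrow> 'a word"
  assumes H: "group H" and f: "f ` fst P \<subseteq> carrier H"
    and rel: "\<And>r. r \<in> set (snd P) \<Longrightarrow> word_eval H f r = \<one>\<^bsub>H\<^esub>"
    and u: "\<And>b. fst ` set (u b) \<subseteq> fst P"
    and free: "free_family H (\<lambda>b. word_eval H f (u b)) UNIV"
  shows "contains_nonabelian_free_subgroup (presented_group P)"
proof (rule presented.free_family_contains)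
  interpret H: group H by fact
  let ?g = "\<lambda>b. word_eval (presented_group P) (generator P) (u b)"
  have gen: "generator P ` fst ` set (u b) \<subseteq> carrier (presented_group P)" for b
    using u[of b] generator_closed by blast
  have fu: "f ` fst ` set (u b) \<subseteq> carrier H" for b
    using u[of b] f by blast
  show "free_family (presented_group P) ?g UNIV"
    unfolding free_family_def
  proof (intro conjI allI impI)
    show "range ?g \<subseteq> carrier (presented_group P)"
      using gen by auto
  next
    fix w assume w: "reduced w \<and> fst ` set w \<subseteq> UNIV \<and> word_eval (presented_group P) ?g w = \<one>\<^bsub>presented_group P\<^esub>"
    have "fst ` set (subst_word u w) \<subseteq> fst P"
      using letters_subst_word[of u w] u by blast
    moreover have "word_eval (presented_group P) (generator P) (subst_word u w) = \<one>\<^bsub>presented_group P\<^esub>"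
      using w gen by (simp add: presented.word_eval_subst_word)
    ultimately have "word_eval H f (subst_word u w) = \<one>\<^bsub>H\<^esub>"
      using word_eval_consequence[OF H f rel] by blast
    then have "word_eval H (\<lambda>b. word_eval H f (u b)) w = \<one>\<^bsub>H\<^esub>"
      using fu by (simp add: H.word_eval_subst_word)
    then show "w = []" using free w by (auto simp: free_family_def)
  qed
qed

section \<open>Permutation groups and HNN extensions\<close>

definition perms :: "('x \<Rightarrow> 'x) monoid" where
  "perms = \<lparr>carrier = {f. bij f}, monoid.mult = (\<circ>), one = id\<rparr>"

lemma carrier_perms [simp]: "f \<in> carrier perms \<longleftrightarrow> bij f"
  and mult_perms [simp]: "f \<otimes>\<^bsub>perms\<^esub> g = f \<circ> g"
  and one_perms [simp]: "\<one>\<^bsub>perms\<^esub> = id"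
  by (simp_all add: perms_def)

lemma group_perms: "group perms"
proof (rule groupI)
  fix f :: "'x \<Rightarrow> 'x" assume "f \<in> carrier perms"
  then show "\<exists>g\<in>carrier perms. g \<otimes>\<^bsub>perms\<^esub> f = \<one>\<^bsub>perms\<^esub>"
    by (intro bexI[of _ "inv_into UNIV f"]) (auto simp: bij_imp_bij_inv bij_is_inj)
qed (auto simp: bij_comp comp_assoc)

interpretation perms: group perms
  by (rule group_perms)

lemma inv_perms [simp]: "bij f \<Longrightarrow> inv\<^bsub>perms\<^esub> f = inv_into UNIV f"
  by (rule perms.inv_equality) (auto simp: bij_imp_bij_inv bij_is_inj)

text \<open>The left regular representation on countably many copies of the group; the copies supply
  infinitely many orbits. Points off the carrier stay fixed, which makes each translation a
  bijection of the whole type.\<close>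

definition translation :: "('g, 'm) monoid_scheme \<Rightarrow> 'g \<Rightarrow> 'g \<times> nat \<Rightarrow> 'g \<times> nat" where
  "translation G g = (\<lambda>(x, n). (if x \<in> carrier G then g \<otimes>\<^bsub>G\<^esub> x else x, n))"

lemma snd_translation [simp]: "snd (translation G g x) = snd x"
  by (cases x) (simp add: translation_def)

context group
begin

lemma translation_mult:
  "g \<in> carrier G \<Longrightarrow> h \<in> carrier G \<Longrightarrow> translation G (g \<otimes> h) = translation G g \<circ> translation G h"
  by (auto simp: translation_def m_assoc)

lemma translation_one: "translation G \<one> = id"
  by (auto simp: translation_def)

lemma translation_inv:
  assumes "g \<in> carrier G"
  shows "translation G g (translation G (inv g) x) = x" "translation G (inv g) (translation G g x) = x"
  using assms by (auto simp: translation_def split: prod.splits simp flip: m_assoc)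

lemma bij_translation: "g \<in> carrier G \<Longrightarrow> bij (translation G g)"
  by (rule bij_betw_byWitness[of _ "translation G (inv g)"]) (auto simp: translation_inv)

lemma inv_translation: "g \<in> carrier G \<Longrightarrow> inv_into UNIV (translation G g) = translation G (inv g)"
  by (rule Hilbert_Choice.inv_equality) (auto simp: translation_inv)

lemma translation_hom: "translation G \<in> hom G perms"
  by (auto intro!: homI simp: bij_translation translation_mult)

lemma group_hom_translation: "group_hom G perms (translation G)"
  by (intro group_hom.intro group_hom_axioms.intro translation_hom group_perms group_axioms)

lemma translation_eq_id_iff: "g \<in> carrier G \<Longrightarrow> translation G g = id \<longleftrightarrow> g = \<one>"
proof
  assume "g \<in> carrier G" "translation G g = id"
  then have "fst (translation G g (\<one>, 0)) = \<one>" by simp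
  with \<open>g \<in> carrier G\<close> show "g = \<one>" by (simp add: translation_def)
qed (simp add: translation_one)

text \<open>\<open>Q\<close> acts freely on \<open>U\<close>, since \<open>a\<close> is injective
  and products cancel. Translations keep the second coordinate, so infinitely many occupied levels
  force infinitely many orbits.\<close>

lemma transversal:
  fixes Q
  assumes "group Q" and a: "a \<in> hom Q G" "inj_on a (carrier Q)"
    and U: "U \<subseteq> carrier G \<times> UNIV" "\<And>q x. q \<in> carrier Q \<Longrightarrow> x \<in> U \<Longrightarrow> translation G (a q) x \<in> U"
    and inf: "infinite (snd ` U)"
  obtains R where "R \<subseteq> U" "infinite R"
    "bij_betw (\<lambda>(q, r). translation G (a q) r) (carrier Q \<times> R) U"
proof -
  interpret Q: group Q by fact
  interpret a: group_hom Q G a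
    by (intro group_hom.intro group_hom_axioms.intro a Q.group_axioms group_axioms)
  define orb where "orb x = {y \<in> U. \<exists>q\<in>carrier Q. x = translation G (a q) y}" for x
  define rep where "rep x = (SOME y. y \<in> orb x)" for x
  have orb_refl: "x \<in> orb x" if "x \<in> U" for x
    unfolding orb_def using that by (auto intro!: bexI[of _ "\<one>\<^bsub>Q\<^esub>"] simp: translation_one)
  have rep: "rep x \<in> orb x" if "x \<in> U" for x
    unfolding rep_def using orb_refl[OF that] by (rule someI)
  have orb_sub: "orb x \<subseteq> orb (translation G (a q) x)" if "q \<in> carrier Q" for q x
  proof
    fix y assume "y \<in> orb x"
    then obtain p where p: "p \<in> carrier Q" "x = translation G (a p) y" "y \<in> U" by (auto simp: orb_def)
    then have "translation G (a q) x = translation G (a (q \<otimes>\<^bsub>Q\<^esub> p)) y"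
      using that by (simp add: translation_mult)
    then show "y \<in> orb (translation G (a q) x)"
      using p that by (auto simp: orb_def intro!: bexI[of _ "q \<otimes>\<^bsub>Q\<^esub> p"])
  qed
  have orb_eq: "orb (translation G (a q) x) = orb x" if q: "q \<in> carrier Q" for q x
    using orb_sub[OF q, of x] orb_sub[OF Q.inv_closed[OF q], of "translation G (a q) x"] q
    by (auto simp: translation_inv)
  have rep_eq: "rep (translation G (a q) x) = rep x" if "q \<in> carrier Q" for q x
    using orb_eq[OF that] by (simp add: rep_def)
  have rep_rep: "rep (rep x) = rep x" if x: "x \<in> U" for x
    using rep[OF x] rep_eq unfolding orb_def mem_Collect_eq by metis
  have "bij_betw (\<lambda>(q, r). translation G (a q) r) (carrier Q \<times> rep ` U) U"
    unfolding bij_betw_def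
  proof (intro conjI equalityI subsetI inj_onI)
    fix z z' assume zz: "z \<in> carrier Q \<times> rep ` U" "z' \<in> carrier Q \<times> rep ` U"
      "(\<lambda>(q, r). translation G (a q) r) z = (\<lambda>(q, r). translation G (a q) r) z'"
    obtain q r q' r' where z: "z = (q, r)" "z' = (q', r')" by (cases z; cases z')
    then have q: "q \<in> carrier Q" "q' \<in> carrier Q" and eq: "translation G (a q) r = translation G (a q') r'"
      and r: "r \<in> rep ` U" "r' \<in> rep ` U"
      using zz by auto
    have "rep r = rep r'"
      using rep_eq[OF q(1), of r] rep_eq[OF q(2), of r'] eq by simp
    then have "r = r'" using r rep_rep by auto
    have "r \<in> carrier G \<times> UNIV" using r rep U by (auto simp: orb_def)
    then have "a q = a q'"
      using eq q \<open>r = r'\<close> by (auto simp: translation_def)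
    then show "z = z'" using z q \<open>r = r'\<close> inj_onD[OF a(2)] by auto
  next
    fix x assume "x \<in> (\<lambda>(q, r). translation G (a q) r) ` (carrier Q \<times> rep ` U)"
    then obtain q y where qy: "q \<in> carrier Q" "y \<in> U" "x = translation G (a q) (rep y)" by auto
    then have "rep y \<in> U" using rep[of y] by (simp add: orb_def)
    then show "x \<in> U" using U(2) qy by blast
  next
    fix x assume x: "x \<in> U"
    then obtain q where "q \<in> carrier Q" "x = translation G (a q) (rep x)"
      using rep[OF x] unfolding orb_def by blast
    then show "x \<in> (\<lambda>(q, r). translation G (a q) r) ` (carrier Q \<times> rep ` U)"
      using x by (intro image_eqI[of _ _ "(q, rep x)"]) auto
  qed
  moreover have "snd ` U \<subseteq> snd ` rep ` U"
  proof
    fix n assume "n \<in> snd ` U"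
    then obtain x where x: "x \<in> U" "n = snd x" by auto
    then obtain q where "x = translation G (a q) (rep x)"
      using rep[OF x(1)] unfolding orb_def by blast
    then have "snd x = snd (rep x)" by (metis snd_translation)
    then show "n \<in> snd ` rep ` U" using x by auto
  qed
  then have "infinite (rep ` U)"
    using inf finite_surj by blast
  moreover have "rep ` U \<subseteq> U" using rep by (auto simp: orb_def)
  ultimately show ?thesis using that by blast
qed

text \<open>Two free actions of \<open>Q\<close> with countably infinitely many orbits are
  isomorphic: match the transversals and extend equivariantly.\<close>

lemma equivariant_bij:
  fixes Q
  assumes Q: "group Q" and count: "countable (carrier G)"
    and a: "a \<in> hom Q G" "inj_on a (carrier Q)" and b: "b \<in> hom Q G" "inj_on b (carrier Q)"
    and U: "U \<subseteq> carrier G \<times> UNIV" "\<And>q x. q \<in> carrier Q \<Longrightarrow> x \<in> U \<Longrightarrow> translation G (a q) x \<in> U"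
      "infinite (snd ` U)"
    and V: "V \<subseteq> carrier G \<times> UNIV" "\<And>q x. q \<in> carrier Q \<Longrightarrow> x \<in> V \<Longrightarrow> translation G (b q) x \<in> V"
      "infinite (snd ` V)"
  obtains \<tau> where "bij_betw \<tau> U V"
    "\<And>q x. q \<in> carrier Q \<Longrightarrow> x \<in> U \<Longrightarrow> \<tau> (translation G (a q) x) = translation G (b q) (\<tau> x)"
proof -
  interpret Q: group Q by fact
  obtain R where R: "R \<subseteq> U" "infinite R"
    and bijR: "bij_betw (\<lambda>(q, r). translation G (a q) r) (carrier Q \<times> R) U" (is "bij_betw ?A _ _")
    using transversal[OF Q a U] .
  obtain S where S: "S \<subseteq> V" "infinite S"
    and bijS: "bij_betw (\<lambda>(q, r). translation G (b q) r) (carrier Q \<times> S) V" (is "bij_betw ?B _ _")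
    using transversal[OF Q b V] .
  have "countable (carrier G \<times> (UNIV :: nat set))"
    using count by simp
  then have "countable R" "countable S"
    using R S U V by (meson countable_subset order_trans)+
  then obtain f g where "bij_betw f R (UNIV :: nat set)" "bij_betw g S (UNIV :: nat set)"
    using R S countableE_infinite by metis
  then have \<beta>: "bij_betw (inv_into S g \<circ> f) R S" (is "bij_betw ?\<beta> _ _")
    by (meson bij_betw_inv_into bij_betw_trans)
  let ?\<gamma> = "\<lambda>(q, r). (q, ?\<beta> r)"
  have \<gamma>: "bij_betw ?\<gamma> (carrier Q \<times> R) (carrier Q \<times> S)"
    using bij_betw_map_prod[OF bij_betw_id \<beta>] by (simp add: map_prod_def id_def)
  define \<tau> where "\<tau> = ?B \<circ> (?\<gamma> \<circ> inv_into (carrier Q \<times> R) ?A)"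
  have "bij_betw \<tau> U V"
    unfolding \<tau>_def using bij_betw_inv_into[OF bijR] \<gamma> bijS by (meson bij_betw_trans)
  moreover have "\<tau> (translation G (a q) x) = translation G (b q) (\<tau> x)"
    if q: "q \<in> carrier Q" and x: "x \<in> U" for q x
  proof -
    have val: "\<tau> (?A (p, r)) = translation G (b p) (?\<beta> r)" if "p \<in> carrier Q" "r \<in> R" for p r
    proof -
      have "inv_into (carrier Q \<times> R) ?A (?A (p, r)) = (p, r)"
        by (rule inv_into_f_f) (use bijR that in \<open>auto simp: bij_betw_def\<close>)
      then show ?thesis by (simp add: \<tau>_def)
    qed
    obtain p r where pr: "p \<in> carrier Q" "r \<in> R" "x = ?A (p, r)"
      using x bijR by (auto simp: bij_betw_def)
    have "a p \<in> carrier G" "a q \<in> carrier G" "b p \<in> carrier G" "b q \<in> carrier G"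
      using pr q a b by (auto simp: hom_def)
    moreover have "a (q \<otimes>\<^bsub>Q\<^esub> p) = a q \<otimes> a p" "b (q \<otimes>\<^bsub>Q\<^esub> p) = b q \<otimes> b p"
      using pr q a b by (auto simp: hom_def)
    ultimately have "translation G (a q) x = ?A (q \<otimes>\<^bsub>Q\<^esub> p, r)"
      "translation G (b q) (translation G (b p) (?\<beta> r)) = translation G (b (q \<otimes>\<^bsub>Q\<^esub> p)) (?\<beta> r)"
      using pr by (simp_all add: translation_mult)
    then show ?thesis
      using val[of "q \<otimes>\<^bsub>Q\<^esub> p" r] val[of p r] pr q by simp
  qed
  ultimately show ?thesis using that by blast
qed

text \<open>An HNN extension is replaced by a permutation \<open>\<tau>\<close> of countably many copies of the base group
  that conjugates the action of one subgroup into the action of the other. The image condition makes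
  \<open>\<tau>\<close> play ping-pong.\<close>

lemma stable_permutation:
  fixes Q
  assumes Q: "group Q" and count: "countable (carrier G)"
    and a: "a \<in> hom Q G" "inj_on a (carrier Q)" and b: "b \<in> hom Q G" "inj_on b (carrier Q)"
  obtains \<tau> where "bij \<tau>"
    "\<And>q. q \<in> carrier Q \<Longrightarrow> \<tau> \<circ> translation G (a q) = translation G (b q) \<circ> \<tau>"
    "\<tau> ` (carrier G \<times> UNIV) = carrier G \<times> UNIV"
    "\<tau> ` (carrier G \<times> UNIV - a ` carrier Q \<times> {n. n mod 3 = 1}) = b ` carrier Q \<times> {n. n mod 3 = 0}"
proof -
  interpret Q: group Q by fact
  interpret a: group_hom Q G a
    by (intro group_hom.intro group_hom_axioms.intro a Q.group_axioms group_axioms)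
  interpret b: group_hom Q G b
    by (intro group_hom.intro group_hom_axioms.intro b Q.group_axioms group_axioms)
  let ?X = "carrier G \<times> (UNIV :: nat set)"
  \<comment> \<open>\<open>\<tau>\<close> is glued from equivariant bijections of \<open>M\<close>
    onto \<open>?X - P\<close> and of \<open>?X - M\<close> onto \<open>P\<close>, so it throws
    everything outside \<open>M\<close> into \<open>P\<close>. The residues keep \<open>M\<close>
    and \<open>P\<close> disjoint; the levels of residue 2 keep both complements infinite, even when
    \<open>a\<close> or \<open>b\<close> is onto.\<close>
  define M where "M = a ` carrier Q \<times> {n::nat. n mod 3 = 1}"
  define P where "P = b ` carrier Q \<times> {n::nat. n mod 3 = 0}"
  have inf: "infinite {n::nat. n mod 3 = k}" if "k < 3" for k
  proof -
    have "range (\<lambda>i. 3 * i + k) \<subseteq> {n. n mod 3 = k}" using that by auto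
    moreover have "infinite (range (\<lambda>i::nat. 3 * i + k))"
      by (rule range_inj_infinite) (auto intro!: injI)
    ultimately show ?thesis using infinite_super by blast
  qed
  have MX: "M \<subseteq> ?X" and PX: "P \<subseteq> ?X" by (auto simp: M_def P_def)
  have M_act: "translation G (a q) x \<in> M \<longleftrightarrow> x \<in> M" if "q \<in> carrier Q" "x \<in> ?X" for q x
  proof -
    have "a q \<otimes> y \<in> a ` carrier Q \<longleftrightarrow> y \<in> a ` carrier Q" if "y \<in> carrier G" for y
      using subgroup.m_closed[OF a.img_is_subgroup, of "a q" y]
        subgroup.m_closed[OF a.img_is_subgroup, of "inv (a q)" "a q \<otimes> y"]
        subgroup.m_inv_closed[OF a.img_is_subgroup, of "a q"] that \<open>q \<in> carrier Q\<close>
      by (auto simp flip: m_assoc)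
    then show ?thesis using that by (cases x) (simp add: translation_def M_def P_def)
  qed
  have P_act: "translation G (b q) x \<in> P \<longleftrightarrow> x \<in> P" if "q \<in> carrier Q" "x \<in> ?X" for q x
  proof -
    have "b q \<otimes> y \<in> b ` carrier Q \<longleftrightarrow> y \<in> b ` carrier Q" if "y \<in> carrier G" for y
      using subgroup.m_closed[OF b.img_is_subgroup, of "b q" y]
        subgroup.m_closed[OF b.img_is_subgroup, of "inv (b q)" "b q \<otimes> y"]
        subgroup.m_inv_closed[OF b.img_is_subgroup, of "b q"] that \<open>q \<in> carrier Q\<close>
      by (auto simp flip: m_assoc)
    then show ?thesis using that by (cases x) (simp add: translation_def M_def P_def)
  qed
  have X_act: "translation G g x \<in> ?X" if "g \<in> carrier G" "x \<in> ?X" for g x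
    using that by (auto simp: translation_def)
  have one_ab: "\<one> \<in> a ` carrier Q" "\<one> \<in> b ` carrier Q"
    using a.hom_one b.hom_one Q.one_closed by (metis imageI)+
  have snd_sub: "{n. n mod 3 = 0} \<subseteq> snd ` P" "{n. n mod 3 = 1} \<subseteq> snd ` M"
    "{n. n mod 3 = 2} \<subseteq> snd ` (?X - P)" "{n. n mod 3 = 2} \<subseteq> snd ` (?X - M)"
    using one_ab unfolding M_def P_def by (force intro: image_eqI[of _ _ "(\<one>, n)" for n])+
  obtain \<tau>1 where \<tau>1: "bij_betw \<tau>1 M (?X - P)"
    "\<And>q x. q \<in> carrier Q \<Longrightarrow> x \<in> M \<Longrightarrow> \<tau>1 (translation G (a q) x) = translation G (b q) (\<tau>1 x)"
  proof (rule equivariant_bij[OF Q count a b, where U = M and V = "?X - P"])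
    show "infinite (snd ` M)" "infinite (snd ` (?X - P))"
      using infinite_super[OF snd_sub(2) inf] infinite_super[OF snd_sub(3) inf] by simp_all
    show "translation G (a q) x \<in> M" if "q \<in> carrier Q" "x \<in> M" for q x
      using M_act[OF that(1)] MX that(2) by blast
    show "translation G (b q) x \<in> ?X - P" if "q \<in> carrier Q" "x \<in> ?X - P" for q x
      using P_act[OF that(1), of x] X_act[OF b.hom_closed[OF that(1)], of x] that(2) by blast
  qed (use MX in blast)+
  obtain \<tau>2 where \<tau>2: "bij_betw \<tau>2 (?X - M) P"
    "\<And>q x. q \<in> carrier Q \<Longrightarrow> x \<in> ?X - M \<Longrightarrow> \<tau>2 (translation G (a q) x) = translation G (b q) (\<tau>2 x)"
  proof (rule equivariant_bij[OF Q count a b, where U = "?X - M" and V = P])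
    show "infinite (snd ` P)" "infinite (snd ` (?X - M))"
      using infinite_super[OF snd_sub(1) inf] infinite_super[OF snd_sub(4) inf] by simp_all
    show "translation G (b q) x \<in> P" if "q \<in> carrier Q" "x \<in> P" for q x
      using P_act[OF that(1)] PX that(2) by blast
    show "translation G (a q) x \<in> ?X - M" if "q \<in> carrier Q" "x \<in> ?X - M" for q x
      using M_act[OF that(1), of x] X_act[OF a.hom_closed[OF that(1)], of x] that(2) by blast
  qed (use PX in blast)+
  define \<tau> where "\<tau> x = (if x \<in> ?X then if x \<in> M then \<tau>1 x else \<tau>2 x else x)" for x
  have \<tau>M: "bij_betw \<tau> M (?X - P)"
    by (rule bij_betw_cong[THEN iffD1, OF _ \<tau>1(1)]) (simp add: \<tau>_def subsetD[OF MX])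
  have \<tau>P: "bij_betw \<tau> (?X - M) P"
    by (rule bij_betw_cong[THEN iffD1, OF _ \<tau>2(1)]) (simp add: \<tau>_def)
  have "bij_betw \<tau> (M \<union> (?X - M)) ((?X - P) \<union> P)"
    by (rule bij_betw_combine[OF \<tau>M \<tau>P]) auto
  moreover have "M \<union> (?X - M) = ?X" "(?X - P) \<union> P = ?X" using MX PX by auto
  ultimately have \<tau>X: "bij_betw \<tau> ?X ?X" by simp
  moreover have "bij_betw \<tau> (- ?X) (- ?X)"
    by (rule bij_betw_cong[THEN iffD1, OF _ bij_betw_id]) (auto simp: \<tau>_def)
  ultimately have "bij_betw \<tau> (?X \<union> - ?X) (?X \<union> - ?X)"
    by (rule bij_betw_combine) auto
  then have "bij \<tau>" by (simp only: Compl_partition)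
  moreover have "\<tau> \<circ> translation G (a q) = translation G (b q) \<circ> \<tau>" if q: "q \<in> carrier Q" for q
  proof
    fix x
    show "(\<tau> \<circ> translation G (a q)) x = (translation G (b q) \<circ> \<tau>) x"
    proof (cases "x \<in> ?X")
      case True
      then have "translation G (a q) x \<in> ?X" using X_act[OF a.hom_closed[OF q]] by blast
      then show ?thesis
        using True M_act[OF q True] \<tau>1(2)[OF q, of x] \<tau>2(2)[OF q, of x] by (simp add: \<tau>_def)
    next
      case False
      then show ?thesis by (cases x) (simp add: \<tau>_def translation_def)
    qed
  qed
  ultimately show ?thesis
    using that[of \<tau>] \<tau>X \<tau>P by (simp add: bij_betw_def M_def P_def)
qed

end

text \<open>\<open>A l\<close> collects the points reached by words that begin with
  \<open>l\<close>. By induction a non-empty reduced word moves \<open>x\<close> into the set of its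
  first letter, hence away from \<open>x\<close>.\<close>

lemma ping_pong:
  fixes f :: "'a \<Rightarrow> 'x \<Rightarrow> 'x" and A :: "'a letter \<Rightarrow> 'x set"
  assumes bij: "\<And>a. bij (f a)"
    and pos: "\<And>a x. x \<in> X \<Longrightarrow> x \<notin> A (a, False) \<Longrightarrow> f a x \<in> A (a, True)"
    and neg: "\<And>a x. x \<in> X \<Longrightarrow> x \<notin> A (a, True) \<Longrightarrow> inv_into UNIV (f a) x \<in> A (a, False)"
    and sub: "\<And>l. A l \<subseteq> X" and disj: "\<And>l l'. l \<noteq> l' \<Longrightarrow> A l \<inter> A l' = {}"
    and x: "x \<in> X" "\<And>l. x \<notin> A l"
  shows "free_family perms f UNIV"
proof -
  have "word_eval perms f w x \<in> A (hd w)" if "reduced w" "w \<noteq> []" for w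
    using that
  proof (induction w)
    case (Cons l w)
    obtain a e where l: "l = (a, e)" by (cases l)
    have "word_eval perms f w x \<in> X \<and> word_eval perms f w x \<notin> A (inv_letter l)"
    proof (cases "w = []")
      case True
      then show ?thesis using x by simp
    next
      case False
      then have "word_eval perms f w x \<in> A (hd w)" "hd w \<noteq> inv_letter l"
        using Cons by (auto simp: reduced_Cons)
      then show ?thesis using sub disj by blast
    qed
    then show ?case
      using pos neg l bij by (cases e) (simp_all add: word_eval_Cons inv_letter_def)
  qed simp
  then show ?thesis
    using bij x unfolding free_family_def by fastforce
qed

text \<open>In an HNN extension with both associated subgroups proper, the stable letter
  \<open>\<tau>\<close> and \<open>v \<tau> u\<close> are free. The four sets are \<open>P\<close>,
  \<open>M\<close> for \<open>\<tau>\<close> and \<open>vP\<close>, \<open>u^{-1}M\<close> for the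
  other: \<open>v\<close> outside the image of \<open>b\<close> separates \<open>P\<close> from
  \<open>vP\<close>, and \<open>u\<close> outside the image of \<open>a\<close> separates
  \<open>M\<close> from \<open>u^{-1}M\<close>.\<close>

lemma (in group) stable_letter_free_pair:
  fixes Q
  assumes Q: "group Q" and a: "a \<in> hom Q G" and b: "b \<in> hom Q G"
    and \<tau>: "bij \<tau>" "\<tau> ` (carrier G \<times> UNIV) = carrier G \<times> UNIV"
    "\<tau> ` (carrier G \<times> UNIV - a ` carrier Q \<times> {n. n mod 3 = 1}) = b ` carrier Q \<times> {n. n mod 3 = 0}"
    and u: "u \<in> carrier G" "u \<notin> a ` carrier Q" and v: "v \<in> carrier G" "v \<notin> b ` carrier Q"
  shows "free_family perms (\<lambda>e. if e then \<tau> else translation G v \<circ> \<tau> \<circ> translation G u) UNIV"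
proof -
  interpret Q: group Q by fact
  interpret a: group_hom Q G a
    by (intro group_hom.intro group_hom_axioms.intro a Q.group_axioms group_axioms)
  interpret b: group_hom Q G b
    by (intro group_hom.intro group_hom_axioms.intro b Q.group_axioms group_axioms)
  let ?X = "carrier G \<times> (UNIV :: nat set)"
  define M where "M = a ` carrier Q \<times> {n::nat. n mod 3 = 1}"
  define P where "P = b ` carrier Q \<times> {n::nat. n mod 3 = 0}"
  have sub: "M \<subseteq> ?X" "P \<subseteq> ?X" by (auto simp: M_def P_def)
  have tr: "translation G g x \<in> ?X" if "g \<in> carrier G" "x \<in> ?X" for g x
    using that by (auto simp: translation_def)
  have pos: "\<tau> x \<in> P" if "x \<in> ?X" "x \<notin> M" for x
    using that \<tau>(3) unfolding M_def P_def by blast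
  have neg: "inv_into UNIV \<tau> x \<in> M" if x: "x \<in> ?X" "x \<notin> P" for x
  proof -
    obtain y where y: "y \<in> ?X" "x = \<tau> y" using x(1) \<tau>(2) by blast
    then have "y \<in> M" using pos x by blast
    then show ?thesis using y \<tau>(1) by (simp add: bij_is_inj)
  qed
  have vP: False if "(y, n) \<in> P" "translation G v (y, n) \<in> P" for y n
  proof -
    have y: "y \<in> b ` carrier Q" "v \<otimes> y \<in> b ` carrier Q" "y \<in> carrier G"
      using that by (auto simp: P_def translation_def)
    have "v \<otimes> y \<otimes> inv y \<in> b ` carrier Q"
      by (rule subgroup.m_closed[OF b.img_is_subgroup y(2) subgroup.m_inv_closed[OF b.img_is_subgroup y(1)]])
    then show False using v y(3) by (simp add: m_assoc)
  qed
  have uM: False if "(y, n) \<in> M" "translation G (inv u) (y, n) \<in> M" for y n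
  proof -
    have y: "y \<in> a ` carrier Q" "inv u \<otimes> y \<in> a ` carrier Q" "y \<in> carrier G"
      using that by (auto simp: M_def translation_def)
    have "y \<otimes> inv (inv u \<otimes> y) \<in> a ` carrier Q"
      by (rule subgroup.m_closed[OF a.img_is_subgroup y(1) subgroup.m_inv_closed[OF a.img_is_subgroup y(2)]])
    moreover have "y \<otimes> inv (inv u \<otimes> y) = u"
      using u y(3) by (simp add: inv_mult_group flip: m_assoc)
    ultimately show False using u by simp
  qed
  define A :: "bool letter \<Rightarrow> _" where
    "A l = (if fst l then if snd l then P else M
       else if snd l then translation G v ` P else translation G (inv u) ` M)" for l
  have A_sub: "A l \<subseteq> ?X" for l
  proof -
    have "translation G v ` P \<subseteq> ?X" "translation G (inv u) ` M \<subseteq> ?X"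
      using sub tr[OF v(1)] tr[OF inv_closed[OF u(1)]] by blast+
    then show ?thesis using sub by (simp add: A_def)
  qed
  have vP': "P \<inter> translation G v ` P = {}" and uM': "M \<inter> translation G (inv u) ` M = {}"
    using vP uM by auto
  have mod: "snd x mod 3 = (if snd l then 0 else 1)" if "x \<in> A l" for x l
    using that by (auto simp: A_def M_def P_def split: if_splits)
  have A_disj: "A l \<inter> A l' = {}" if "l \<noteq> l'" for l l'
  proof (cases "snd l = snd l'")
    case True
    then have "fst l' = (\<not> fst l)" using that by (auto simp: prod_eq_iff)
    then show ?thesis
      using True vP' uM' by (cases "snd l"; cases "fst l") (simp_all add: A_def Int_commute)
  next
    case False
    show ?thesis
    proof (rule equals0I)
      fix x assume "x \<in> A l \<inter> A l'"
      then show False using mod[of x l] mod[of x l'] False by (simp split: if_splits)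
    qed
  qed
  show ?thesis
  proof (rule ping_pong[where X = ?X and A = A and x = "(\<one>, 2)"])
    fix e
    show "bij (if e then \<tau> else translation G v \<circ> \<tau> \<circ> translation G u)"
      using \<tau>(1) u v by (auto intro!: bij_comp bij_translation)
    fix x assume x: "x \<in> ?X"
    show "(if e then \<tau> else translation G v \<circ> \<tau> \<circ> translation G u) x \<in> A (e, True)"
      if "x \<notin> A (e, False)"
    proof (cases e)
      case True
      then show ?thesis using that x pos by (simp add: A_def)
    next
      case False
      then have "translation G u x \<notin> M"
        using that translation_inv(2)[OF u(1), of x] by (force simp: A_def)
      then show ?thesis using False pos tr[OF u(1) x] by (simp add: A_def)
    qed
    show "inv_into UNIV (if e then \<tau> else translation G v \<circ> \<tau> \<circ> translation G u) x \<in> A (e, False)"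
      if "x \<notin> A (e, True)"
    proof (cases e)
      case True
      then show ?thesis using that x neg \<tau>(1) by (simp add: A_def)
    next
      case False
      then have "translation G (inv v) x \<notin> P"
        using that translation_inv(1)[OF v(1), of x] by (force simp: A_def)
      then have *: "inv_into UNIV \<tau> (translation G (inv v) x) \<in> M"
        using neg tr[OF inv_closed[OF v(1)] x] \<tau>(1) by simp
      have "inv_into UNIV (translation G v \<circ> \<tau> \<circ> translation G u) x
          = translation G (inv u) (inv_into UNIV \<tau> (translation G (inv v) x))"
        using \<tau>(1) u v
        by (simp add: o_inv_distrib bij_comp bij_translation inv_translation)
      then show ?thesis using False * by (simp add: A_def)
    qed
  next
    \<comment> \<open>Translations preserve levels, so the four sets live at residues 0 and 1 only;
      level 2 offers a base point.\<close>
    show "(\<one>, 2) \<notin> A l" for l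
      by (auto simp: A_def M_def P_def translation_def)
  qed (use A_sub A_disj in auto)
qed

section \<open>Unwinding words along a height function\<close>

definition height :: "('a \<Rightarrow> int) \<Rightarrow> 'a word \<Rightarrow> int" where
  "height \<phi> w = (\<Sum>(a, e)\<leftarrow>w. if e then \<phi> a else - \<phi> a)"

text \<open>Magnus' rewriting: the stable letter \<open>t\<close> is a power of some \<open>\<tau>\<close> with exponent \<open>\<phi> t\<close>, and \<open>(a, i)\<close>
  names the element that \<open>conj_letter\<close> below assigns to it. Since \<open>\<phi>\<close> need not vanish outside \<open>t\<close>,
  an inverse letter is indexed by the height at which it ends.\<close>

fun unwind :: "'a \<Rightarrow> ('a \<Rightarrow> int) \<Rightarrow> int \<Rightarrow> 'a word \<Rightarrow> ('a \<times> int) word" where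
  "unwind t \<phi> h [] = []"
| "unwind t \<phi> h ((a, True) # w) =
     (if a = t then [] else [((a, h), True)]) @ unwind t \<phi> (h + \<phi> a) w"
| "unwind t \<phi> h ((a, False) # w) =
     (if a = t then [] else [((a, h - \<phi> a), False)]) @ unwind t \<phi> (h - \<phi> a) w"

lemma height_Nil [simp]: "height \<phi> [] = 0"
  and height_Cons: "height \<phi> ((a, e) # w) = (if e then \<phi> a else - \<phi> a) + height \<phi> w"
  and height_append: "height \<phi> (u @ v) = height \<phi> u + height \<phi> v"
  by (simp_all add: height_def)

lemma height_inv_word: "height \<phi> (inv_word w) = - height \<phi> w"
  by (induction w) (auto simp: inv_word_Cons height_append height_Cons inv_letter_def)

lemma unwind_append:
  "unwind t \<phi> h (u @ v) = unwind t \<phi> h u @ unwind t \<phi> (h + height \<phi> u) v"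
  by (induction t \<phi> h u rule: unwind.induct) (auto simp: height_Cons algebra_simps)

lemma letters_unwind: "(a, i) \<in> fst ` set (unwind t \<phi> h w) \<Longrightarrow> a \<noteq> t \<and> a \<in> fst ` set w"
  by (induction t \<phi> h w rule: unwind.induct) (auto split: if_splits)

lemma letter_unwind:
  assumes "a \<in> fst ` set w" "a \<noteq> t"
  obtains i where "(a, i) \<in> fst ` set (unwind t \<phi> h w)"
proof -
  have "\<exists>i. (a, i) \<in> fst ` set (unwind t \<phi> h w)"
    using assms
  proof (induction w arbitrary: h)
    case (Cons x w)
    obtain b e where x: "x = (b, e)" by (cases x)
    show ?case
    proof (cases "b = a")
      case True
      then show ?thesis using x \<open>a \<noteq> t\<close> by (cases e) auto
    next
      case False
      then have "a \<in> fst ` set w" using Cons.prems x by auto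
      then show ?thesis
        using Cons.IH[OF _ \<open>a \<noteq> t\<close>, of "if e then h + \<phi> b else h - \<phi> b"] x
        by (cases e) (auto simp: image_Un)
    qed
  qed simp
  then show ?thesis using that by blast
qed

lemma length_unwind: "length (unwind t \<phi> h w) \<le> length w"
  by (induction t \<phi> h w rule: unwind.induct) auto

lemma length_unwind_less: "t \<in> fst ` set w \<Longrightarrow> length (unwind t \<phi> h w) < length w"
proof (induction t \<phi> h w rule: unwind.induct)
  case (2 t \<phi> h a w)
  then show ?case using length_unwind[of t \<phi> "h + \<phi> a" w] by (cases "a = t") auto
next
  case (3 t \<phi> h a w)
  then show ?case using length_unwind[of t \<phi> "h - \<phi> a" w] by (cases "a = t") auto
qed simp

text \<open>\<open>k\<close> is the signed number of stable letters before the first surviving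
  letter; in a reduced word they all have the same sign.\<close>

lemma hd_unwind:
  assumes "reduced w" "unwind t \<phi> h w \<noteq> []" "hd (unwind t \<phi> h w) = ((a, i), e)"
  shows "\<exists>k. i = h + k * \<phi> t - (if e then 0 else \<phi> a) \<and>
    (if fst (hd w) = t then (if snd (hd w) then k \<ge> 1 else k \<le> -1) else k = 0 \<and> hd w = (a, e))"
  using assms
proof (induction w arbitrary: h)
  case (Cons x w)
  obtain b d where x: "x = (b, d)" by (cases x)
  show ?case
  proof (cases "b = t")
    case False
    then show ?thesis using x Cons.prems by (intro exI[of _ 0]) (cases d; auto)
  next
    case True
    define h' where "h' = (if d then h + \<phi> t else h - \<phi> t)"
    have un: "unwind t \<phi> h (x # w) = unwind t \<phi> h' w"
      using x True by (cases d) (auto simp: h'_def)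
    then have w: "w \<noteq> []" using Cons.prems by auto
    have "hd w \<noteq> (t, \<not> d)" "reduced w"
      using Cons.prems w x True by (auto simp: reduced_Cons inv_letter_def)
    then obtain k where k: "i = h' + k * \<phi> t - (if e then 0 else \<phi> a)"
      "if fst (hd w) = t then (if snd (hd w) then k \<ge> 1 else k \<le> -1) else k = 0 \<and> hd w = (a, e)"
      using Cons.IH[of h'] Cons.prems un by auto
    have kd: "if d then k \<ge> 0 else k \<le> 0"
      using k(2) \<open>hd w \<noteq> (t, \<not> d)\<close> by (cases "hd w") (auto split: if_splits)
    show ?thesis
      using k(1) kd x True
      by (intro exI[of _ "if d then k + 1 else k - 1"]) (auto simp: h'_def algebra_simps)
  qed
qed simp

text \<open>Two letters that become adjacent when stable letters between them are deleted differ in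
  their index by a non-zero multiple of \<open>\<phi> t\<close>, so no new cancellation
  arises.\<close>

lemma reduced_unwind:
  assumes "\<phi> t \<noteq> 0" "reduced w"
  shows "reduced (unwind t \<phi> h w)"
  using assms(2)
proof (induction w arbitrary: h)
  case (Cons x w)
  obtain a e where x: "x = (a, e)" by (cases x)
  define h' where "h' = (if e then h + \<phi> a else h - \<phi> a)"
  define j where "j = (if e then h else h - \<phi> a)"
  have un: "unwind t \<phi> h (x # w) = (if a = t then [] else [((a, j), e)]) @ unwind t \<phi> h' w"
    using x by (cases e) (auto simp: h'_def j_def)
  have w: "reduced w" using Cons.prems by (simp add: reduced_Cons)
  have "hd (unwind t \<phi> h' w) \<noteq> ((a, j), \<not> e)" if ne: "unwind t \<phi> h' w \<noteq> []" and a: "a \<noteq> t"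
  proof
    assume "hd (unwind t \<phi> h' w) = ((a, j), \<not> e)"
    from hd_unwind[OF w ne this] obtain k where
      "j = h' + k * \<phi> t - (if \<not> e then 0 else \<phi> a)"
      and k: "if fst (hd w) = t then (if snd (hd w) then k \<ge> 1 else k \<le> -1) else k = 0 \<and> hd w = (a, \<not> e)"
      by blast
    then have "k = 0" using \<open>\<phi> t \<noteq> 0\<close> by (auto simp: j_def h'_def split: if_splits)
    then have "hd w = inv_letter x" "w \<noteq> []"
      using k x ne by (auto simp: inv_letter_def split: if_splits)
    then show False using Cons.prems by (simp add: reduced_Cons)
  qed
  then show ?case
    using un Cons.IH[OF w, of h'] by (auto simp: reduced_Cons inv_letter_def)
qed simp

lemma cyclically_reduced_iff: "cyclically_reduced w \<longleftrightarrow> reduced (w @ w)"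
  by (auto simp: cyclically_reduced_def reduced_def successively_append_iff)

text \<open>As the height vanishes, the second copy of \<open>w\<close> in \<open>w @ w\<close>
  starts at level \<open>h\<close> again, and \<open>w @ w\<close> unwinds to the doubled
  unwinding.\<close>

lemma cyclically_reduced_unwind:
  assumes "\<phi> t \<noteq> 0" "cyclically_reduced w" "height \<phi> w = 0"
  shows "cyclically_reduced (unwind t \<phi> h w)"
  using reduced_unwind[of \<phi> t "w @ w" h] assms by (simp add: cyclically_reduced_iff unwind_append)

lemma reduced_append: "reduced (u @ v) \<Longrightarrow> reduced u \<and> reduced v"
  by (simp add: reduced_def successively_append_iff)

lemma unwind_eq_Nil_iff: "unwind t \<phi> h w = [] \<longleftrightarrow> fst ` set w \<subseteq> {t}"
  by (induction t \<phi> h w rule: unwind.induct) auto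

lemma height_stable_word:
  assumes "reduced w" "fst ` set w \<subseteq> {t}" "\<phi> t \<noteq> 0" "height \<phi> w = 0"
  shows "w = []"
proof (rule ccontr)
  assume "w \<noteq> []"
  \<comment> \<open>The sign of \<open>k\<close> is tied to the first letter because reducedness
    only compares neighbours.\<close>
  have "\<exists>k. height \<phi> w = k * \<phi> t \<and> (w \<noteq> [] \<longrightarrow> (if snd (hd w) then k \<ge> 1 else k \<le> -1))"
    using assms(1,2)
  proof (induction w)
    case (Cons x w)
    obtain e where x: "x = (t, e)" using Cons.prems by (cases x) auto
    obtain k where k: "height \<phi> w = k * \<phi> t" "w \<noteq> [] \<longrightarrow> (if snd (hd w) then k \<ge> 1 else k \<le> -1)"
      using Cons by (auto simp: reduced_Cons)
    have "if e then k \<ge> 0 else k \<le> 0"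
    proof (cases "w = []")
      case True
      then show ?thesis using k(1) assms(3) by auto
    next
      case False
      then have "fst (hd w) = t" using Cons.prems(2) hd_in_set[OF False]
        by (meson image_eqI list.set_intros(2) singletonD subsetD)
      moreover have "hd w \<noteq> (t, \<not> e)"
        using Cons.prems(1) False x by (auto simp: reduced_Cons inv_letter_def)
      ultimately show ?thesis using k(2) False by (cases "hd w") (auto split: if_splits)
    qed
    then show ?case
      using k(1) x by (intro exI[of _ "if e then k + 1 else k - 1"]) (auto simp: height_Cons algebra_simps)
  qed simp
  then show False using \<open>w \<noteq> []\<close> assms by (auto split: if_splits)
qed

text \<open>Here the level is a multiple of the exponent of \<open>t\<close> read so far. A stable
  letter followed later by another letter would push that letter off level \<open>h\<close>, so all
  stable letters come last.\<close>

lemma unwind_constant: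
  assumes "\<phi> t \<noteq> 0" "\<And>a. a \<noteq> t \<Longrightarrow> \<phi> a = 0" "reduced w"
    and "\<And>a i. (a, i) \<in> fst ` set (unwind t \<phi> h w) \<Longrightarrow> i = h"
  shows "\<exists>u v. w = u @ v \<and> t \<notin> fst ` set u \<and> fst ` set v \<subseteq> {t}"
  using assms(3,4)
proof (induction w)
  case (Cons x w)
  obtain a e where x: "x = (a, e)" by (cases x)
  show ?case
  proof (cases "a = t")
    case False
    then have un: "unwind t \<phi> h (x # w) = ((a, h), e) # unwind t \<phi> h w"
      using x assms(2) by (cases e) auto
    obtain u v where "w = u @ v" "t \<notin> fst ` set u" "fst ` set v \<subseteq> {t}"
      using Cons.IH Cons.prems un by (force simp: reduced_Cons)
    then show ?thesis
      using x False by (intro exI[of _ "x # u"] exI[of _ v]) auto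
  next
    case True
    have "unwind t \<phi> h (x # w) = []"
    proof (rule ccontr)
      assume ne: "unwind t \<phi> h (x # w) \<noteq> []"
      obtain b i d where hd: "hd (unwind t \<phi> h (x # w)) = ((b, i), d)"
        by (metis prod.exhaust)
      then have mem: "(b, i) \<in> fst ` set (unwind t \<phi> h (x # w))"
        using hd_in_set[OF ne] by force
      then have "i = h" "b \<noteq> t" using Cons.prems(2) letters_unwind by fast+
      then obtain k where "k * \<phi> t = 0" "k \<ge> 1 \<or> k \<le> -1"
        using hd_unwind[OF Cons.prems(1) ne hd] x True assms(2)[of b] by (auto split: if_splits)
      then show False using assms(1) by auto
    qed
    then have "fst ` set (x # w) \<subseteq> {t}" by (simp only: unwind_eq_Nil_iff)
    then show ?thesis by (intro exI[of _ "[]"] exI[of _ "x # w"]) simp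
  qed
qed simp

text \<open>This supplies the Freiheitssatz with a letter of the new relator at a level other than
  \<open>k\<close>. If there were none, a rotation of \<open>w\<close> would be a
  \<open>t\<close>-free word followed by a power of \<open>t\<close> of height zero, so
  \<open>t\<close> would not occur.\<close>

lemma unwind_not_constant:
  assumes \<phi>: "\<phi> t \<noteq> 0" "\<And>a. a \<noteq> t \<Longrightarrow> \<phi> a = 0"
    and w: "cyclically_reduced w" "height \<phi> w = 0" "t \<in> fst ` set w" "b \<in> fst ` set w" "b \<noteq> t"
  obtains a i where "(a, i) \<in> fst ` set (unwind t \<phi> 0 w)" "i \<noteq> k"
proof (rule ccontr)
  assume "\<not> thesis"
  then have const: "\<And>a i. (a, i) \<in> fst ` set (unwind t \<phi> 0 w) \<Longrightarrow> i = k" using that by blast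
  \<comment> \<open>Rotating the leading stable letters to the end makes the rotated word start with
    a letter at level \<open>h\<close>; constancy then gives \<open>h = k\<close>.\<close>
  define p where "p = takeWhile (\<lambda>x. fst x = t) w"
  define q where "q = dropWhile (\<lambda>x. fst x = t) w"
  have pq: "w = p @ q" by (simp add: p_def q_def)
  have p: "fst ` set p \<subseteq> {t}" by (auto simp: p_def dest: set_takeWhileD)
  have "q \<noteq> []" using w(4,5) by (auto simp: q_def)
  then have hdq: "fst (hd q) \<noteq> t" unfolding q_def by (rule hd_dropWhile)
  have "reduced (p @ (q @ p) @ q)" using w(1) pq by (simp add: cyclically_reduced_iff)
  then have red: "reduced (q @ p)" using reduced_append by blast
  define h where "h = height \<phi> p"
  have un: "unwind t \<phi> 0 w = unwind t \<phi> h q"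
    using p by (simp add: pq unwind_append h_def unwind_eq_Nil_iff[THEN iffD2])
  have un': "unwind t \<phi> h (q @ p) = unwind t \<phi> 0 w"
    using p un by (simp add: unwind_append unwind_eq_Nil_iff[THEN iffD2])
  have "h = k"
  proof -
    obtain x q' where q': "q = x # q'" using \<open>q \<noteq> []\<close> by (cases q) auto
    obtain a e where x: "x = (a, e)" by (cases x)
    have "a \<noteq> t" using hdq q' x by simp
    then have "(a, h) \<in> fst ` set (unwind t \<phi> h q)" using q' x \<phi>(2)[of a] by (cases e) auto
    then show ?thesis using const un by simp
  qed
  have "\<exists>u v. q @ p = u @ v \<and> t \<notin> fst ` set u \<and> fst ` set v \<subseteq> {t}"
  proof (rule unwind_constant[where t = t and \<phi> = \<phi> and h = h, OF \<phi> red])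
    show "i = h" if "(a, i) \<in> fst ` set (unwind t \<phi> h (q @ p))" for a i
      using that const[of a i] un' \<open>h = k\<close> by simp
  qed
  then obtain u v where uv: "q @ p = u @ v" "t \<notin> fst ` set u" "fst ` set v \<subseteq> {t}" by blast
  have "height \<phi> u = 0"
    using uv(2) \<phi>(2) by (induction u) (auto simp: height_Cons)
  then have "height \<phi> v = 0"
    using w(2) pq arg_cong[OF uv(1), of "height \<phi>"] by (simp add: height_append)
  moreover have "reduced v" using red uv(1) reduced_append by metis
  ultimately have "v = []"
    using height_stable_word[where t = t and \<phi> = \<phi>, OF _ uv(3) \<phi>(1)] by blast
  then show False using uv w(3) pq by (auto simp: image_Un)
qed

text \<open>The Reidemeister-Schreier generators of the kernel of \<open>\<phi>\<close>, with the
  powers of \<open>\<tau>\<close> as transversal: the last factor brings the height from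
  \<open>i + \<phi> a\<close> back to 0.\<close>

definition conj_letter ::
    "('g, 'm) monoid_scheme \<Rightarrow> 'g \<Rightarrow> ('b \<Rightarrow> 'g) \<Rightarrow> ('b \<Rightarrow> int) \<Rightarrow> 'b \<times> int \<Rightarrow> 'g" where
  "conj_letter G \<tau> \<rho> \<phi> =
     (\<lambda>(a, i). \<tau> [^]\<^bsub>G\<^esub> i \<otimes>\<^bsub>G\<^esub> \<rho> a \<otimes>\<^bsub>G\<^esub> \<tau> [^]\<^bsub>G\<^esub> (- (i + \<phi> a)))"

context group
begin

lemma conj_letter_closed [simp]:
  "\<tau> \<in> carrier G \<Longrightarrow> \<rho> a \<in> carrier G \<Longrightarrow> conj_letter G \<tau> \<rho> \<phi> (a, i) \<in> carrier G"
  by (simp add: conj_letter_def)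

lemma conj_letter_image:
  assumes "\<tau> \<in> carrier G" "\<rho> ` fst ` set w \<subseteq> carrier G"
  shows "conj_letter G \<tau> \<rho> \<phi> ` fst ` set (unwind t \<phi> h w) \<subseteq> carrier G"
proof
  fix g assume "g \<in> conj_letter G \<tau> \<rho> \<phi> ` fst ` set (unwind t \<phi> h w)"
  then obtain p where p: "p \<in> fst ` set (unwind t \<phi> h w)" "g = conj_letter G \<tau> \<rho> \<phi> p" by blast
  obtain b i where bi: "p = (b, i)" by (cases p)
  then have "b \<in> fst ` set w" using p letters_unwind by fast
  then have "\<rho> b \<in> carrier G" using assms(2) by blast
  then show "g \<in> carrier G" using p bi assms(1) by simp
qed

text \<open>A telescoping product: each letter read at level \<open>h\<close> is replaced by its
  Schreier generator times the power of \<open>\<tau>\<close> for the next level. The hypothesis on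
  \<open>\<rho> t\<close> makes the generators that belong to \<open>t\<close> trivial, which is why
  \<open>unwind\<close> drops them.\<close>

lemma word_eval_unwind:
  assumes \<tau>: "\<tau> \<in> carrier G" and \<rho>: "\<rho> ` fst ` set w \<subseteq> carrier G" and t: "\<rho> t = \<tau> [^] \<phi> t"
  shows "\<tau> [^] h \<otimes> word_eval G \<rho> w =
    word_eval G (conj_letter G \<tau> \<rho> \<phi>) (unwind t \<phi> h w) \<otimes> \<tau> [^] (h + height \<phi> w)"
  using \<rho>
proof (induction w arbitrary: h)
  case (Cons x w)
  obtain a e where x: "x = (a, e)" by (cases x)
  have a: "\<rho> a \<in> carrier G" and w: "\<rho> ` fst ` set w \<subseteq> carrier G" using Cons.prems x by auto
  have ww: "word_eval G \<rho> w \<in> carrier G" using w by (rule word_eval_closed)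
  have un: "word_eval G (conj_letter G \<tau> \<rho> \<phi>) (unwind t \<phi> h w) \<in> carrier G" for h
    by (intro word_eval_closed conj_letter_image \<tau> w)
  define h' where "h' = (if e then h + \<phi> a else h - \<phi> a)"
  define z where "z = (if e then conj_letter G \<tau> \<rho> \<phi> (a, h) else inv (conj_letter G \<tau> \<rho> \<phi> (a, h - \<phi> a)))"
  define y where "y = (if e then \<rho> a else inv (\<rho> a))"
  have y: "y \<in> carrier G" using a by (simp add: y_def)
  have inv_pow: "inv (\<tau> [^] i) = \<tau> [^] (- i)" for i :: int
    using \<tau> by (simp add: int_pow_neg)
  have z: "z = \<tau> [^] h \<otimes> y \<otimes> \<tau> [^] (- h')"
    using \<tau> a
    by (simp add: z_def y_def h'_def conj_letter_def inv_mult_group inv_pow m_assoc)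
  have "z \<otimes> \<tau> [^] h' = \<tau> [^] h \<otimes> y"
    using z \<tau> y by (simp add: m_assoc flip: int_pow_mult)
  moreover have "z \<in> carrier G" using z \<tau> y by simp
  ultimately have "\<tau> [^] h \<otimes> (y \<otimes> word_eval G \<rho> w) = z \<otimes> (\<tau> [^] h' \<otimes> word_eval G \<rho> w)"
    using \<tau> y ww by (simp flip: m_assoc)
  also have "\<dots> = (z \<otimes> word_eval G (conj_letter G \<tau> \<rho> \<phi>) (unwind t \<phi> h' w)) \<otimes> \<tau> [^] (h' + height \<phi> w)"
    using Cons.IH[OF w, of h'] \<open>z \<in> carrier G\<close> un \<tau> by (simp add: m_assoc)
  also have "z \<otimes> word_eval G (conj_letter G \<tau> \<rho> \<phi>) (unwind t \<phi> h' w)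
      = word_eval G (conj_letter G \<tau> \<rho> \<phi>) (unwind t \<phi> h (x # w))"
  proof (cases "a = t")
    case True
    then have "z = \<one>"
      using z \<tau> t by (simp add: y_def h'_def inv_pow flip: int_pow_mult)
    then show ?thesis using True x un by (cases e) (simp_all add: h'_def)
  next
    case False
    then show ?thesis using x by (cases e) (simp_all add: z_def h'_def word_eval_Cons)
  qed
  also have "h' + height \<phi> w = h + height \<phi> (x # w)"
    using x by (simp add: h'_def height_Cons)
  finally have "\<tau> [^] h \<otimes> (y \<otimes> word_eval G \<rho> w) =
    word_eval G (conj_letter G \<tau> \<rho> \<phi>) (unwind t \<phi> h (x # w)) \<otimes> \<tau> [^] (h + height \<phi> (x # w))" .
  moreover have "word_eval G \<rho> (x # w) = y \<otimes> word_eval G \<rho> w"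
    using x by (simp add: word_eval_Cons y_def)
  ultimately show ?case by (simp only:)
qed (use \<tau> in simp)

lemma word_eval_unwind_height_zero:
  assumes \<tau>: "\<tau> \<in> carrier G" and \<rho>: "\<rho> ` fst ` set w \<subseteq> carrier G" and t: "\<rho> t = \<tau> [^] \<phi> t"
    and ht: "height \<phi> w = 0"
  shows "word_eval G (conj_letter G \<tau> \<rho> \<phi>) (unwind t \<phi> 0 w) = word_eval G \<rho> w"
proof -
  have "word_eval G (conj_letter G \<tau> \<rho> \<phi>) (unwind t \<phi> 0 w) \<in> carrier G"
    by (intro word_eval_closed conj_letter_image \<tau> \<rho>)
  then show ?thesis
    using word_eval_unwind[where t = t and \<phi> = \<phi> and h = 0, OF \<tau> \<rho> t] \<rho> ht by simp
qed

end

definition power_word :: "'a \<Rightarrow> int \<Rightarrow> 'a word" where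
  "power_word t i = replicate (nat \<bar>i\<bar>) (t, i \<ge> 0)"

definition conj_word :: "'a \<Rightarrow> ('a \<Rightarrow> int) \<Rightarrow> 'a \<times> int \<Rightarrow> 'a word" where
  "conj_word t \<phi> = (\<lambda>(a, i). power_word t i @ (a, True) # power_word t (- (i + \<phi> a)))"

lemma letters_conj_word: "fst ` set (conj_word t \<phi> (a, i)) \<subseteq> {a, t}"
  by (auto simp: conj_word_def power_word_def)

context group
begin

lemma word_eval_power_word:
  assumes "f t \<in> carrier G"
  shows "word_eval G f (power_word t i) = f t [^] i"
proof -
  have "word_eval G f (replicate n (t, e)) = (if e then f t [^] (int n) else f t [^] (- int n))" for n e
  proof (induction n)
    case (Suc n)
    have "f t [^] (1 + int n) = f t \<otimes> f t [^] (int n)" "f t [^] (- 1 - int n) = inv (f t) \<otimes> f t [^] (- int n)"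
      using int_pow_mult[OF assms, of 1 "int n"] int_pow_mult[OF assms, of "-1" "- int n"] assms
      by (simp_all add: int_pow_neg)
    then show ?case using Suc by (auto simp: word_eval_Cons)
  qed simp
  then show ?thesis by (simp add: power_word_def)
qed

lemma word_eval_conj_word:
  assumes "f t \<in> carrier G" "f a \<in> carrier G"
  shows "word_eval G f (conj_word t \<phi> (a, i)) = conj_letter G (f t) f \<phi> (a, i)"
proof -
  have "f ` fst ` set (power_word t j) \<subseteq> carrier G" for j
    using assms by (auto simp: power_word_def)
  then show ?thesis
    using assms by (simp add: conj_word_def conj_letter_def word_eval_append word_eval_Cons
        word_eval_power_word m_assoc)
qed

end

section \<open>The Freiheitssatz\<close>

abbreviation one_relator :: "'a word \<Rightarrow> 'a presentation" where
  "one_relator r \<equiv> (UNIV, [r])"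

abbreviation one_relator_group :: "'a word \<Rightarrow> 'a word set monoid" where
  "one_relator_group r \<equiv> presented_group (one_relator r)"

abbreviation one_relator_eval :: "'a word \<Rightarrow> 'a word \<Rightarrow> 'a word set" where
  "one_relator_eval r \<equiv> word_eval (one_relator_group r) (generator (one_relator r))"

text \<open>Freeness of the Magnus subgroup that omits \<open>c\<close>. All letters of the type are
  generators of \<open>one_relator r\<close>, including those that do not occur in
  \<open>r\<close>.\<close>

definition omits_freely :: "'a word \<Rightarrow> 'a \<Rightarrow> bool" where
  "omits_freely r c \<longleftrightarrow> free_family (one_relator_group r) (generator (one_relator r)) (- {c})"

lemma presentation_one_relator: "presentation (one_relator r)"
  by unfold_locales auto

lemma omits_freelyD:
  assumes "omits_freely r c" "reduced w" "c \<notin> fst ` set w"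
    "one_relator_eval r w = \<one>\<^bsub>one_relator_group r\<^esub>"
  shows "w = []"
  using assms unfolding omits_freely_def free_family_def by blast

lemma omits_freelyI:
  assumes "\<And>w. reduced w \<Longrightarrow> c \<notin> fst ` set w \<Longrightarrow>
    one_relator_eval r w = \<one>\<^bsub>one_relator_group r\<^esub> \<Longrightarrow> w = []"
  shows "omits_freely r c"
proof -
  interpret presentation "one_relator r" by (rule presentation_one_relator)
  have "generator (one_relator r) ` (- {c}) \<subseteq> carrier (one_relator_group r)"
    using generator_closed by auto
  moreover have "c \<notin> fst ` set w" if "fst ` set w \<subseteq> - {c}" for w :: "'a word"
    using that by blast
  ultimately show ?thesis
    unfolding omits_freely_def free_family_def using assms by simp
qed

lemma one_relator_consequence:
  assumes "group H" "range f \<subseteq> carrier H" "word_eval H f r = \<one>\<^bsub>H\<^esub>"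
    "one_relator_eval r w = \<one>\<^bsub>one_relator_group r\<^esub>"
  shows "word_eval H f w = \<one>\<^bsub>H\<^esub>"
proof -
  interpret presentation "one_relator r" by (rule presentation_one_relator)
  show ?thesis
    by (rule word_eval_consequence) (use assms in auto)
qed

text \<open>Injective renaming induces a homomorphism from the group of \<open>r\<close> to that of
  the renamed relator. It lets the induction of the Freiheitssatz return from the letters
  \<open>(a, i)\<close> to natural numbers.\<close>

lemma omits_freely_map:
  assumes g: "inj g" and "omits_freely (map (\<lambda>(a, e). (g a, e)) r) (g c)"
  shows "omits_freely r c"
proof (rule omits_freelyI)
  let ?r = "map (\<lambda>(a, e). (g a, e)) r"
  interpret presentation "one_relator ?r" by (rule presentation_one_relator)
  fix w assume w: "reduced w" "c \<notin> fst ` set w" "one_relator_eval r w = \<one>\<^bsub>one_relator_group r\<^esub>"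
  have "word_eval (one_relator_group ?r) (generator (one_relator ?r) \<circ> g) w = \<one>\<^bsub>one_relator_group ?r\<^esub>"
  proof (rule one_relator_consequence[OF presented.group_axioms _ _ w(3)])
    show "range (generator (one_relator ?r) \<circ> g) \<subseteq> carrier (one_relator_group ?r)"
      using generator_closed by auto
    show "word_eval (one_relator_group ?r) (generator (one_relator ?r) \<circ> g) r = \<one>\<^bsub>one_relator_group ?r\<^esub>"
      using generator_relator[of ?r] by (simp add: word_eval_map)
  qed
  then have "one_relator_eval ?r (map (\<lambda>(a, e). (g a, e)) w) = \<one>\<^bsub>one_relator_group ?r\<^esub>"
    by (simp add: word_eval_map)
  moreover have "reduced (map (\<lambda>(a, e). (g a, e)) w)"
    using w(1) reduced_map_inj[of g w] g inj_on_subset by blast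
  moreover have "g c \<notin> fst ` set (map (\<lambda>(a, e). (g a, e)) w)"
  proof
    assume "g c \<in> fst ` set (map (\<lambda>(a, e). (g a, e)) w)"
    then obtain x where "x \<in> set w" "g c = g (fst x)" by auto
    then show False using w(2) injD[OF g] by auto
  qed
  ultimately have "map (\<lambda>(a, e). (g a, e)) w = []"
    using omits_freelyD[OF assms(2)] by blast
  then show "w = []" by simp
qed

lemma (in group) conj_letter_base:
  assumes "\<tau> \<in> carrier G" "g \<in> carrier G"
    and "\<rho> a = \<tau> [^] (- k) \<otimes> g \<otimes> \<tau> [^] (k + \<phi> a)"
  shows "conj_letter G \<tau> \<rho> \<phi> (a, i) = \<tau> [^] (i - k) \<otimes> g \<otimes> \<tau> [^] (k - i)"
proof -
  have "conj_letter G \<tau> \<rho> \<phi> (a, i) =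
      (\<tau> [^] i \<otimes> \<tau> [^] (- k)) \<otimes> g \<otimes> (\<tau> [^] (k + \<phi> a) \<otimes> \<tau> [^] (- (i + \<phi> a)))"
    using assms by (simp add: conj_letter_def m_assoc)
  also have "\<dots> = \<tau> [^] (i - k) \<otimes> g \<otimes> \<tau> [^] (k - i)"
    using assms(1) by (simp flip: int_pow_mult)
  finally show ?thesis .
qed

text \<open>\<open>\<tau>\<close> is known to raise the index only inside the window
  \<open>I\<close>; convexity of \<open>I\<close> keeps every intermediate conjugate inside
  it.\<close>

lemma (in group) conj_power_shift:
  assumes \<tau>: "\<tau> \<in> carrier G" and g: "\<And>i. i \<in> I \<Longrightarrow> g i \<in> carrier G"
    and k: "k \<in> I" and I: "\<And>i j l :: int. i \<in> I \<Longrightarrow> l \<in> I \<Longrightarrow> i \<le> j \<Longrightarrow> j \<le> l \<Longrightarrow> j \<in> I"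
    and step: "\<And>i. i \<in> I \<Longrightarrow> i + 1 \<in> I \<Longrightarrow> g (i + 1) = \<tau> \<otimes> g i \<otimes> inv \<tau>"
    and i: "i \<in> I"
  shows "\<tau> [^] (i - k) \<otimes> g k \<otimes> \<tau> [^] (k - i) = g i"
proof -
  have inv1: "inv \<tau> = \<tau> [^] (- 1 :: int)" using \<tau> by (simp add: int_pow_neg)
  have up: "\<tau> [^] (int n) \<otimes> g i \<otimes> \<tau> [^] (- int n) = g (i + int n)"
    if "i \<in> I" "i + int n \<in> I" for i n
    using that
  proof (induction n)
    case 0
    then show ?case using g by simp
  next
    case (Suc n)
    have n: "i + int n \<in> I" using I[OF Suc.prems, of "i + int n"] by simp
    have "\<tau> [^] (int (Suc n)) = \<tau> \<otimes> \<tau> [^] (int n)" "\<tau> [^] (- int (Suc n)) = \<tau> [^] (- int n) \<otimes> inv \<tau>"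
      using int_pow_mult[OF \<tau>, of 1 "int n"] int_pow_mult[OF \<tau>, of "- int n" "-1"] \<tau>
      by (simp_all add: inv1 add.commute)
    then have "\<tau> [^] (int (Suc n)) \<otimes> g i \<otimes> \<tau> [^] (- int (Suc n))
        = \<tau> \<otimes> (\<tau> [^] (int n) \<otimes> g i \<otimes> \<tau> [^] (- int n)) \<otimes> inv \<tau>"
      using \<tau> g[OF Suc.prems(1)] by (simp add: m_assoc)
    also have "\<dots> = g (i + int (Suc n))"
    proof -
      have "i + int (Suc n) = (i + int n) + 1" by simp
      then show ?thesis
        using Suc.IH[OF Suc.prems(1) n] step[OF n] Suc.prems(2) by (simp only:)
    qed
    finally show ?case .
  qed
  show ?thesis
  proof (cases "k \<le> i")
    case True
    then show ?thesis using up[of k "nat (i - k)"] k i by simp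
  next
    case False
    then have "\<tau> [^] (k - i) \<otimes> g i \<otimes> \<tau> [^] (i - k) = g k"
      using up[of i "nat (k - i)"] k i by simp
    moreover have "\<tau> [^] (i - k) \<otimes> (\<tau> [^] (k - i) \<otimes> g i \<otimes> \<tau> [^] (i - k)) \<otimes> \<tau> [^] (k - i)
        = (\<tau> [^] (i - k) \<otimes> \<tau> [^] (k - i)) \<otimes> g i \<otimes> (\<tau> [^] (i - k) \<otimes> \<tau> [^] (k - i))"
      using \<tau> g[OF i] by (simp add: m_assoc)
    moreover have "\<tau> [^] (i - k) \<otimes> \<tau> [^] (k - i) = \<one>"
      using \<tau> by (simp flip: int_pow_mult)
    ultimately show ?thesis using g[OF i] by simp
  qed
qed

text \<open>The HNN step of Magnus' induction. The base group has the single relator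
  \<open>s\<close>, and the stable letter is to raise the index of \<open>(a, i)\<close>. Only the
  copies of \<open>j\<close> are confined to a window; the other letters of \<open>\<Sigma>\<close>
  keep all integer indices, on which raising is already a bijection. \<open>\<Sigma>\<close> is
  everything but \<open>t\<close> in the Freiheitssatz, and \<open>{y}\<close> in the two-generator
  theorem, where \<open>lower\<close> and \<open>upper\<close> must be generated by copies of
  \<open>y\<close> alone.\<close>

locale magnus_step =
  fixes s :: "('a::countable \<times> int) word" and t j :: 'a and \<phi> :: "'a \<Rightarrow> int"
    and \<Sigma> :: "'a set" and lo hi :: int
  assumes window: "lo \<le> hi" and j: "j \<in> \<Sigma>" and t: "t \<notin> \<Sigma>"
    and free_hi: "omits_freely s (j, hi)" and free_lo: "omits_freely s (j, lo)"
begin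

definition letters :: "('a \<times> int) set" where
  "letters = {(a, i). a \<in> \<Sigma> \<and> (a = j \<longrightarrow> lo \<le> i \<and> i \<le> hi)}"

definition lower :: "('a \<times> int) word set set" where
  "lower = one_relator_eval s ` carrier (free_group (letters - {(j, hi)}))"

definition upper :: "('a \<times> int) word set set" where
  "upper = one_relator_eval s ` carrier (free_group (letters - {(j, lo)}))"

sublocale presentation "one_relator s"
  by (rule presentation_one_relator)

abbreviation base :: "('a \<times> int) word set monoid" where
  "base \<equiv> one_relator_group s"

abbreviation act :: "('a \<times> int) word set \<Rightarrow> ('a \<times> int) word set \<times> nat \<Rightarrow> ('a \<times> int) word set \<times> nat" where
  "act \<equiv> translation base"

abbreviation gen :: "'a \<times> int \<Rightarrow> ('a \<times> int) word set" where
  "gen \<equiv> generator (one_relator s)"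

lemma gen_closed [simp]: "gen p \<in> carrier base"
  by (rule generator_closed) simp

lemma countable_base: "countable (carrier base)"
proof -
  have "carrier base \<subseteq> range (one_relator_eval s)"
    using carrier_presented_group by blast
  then show ?thesis by (rule countable_subset) simp
qed

definition up :: "'a \<times> int \<Rightarrow> 'a \<times> int" where
  "up = (\<lambda>(a, i). (a, i + 1))"

lemma inj_up: "inj up"
  by (auto simp: inj_def up_def)

lemma up_image: "up ` (letters - {(j, hi)}) = letters - {(j, lo)}"
proof (intro equalityI subsetI)
  fix p assume "p \<in> letters - {(j, lo)}"
  then show "p \<in> up ` (letters - {(j, hi)})"
    by (intro image_eqI[of _ _ "(fst p, snd p - 1)"]) (auto simp: letters_def up_def)
qed (auto simp: letters_def up_def)

text \<open>The permutation of \<open>stable_permutation\<close> for the associated subgroups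
  \<open>lower\<close> and \<open>upper\<close>, identified by \<open>up\<close>. The last clause is
  the ping-pong condition.\<close>

definition stable :: "('a \<times> int) word set \<times> nat \<Rightarrow> ('a \<times> int) word set \<times> nat" where
  "stable = (SOME \<tau>. bij \<tau> \<and>
     (\<forall>p \<in> letters - {(j, hi)}. \<tau> \<circ> act (gen p) = act (gen (up p)) \<circ> \<tau>) \<and>
     \<tau> ` (carrier base \<times> UNIV) = carrier base \<times> UNIV \<and>
     \<tau> ` (carrier base \<times> UNIV - lower \<times> {n. n mod 3 = 1}) = upper \<times> {n. n mod 3 = 0})"

lemma word_hom: "f ` S \<subseteq> carrier base \<Longrightarrow> word_eval base f \<in> hom (free_group S) base"
  by (rule presented.word_eval_hom)

lemma lower_hom: "one_relator_eval s \<in> hom (free_group (letters - {(j, hi)})) base"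
  and upper_hom: "word_eval base (gen \<circ> up) \<in> hom (free_group (letters - {(j, hi)})) base"
  by (auto intro!: word_hom)

lemma upper_eq: "word_eval base (gen \<circ> up) ` carrier (free_group (letters - {(j, hi)})) = upper"
proof -
  let ?m = "map (\<lambda>(p, e). (up p, e))"
  let ?SA = "letters - {(j, hi)}" and ?SB = "letters - {(j, lo)}"
  have letters_map: "fst ` set (?m w) = up ` fst ` set w" for w :: "('a \<times> int) word"
    by (induction w) auto
  have "?m ` carrier (free_group ?SA) = carrier (free_group ?SB)"
  proof (intro equalityI subsetI)
    fix w assume "w \<in> ?m ` carrier (free_group ?SA)"
    then obtain v where v: "w = ?m v" "reduced v" "fst ` set v \<subseteq> ?SA"
      by (auto simp: free_group_def)
    have "reduced w" using v reduced_map_inj[of up v] inj_up inj_on_subset by blast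
    moreover have "fst ` set w \<subseteq> ?SB"
      using v(1,3) letters_map[of v] up_image by blast
    ultimately show "w \<in> carrier (free_group ?SB)" by (simp add: free_group_def)
  next
    fix w assume "w \<in> carrier (free_group ?SB)"
    then have w: "reduced w" "fst ` set w \<subseteq> ?SB" by (auto simp: free_group_def)
    define v where "v = map (\<lambda>((a, i), e). ((a, i - 1), e)) w"
    have wv: "w = ?m v" by (simp add: v_def up_def case_prod_unfold comp_def)
    have "reduced v"
      using w(1) reduced_map_inj[of up v] inj_up inj_on_subset wv by blast
    moreover have "fst ` set v \<subseteq> ?SA"
    proof
      fix p assume "p \<in> fst ` set v"
      then have "up p \<in> fst ` set (?m v)" unfolding letters_map by (rule imageI)
      then have "up p \<in> up ` ?SA" using w(2) unfolding up_image wv[symmetric] by (rule subsetD[rotated])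
      then show "p \<in> ?SA" using inj_image_mem_iff[OF inj_up] by metis
    qed
    ultimately have "v \<in> carrier (free_group ?SA)" by (simp add: free_group_def)
    then show "w \<in> ?m ` carrier (free_group ?SA)" by (subst wv) (rule imageI)
  qed
  moreover have "word_eval base (gen \<circ> up) w = one_relator_eval s (?m w)" for w
    by (simp add: word_eval_map)
  ultimately show ?thesis
    unfolding upper_def by (metis (no_types, lifting) image_cong image_image)
qed

text \<open>Here the Freiheitssatz for \<open>s\<close> enters: both Magnus subgroups are copies of
  one abstract free group, so raising the index is an isomorphism from \<open>lower\<close> to
  \<open>upper\<close>.\<close>

lemma lower_inj: "inj_on (one_relator_eval s) (carrier (free_group (letters - {(j, hi)})))"
  and upper_inj: "inj_on (word_eval base (gen \<circ> up)) (carrier (free_group (letters - {(j, hi)})))"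
proof -
  let ?SA = "letters - {(j, hi)}"
  have "free_family base gen ?SA"
    using free_hi unfolding omits_freely_def free_family_def by blast
  then show "inj_on (one_relator_eval s) (carrier (free_group ?SA))"
    by (rule presented.free_family_word_eval_inj)
  have "free_family base (gen \<circ> up) ?SA"
    unfolding free_family_def
  proof (intro conjI allI impI)
    show "(gen \<circ> up) ` ?SA \<subseteq> carrier base" by auto
    fix w assume w: "reduced w \<and> fst ` set w \<subseteq> ?SA \<and> word_eval base (gen \<circ> up) w = \<one>\<^bsub>base\<^esub>"
    let ?w = "map (\<lambda>(p, e). (up p, e)) w"
    have "reduced ?w" using w reduced_map_inj[of up w] inj_up inj_on_subset by blast
    moreover have "(j, lo) \<notin> fst ` set ?w"
    proof -
      have "fst ` set ?w = up ` fst ` set w" by (induction w) auto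
      moreover have "up ` fst ` set w \<subseteq> letters - {(j, lo)}"
        unfolding up_image[symmetric] by (rule image_mono) (use w in simp)
      ultimately show ?thesis by (metis Diff_iff insertI1 subsetD)
    qed
    moreover have "one_relator_eval s ?w = \<one>\<^bsub>base\<^esub>" using w by (simp add: word_eval_map)
    ultimately have "?w = []" using omits_freelyD[OF free_lo] by blast
    then show "w = []" by simp
  qed
  then show "inj_on (word_eval base (gen \<circ> up)) (carrier (free_group ?SA))"
    by (rule presented.free_family_word_eval_inj)
qed

lemma bij_stable: "bij stable"
  and stable_act: "p \<in> letters - {(j, hi)} \<Longrightarrow> stable \<circ> act (gen p) = act (gen (up p)) \<circ> stable"
  and stable_carrier: "stable ` (carrier base \<times> UNIV) = carrier base \<times> UNIV"
  and stable_ping_pong: "stable ` (carrier base \<times> UNIV - lower \<times> {n. n mod 3 = 1}) = upper \<times> {n. n mod 3 = 0}"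
proof -
  let ?SA = "letters - {(j, hi)}"
  obtain \<tau> where \<tau>: "bij \<tau>"
    "\<And>q. q \<in> carrier (free_group ?SA) \<Longrightarrow>
      \<tau> \<circ> act (one_relator_eval s q) = act (word_eval base (gen \<circ> up) q) \<circ> \<tau>"
    "\<tau> ` (carrier base \<times> UNIV) = carrier base \<times> UNIV"
    "\<tau> ` (carrier base \<times> UNIV - lower \<times> {n. n mod 3 = 1}) = upper \<times> {n. n mod 3 = 0}"
    using presented.stable_permutation[OF group_free_group countable_base lower_hom lower_inj upper_hom upper_inj]
    unfolding lower_def[symmetric] upper_eq by blast
  have "\<tau> \<circ> act (gen p) = act (gen (up p)) \<circ> \<tau>" if "p \<in> ?SA" for p
  proof -
    have "[(p, True)] \<in> carrier (free_group ?SA)" using that by (simp add: free_group_def reduced_def)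
    from \<tau>(2)[OF this] show ?thesis by (simp add: presented.word_eval_singleton)
  qed
  then have "\<exists>\<tau>. bij \<tau> \<and>
     (\<forall>p \<in> ?SA. \<tau> \<circ> act (gen p) = act (gen (up p)) \<circ> \<tau>) \<and>
     \<tau> ` (carrier base \<times> UNIV) = carrier base \<times> UNIV \<and>
     \<tau> ` (carrier base \<times> UNIV - lower \<times> {n. n mod 3 = 1}) = upper \<times> {n. n mod 3 = 0}"
    using \<tau> by blast
  then have *: "bij stable \<and>
     (\<forall>p \<in> ?SA. stable \<circ> act (gen p) = act (gen (up p)) \<circ> stable) \<and>
     stable ` (carrier base \<times> UNIV) = carrier base \<times> UNIV \<and>
     stable ` (carrier base \<times> UNIV - lower \<times> {n. n mod 3 = 1}) = upper \<times> {n. n mod 3 = 0}"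
    unfolding stable_def by (rule someI_ex)
  note ** = *[THEN conjunct2]
  show "bij stable" by (rule *[THEN conjunct1])
  show "stable \<circ> act (gen p) = act (gen (up p)) \<circ> stable" if "p \<in> ?SA"
    by (rule **[THEN conjunct1, THEN bspec, OF that])
  show "stable ` (carrier base \<times> UNIV) = carrier base \<times> UNIV"
    by (rule **[THEN conjunct2, THEN conjunct1])
  show "stable ` (carrier base \<times> UNIV - lower \<times> {n. n mod 3 = 1}) = upper \<times> {n. n mod 3 = 0}"
    by (rule **[THEN conjunct2, THEN conjunct2])
qed

text \<open>Obtained by solving the equation that sends \<open>(a, k)\<close> under
  \<open>conj_letter\<close> to its own translation. The reference index is \<open>lo\<close> for
  \<open>j\<close>, because 0 may lie outside the window.\<close>

definition rep :: "'a \<Rightarrow> ('a \<times> int) word set \<times> nat \<Rightarrow> ('a \<times> int) word set \<times> nat" where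
  "rep a = (let k = if a = j then lo else 0 in
     if a \<in> \<Sigma> then stable [^]\<^bsub>perms\<^esub> (- k) \<otimes>\<^bsub>perms\<^esub> act (gen (a, k)) \<otimes>\<^bsub>perms\<^esub> stable [^]\<^bsub>perms\<^esub> (k + \<phi> a)
     else stable [^]\<^bsub>perms\<^esub> \<phi> a)"

lemma stable_closed: "stable \<in> carrier perms"
  by (simp add: bij_stable)

lemma act_closed: "act (gen p) \<in> carrier perms"
  by (simp add: presented.bij_translation)

lemma rep_closed: "rep a \<in> carrier perms"
proof (cases "a \<in> \<Sigma>")
  case True
  show ?thesis
    unfolding rep_def Let_def if_P[OF True]
    by (intro perms.m_closed perms.int_pow_closed stable_closed act_closed)
next
  case False
  show ?thesis
    unfolding rep_def Let_def if_not_P[OF False]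
    by (intro perms.int_pow_closed stable_closed)
qed

lemma rep_stable: "rep t = stable [^]\<^bsub>perms\<^esub> \<phi> t"
  using t by (simp add: rep_def)

lemma conj_letter_rep:
  assumes "(a, i) \<in> letters"
  shows "conj_letter perms stable rep \<phi> (a, i) = act (gen (a, i))"
proof -
  define k where "k = (if a = j then lo else 0)"
  have "a \<in> \<Sigma>" using assms by (simp add: letters_def)
  then have "rep a = stable [^]\<^bsub>perms\<^esub> (- k) \<otimes>\<^bsub>perms\<^esub> act (gen (a, k)) \<otimes>\<^bsub>perms\<^esub> stable [^]\<^bsub>perms\<^esub> (k + \<phi> a)"
    by (simp add: rep_def k_def Let_def)
  then have "conj_letter perms stable rep \<phi> (a, i) =
      stable [^]\<^bsub>perms\<^esub> (i - k) \<otimes>\<^bsub>perms\<^esub> act (gen (a, k)) \<otimes>\<^bsub>perms\<^esub> stable [^]\<^bsub>perms\<^esub> (k - i)"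
    by (rule perms.conj_letter_base[OF stable_closed act_closed])
  also have "\<dots> = act (gen (a, i))"
  proof (rule perms.conj_power_shift[where I = "{i. (a, i) \<in> letters}" and g = "\<lambda>i. act (gen (a, i))",
        OF stable_closed act_closed])
    show "k \<in> {i. (a, i) \<in> letters}"
      using \<open>a \<in> \<Sigma>\<close> window by (simp add: letters_def k_def)
    show "i \<in> {i. (a, i) \<in> letters}" using assms by simp
    fix i assume i: "i \<in> {i. (a, i) \<in> letters}" "i + 1 \<in> {i. (a, i) \<in> letters}"
    then have "(a, i) \<in> letters - {(j, hi)}" by (auto simp: letters_def)
    from stable_act[OF this]
    have "stable \<otimes>\<^bsub>perms\<^esub> act (gen (a, i)) = act (gen (a, i + 1)) \<otimes>\<^bsub>perms\<^esub> stable"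
      by (simp add: up_def)
    then show "act (gen (a, i + 1)) = stable \<otimes>\<^bsub>perms\<^esub> act (gen (a, i)) \<otimes>\<^bsub>perms\<^esub> inv\<^bsub>perms\<^esub> stable"
      using stable_closed act_closed by (metis perms.inv_solve_right perms.m_closed)
  qed (auto simp: letters_def)
  finally show ?thesis .
qed

lemma word_eval_act:
  assumes "fst ` set v \<subseteq> letters"
  shows "word_eval perms (conj_letter perms stable rep \<phi>) v = act (one_relator_eval s v)"
proof -
  interpret act: group_hom base perms act
    by (rule presented.group_hom_translation)
  have "word_eval perms (conj_letter perms stable rep \<phi>) v = word_eval perms (act \<circ> gen) v"
  proof (rule word_eval_cong)
    fix p assume "p \<in> fst ` set v"
    then have "p \<in> letters" using assms by (rule subsetD[rotated])
    then show "conj_letter perms stable rep \<phi> p = (act \<circ> gen) p"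
      by (cases p) (simp add: conj_letter_rep)
  qed
  also have "\<dots> = act (one_relator_eval s v)"
    by (rule act.hom_word_eval[symmetric]) auto
  finally show ?thesis .
qed

lemma rep_relator:
  assumes "height \<phi> r = 0" "unwind t \<phi> 0 r = s" "fst ` set s \<subseteq> letters"
  shows "word_eval perms rep r = id"
proof -
  have "word_eval perms rep r = word_eval perms (conj_letter perms stable rep \<phi>) (unwind t \<phi> 0 r)"
    by (rule perms.word_eval_unwind_height_zero[where t = t and \<phi> = \<phi> and \<rho> = rep, symmetric, OF stable_closed _ rep_stable assms(1)])
      (use rep_closed in blast)
  also have "\<dots> = act (one_relator_eval s s)"
    using assms by (simp add: word_eval_act)
  also have "\<dots> = id"
    using generator_relator[of s] by (simp add: presented.translation_one)
  finally show ?thesis .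
qed

text \<open>The base group acts faithfully by translations. The starting level \<open>h\<close> is
  arbitrary because it only conjugates by a power of \<open>stable\<close>; the Freiheitssatz
  exploits this choice.\<close>

lemma rep_eq_id:
  assumes "word_eval perms rep w = id" "height \<phi> w = 0" "fst ` set (unwind t \<phi> h w) \<subseteq> letters"
  shows "one_relator_eval s (unwind t \<phi> h w) = \<one>\<^bsub>base\<^esub>"
proof -
  have "stable [^]\<^bsub>perms\<^esub> h \<otimes>\<^bsub>perms\<^esub> word_eval perms rep w =
      act (one_relator_eval s (unwind t \<phi> h w)) \<otimes>\<^bsub>perms\<^esub> stable [^]\<^bsub>perms\<^esub> h"
    using perms.word_eval_unwind[where t = t and h = h and \<phi> = \<phi> and w = w and \<rho> = rep, OF stable_closed _ rep_stable]
      rep_closed assms word_eval_act by (simp add: image_subset_iff)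
  moreover have *: "stable [^]\<^bsub>perms\<^esub> h \<in> carrier perms"
    by (rule perms.int_pow_closed[OF stable_closed])
  moreover have eval: "one_relator_eval s (unwind t \<phi> h w) \<in> carrier base" by (rule presented.word_eval_closed) auto
  moreover from this have "act (one_relator_eval s (unwind t \<phi> h w)) \<in> carrier perms"
    by (simp add: presented.bij_translation)
  ultimately have "act (one_relator_eval s (unwind t \<phi> h w)) = \<one>\<^bsub>perms\<^esub>"
    using assms(1) by (metis perms.r_cancel_one' perms.r_one one_perms)
  then show ?thesis using presented.translation_eq_id_iff[OF eval] by simp
qed

end

text \<open>The integers, acting on themselves by addition, form an image in which the relator
  holds.\<close>

lemma consequence_height:
  assumes "height \<phi> r = 0" "one_relator_eval r w = \<one>\<^bsub>one_relator_group r\<^esub>"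
  shows "height \<phi> w = 0"
proof -
  have inv_shift: "inv_into UNIV ((+) k) = (+) (- k)" for k :: int
    by (rule Hilbert_Choice.inv_equality) auto
  have eval: "word_eval perms (\<lambda>a. (+) (\<phi> a)) v = (+) (height \<phi> v)" for v
  proof (induction v)
    case (Cons x v)
    then show ?case
      by (cases x) (auto simp: word_eval_Cons height_Cons inv_shift fun_eq_iff bij_plus)
  qed auto
  have "word_eval perms (\<lambda>a. (+) (\<phi> a)) w = \<one>\<^bsub>perms\<^esub>"
    by (rule one_relator_consequence[OF group_perms _ _ assms(2)])
      (use eval[of r] assms(1) in \<open>auto simp: bij_plus\<close>)
  then have "(+) (height \<phi> w) = (id :: int \<Rightarrow> int)" using eval by simp
  then have "height \<phi> w + 0 = 0" by (metis id_apply)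
  then show ?thesis by simp
qed

lemma height_linear:
  "height (\<lambda>a. p * f a + q * g a) w = p * height f w + q * height g w"
  by (induction w) (auto simp: height_Cons algebra_simps)

lemma unwind_no_stable:
  assumes "\<And>a. a \<noteq> t \<Longrightarrow> \<phi> a = 0" "t \<notin> fst ` set w" "(a, i) \<in> fst ` set (unwind t \<phi> h w)"
  shows "i = h"
  using assms(2,3)
proof (induction w)
  case (Cons x w)
  obtain b e where x: "x = (b, e)" by (cases x)
  have "b \<noteq> t" using Cons.prems(1) x by auto
  then have "unwind t \<phi> h (x # w) = ((b, h), e) # unwind t \<phi> h w"
    using x assms(1) by (cases e) auto
  then show ?case using Cons by auto
qed simp

text \<open>A consequence \<open>w\<close> of \<open>r\<close> is trivial under \<open>rep\<close>,
  so its unwinding is trivial in the base group. That unwinding omits the letter \<open>c\<close> of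
  the shorter relator, so induction makes it empty; then \<open>w\<close> is a power of
  \<open>t\<close> of height zero. The choice of \<open>t\<close>, \<open>j\<close>,
  \<open>c\<close> and \<open>h\<close> differs between the two uses.\<close>

lemma omits_freely_step:
  fixes r :: "'a::countable word"
  assumes \<phi>: "height \<phi> r = 0" "\<phi> t \<noteq> 0"
    and IH: "\<And>c. c \<in> fst ` set (unwind t \<phi> 0 r) \<Longrightarrow> omits_freely (unwind t \<phi> 0 r) c"
    and j: "j \<in> fst ` set r" "j \<noteq> t" and c: "c \<in> fst ` set (unwind t \<phi> 0 r)"
    and w: "reduced w" "one_relator_eval r w = \<one>\<^bsub>one_relator_group r\<^esub>"
    and w_letters: "\<And>i. (j, i) \<in> fst ` set (unwind t \<phi> h w) \<Longrightarrow> (j, i) \<in> fst ` set (unwind t \<phi> 0 r)"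
      "c \<notin> fst ` set (unwind t \<phi> h w)"
  shows "w = []"
proof -
  define s where "s = unwind t \<phi> 0 r"
  define I where "I = {i. (j, i) \<in> fst ` set s}"
  have "I \<subseteq> snd ` fst ` set s" unfolding I_def by force
  then have fin: "finite I" by (rule finite_subset) simp
  obtain i0 where "(j, i0) \<in> fst ` set s" unfolding s_def by (rule letter_unwind[OF j])
  then have ne: "I \<noteq> {}" by (auto simp: I_def)
  \<comment> \<open>Both ends of the window must occur in \<open>s\<close>, since the induction
    hypothesis only omits letters of the relator.\<close>
  have I: "(j, Min I) \<in> fst ` set s" "(j, Max I) \<in> fst ` set s"
    using Min_in[OF fin ne] Max_in[OF fin ne] by (auto simp: I_def)
  interpret magnus_step s t j \<phi> "- {t}" "Min I" "Max I"
  proof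
    show "Min I \<le> Max I" using fin ne by (meson Max_in Min_le)
    show "omits_freely s (j, Max I)" "omits_freely s (j, Min I)"
      using IH I unfolding s_def by blast+
  qed (use j in auto)
  have window_letters: "fst ` set v \<subseteq> letters"
    if "\<And>a i. (a, i) \<in> fst ` set v \<Longrightarrow> a \<noteq> t" "\<And>i. (j, i) \<in> fst ` set v \<Longrightarrow> i \<in> I" for v
  proof
    fix p assume p: "p \<in> fst ` set v"
    obtain a i where ai: "p = (a, i)" by (cases p)
    then have "a \<noteq> t" "a = j \<Longrightarrow> i \<in> I" using that p by blast+
    then show "p \<in> letters" using ai fin by (simp add: letters_def)
  qed
  have "fst ` set s \<subseteq> letters"
  proof (rule window_letters)
    show "a \<noteq> t" if "(a, i) \<in> fst ` set s" for a i
      using letters_unwind[of a i t \<phi> 0 r] that by (simp add: s_def)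
  qed (simp add: I_def)
  then have rel: "word_eval perms rep r = id"
    using rep_relator \<phi>(1) s_def by blast
  have "word_eval perms rep w = \<one>\<^bsub>perms\<^esub>"
    by (rule one_relator_consequence[OF group_perms _ _ w(2)]) (use rel rep_closed in auto)
  then have "word_eval perms rep w = id" by simp
  moreover have hw: "height \<phi> w = 0" by (rule consequence_height[OF \<phi>(1) w(2)])
  moreover have "fst ` set (unwind t \<phi> h w) \<subseteq> letters"
  proof (rule window_letters)
    show "a \<noteq> t" if "(a, i) \<in> fst ` set (unwind t \<phi> h w)" for a i
      using letters_unwind[of a i t \<phi> h w] that by simp
  qed (use w_letters(1) in \<open>simp add: I_def s_def\<close>)
  ultimately have "one_relator_eval s (unwind t \<phi> h w) = \<one>\<^bsub>base\<^esub>"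
    by (rule rep_eq_id)
  moreover have "omits_freely s c" using IH c unfolding s_def by blast
  moreover have "reduced (unwind t \<phi> h w)" using \<phi>(2) w(1) by (rule reduced_unwind)
  ultimately have "unwind t \<phi> h w = []"
    by (intro omits_freelyD[OF _ _ w_letters(2)])
  then have "fst ` set w \<subseteq> {t}" by (simp only: unwind_eq_Nil_iff)
  then show "w = []" by (rule height_stable_word[OF w(1) _ \<phi>(2) hw])
qed

text \<open>Killing \<open>y\<close> kills \<open>r\<close> and leaves the free group on the
  remaining letters.\<close>

lemma omits_freely_single_letter:
  assumes "fst ` set r \<subseteq> {y}"
  shows "omits_freely r y"
proof (rule omits_freelyI)
  interpret F: group "free_group (UNIV :: 'a set)" by (rule group_free_group)
  fix w assume w: "reduced w" "y \<notin> fst ` set w" "one_relator_eval r w = \<one>\<^bsub>one_relator_group r\<^esub>"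
  define f where "f a = (if a = y then [] else [(a, True)])" for a
  have one: "word_eval (free_group UNIV) f v = []" if "fst ` set v \<subseteq> {y}" for v
    using that F.inv_one
    by (induction v) (auto simp: word_eval_Cons f_def free_group_def reduce_def)
  have "word_eval (free_group UNIV) f w = \<one>\<^bsub>free_group UNIV\<^esub>"
    by (rule one_relator_consequence[OF F.group_axioms _ _ w(3)])
      (use one[OF assms] in \<open>auto simp: f_def free_group_def reduced_def\<close>)
  moreover have "word_eval (free_group UNIV) f w = word_eval (free_group UNIV) (\<lambda>a. [(a, True)]) w"
    using w(2) by (intro word_eval_cong) (auto simp: f_def)
  ultimately show "w = []"
    using w(1) by (simp add: word_eval_free_group reduce_reduced) (simp add: free_group_def)
qed

text \<open>Unwinding changes the letter type to pairs; fixing the natural numbers and re-encoding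
  the pairs keeps the induction on the length within one statement.\<close>

theorem freiheitssatz_nat:
  fixes r :: "nat word"
  assumes "cyclically_reduced r" "y \<in> fst ` set r"
  shows "omits_freely r y"
  using assms
proof (induction r arbitrary: y rule: measure_induct_rule[where f = length])
  case (less r)
  have IH: "omits_freely (unwind t \<phi> 0 r) c"
    if t: "t \<in> fst ` set r" "\<phi> t \<noteq> 0" "height \<phi> r = 0" and c: "c \<in> fst ` set (unwind t \<phi> 0 r)" for t \<phi> c
  proof -
    let ?s = "unwind t \<phi> 0 r" and ?enc = "to_nat :: nat \<times> int \<Rightarrow> nat"
    let ?r = "map (\<lambda>(p, e). (?enc p, e)) ?s"
    have "cyclically_reduced ?s"
      by (rule cyclically_reduced_unwind[OF t(2) less.prems(1) t(3)])
    then have "cyclically_reduced ?r"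
      using reduced_map_inj[of ?enc "?s @ ?s"] by (simp add: cyclically_reduced_iff)
    moreover have "length ?r < length r"
      using length_unwind_less[OF t(1), of \<phi> 0] by simp
    moreover have "?enc c \<in> fst ` set ?r"
      using c by (force simp: image_iff)
    ultimately have "omits_freely ?r (?enc c)" using less.IH by blast
    then show ?thesis by (rule omits_freely_map[OF inj_to_nat])
  qed
  show ?case
  proof (cases "fst ` set r \<subseteq> {y}")
    case True
    then show ?thesis by (rule omits_freely_single_letter)
  next
    case False
    then obtain x where x: "x \<in> fst ` set r" "x \<noteq> y" by blast
    define e where "e = height (\<lambda>a. if a = y then 1 else 0) r"
    define f where "f = height (\<lambda>a. if a = x then 1 else 0) r"
    show ?thesis
    proof (rule omits_freelyI)
      fix w assume w: "reduced w" "y \<notin> fst ` set w" "one_relator_eval r w = \<one>\<^bsub>one_relator_group r\<^esub>"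
      show "w = []"
      proof (cases "e = 0")
        case False
        \<comment> \<open>The exponent sums \<open>e\<close> of \<open>y\<close> and
          \<open>f\<close> of \<open>x\<close> cancel: \<open>- e * f + f * e = 0\<close>. With
          \<open>x\<close> as stable letter, \<open>w\<close> has no \<open>y\<close> and its
          unwinding has no copy of \<open>y\<close>, so any copy of \<open>y\<close> in the new
          relator can be omitted.\<close>
        define \<phi> where "\<phi> a = (- e) * (if a = x then 1 else 0) + f * (if a = y then 1 else 0)" for a
        have \<phi>: "height \<phi> r = 0" "\<phi> x \<noteq> 0"
          using False x unfolding \<phi>_def height_linear e_def[symmetric] f_def[symmetric] by auto
        obtain i where i: "(y, i) \<in> fst ` set (unwind x \<phi> 0 r)"
          using letter_unwind[OF less.prems(2) x(2)[symmetric]] .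
        have no_y: "(y, k) \<notin> fst ` set (unwind x \<phi> 0 w)" for k
          using letters_unwind[of y k x \<phi> 0 w] w(2) by blast
        show ?thesis
          by (rule omits_freely_step[where t = x and \<phi> = \<phi> and h = 0 and j = y and c = "(y, i)",
                OF \<phi> IH[OF x(1) \<phi>(2,1)] less.prems(2) x(2)[symmetric] i w(1,3)])
            (use no_y in blast)+
      next
        case True
        \<comment> \<open>Now \<open>y\<close> itself is the stable letter. As \<open>w\<close> has
          no \<open>y\<close>, its unwinding stays at the starting level, chosen as a level
          \<open>h\<close> at which \<open>x\<close> occurs in the new relator; a letter of that
          relator at another level is omitted.\<close>
        define \<phi> :: "nat \<Rightarrow> int" where "\<phi> a = (if a = y then 1 else 0)" for a
        have \<phi>: "height \<phi> r = 0" "\<phi> y \<noteq> 0" "\<And>a. a \<noteq> y \<Longrightarrow> \<phi> a = 0"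
          using True by (simp_all add: e_def \<phi>_def[abs_def])
        obtain h where h: "(x, h) \<in> fst ` set (unwind y \<phi> 0 r)"
          using letter_unwind[OF x] .
        obtain b k where bk: "(b, k) \<in> fst ` set (unwind y \<phi> 0 r)" "k \<noteq> h"
          using unwind_not_constant[where t = y and \<phi> = \<phi> and k = h, OF \<phi>(2,3) less.prems(1) \<phi>(1) less.prems(2) x] .
        have level: "i = h" if "(a, i) \<in> fst ` set (unwind y \<phi> h w)" for a i
          using unwind_no_stable[where t = y and \<phi> = \<phi>, OF \<phi>(3) w(2) that] .
        show ?thesis
          by (rule omits_freely_step[where t = y and \<phi> = \<phi> and h = h and j = x and c = "(b, k)",
                OF \<phi>(1,2) IH[OF less.prems(2) \<phi>(2,1)] x bk(1) w(1,3)])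
            (use level h bk(2) in blast)+
      qed
    qed
  qed
qed

theorem freiheitssatz:
  fixes r :: "'a::countable word"
  assumes "cyclically_reduced r" "y \<in> fst ` set r"
  shows "omits_freely r y"
proof (rule omits_freely_map[of "to_nat :: 'a \<Rightarrow> nat"])
  let ?r = "map (\<lambda>(a, e). (to_nat a, e)) r"
  have "cyclically_reduced ?r"
    using assms(1) reduced_map_inj[of to_nat "r @ r"] by (simp add: cyclically_reduced_iff)
  moreover have "to_nat y \<in> fst ` set ?r"
    using assms(2) by (force simp: image_iff)
  ultimately show "omits_freely ?r (to_nat y)" by (rule freiheitssatz_nat)
qed simp

section \<open>Two generators and one relator\<close>

context group
begin

lemma inv_commute:
  assumes "x \<in> carrier G" "y \<in> carrier G" "x \<otimes> y = y \<otimes> x"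
  shows "inv x \<otimes> y = y \<otimes> inv x"
proof -
  have "inv x \<otimes> y = inv x \<otimes> (y \<otimes> x) \<otimes> inv x"
    using assms(1,2) by (simp add: m_assoc)
  also have "\<dots> = inv x \<otimes> (x \<otimes> y) \<otimes> inv x" by (simp only: assms(3))
  also have "\<dots> = y \<otimes> inv x" using assms(1,2) by (simp flip: m_assoc)
  finally show ?thesis .
qed

lemma word_eval_commute:
  assumes "f ` fst ` set w \<subseteq> carrier G" "x \<in> carrier G"
    and "\<And>a. a \<in> fst ` set w \<Longrightarrow> f a \<otimes> x = x \<otimes> f a"
  shows "word_eval G f w \<otimes> x = x \<otimes> word_eval G f w"
  using assms
proof (induction w)
  case (Cons l w)
  define g where "g = (if snd l then f (fst l) else inv (f (fst l)))"
  have l: "f (fst l) \<in> carrier G" "f (fst l) \<otimes> x = x \<otimes> f (fst l)" using Cons.prems by auto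
  have g: "g \<in> carrier G" "g \<otimes> x = x \<otimes> g"
    using l Cons.prems(2) inv_commute by (auto simp: g_def)
  have w: "word_eval G f w \<in> carrier G" "word_eval G f w \<otimes> x = x \<otimes> word_eval G f w"
    using Cons by auto
  have "g \<otimes> word_eval G f w \<otimes> x = g \<otimes> x \<otimes> word_eval G f w"
    using g(1) w Cons.prems(2) by (simp add: m_assoc)
  also have "\<dots> = x \<otimes> (g \<otimes> word_eval G f w)"
    using g w(1) Cons.prems(2) by (simp add: m_assoc)
  finally show ?case by (simp add: word_eval_Cons g_def)
qed simp

lemma word_eval_single_letter:
  assumes "f c \<in> carrier G" "fst ` set w \<subseteq> {c}"
  obtains m :: int where "word_eval G f w = f c [^] m"
proof -
  have "\<exists>m::int. word_eval G f w = f c [^] m"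
    using assms(2)
  proof (induction w)
    case Nil
    show ?case by (intro exI[of _ 0]) simp
  next
    case (Cons l w)
    then obtain m :: int where m: "word_eval G f w = f c [^] m" by auto
    have "f c [^] (1 + m) = f c \<otimes> f c [^] m" "f c [^] (- 1 + m) = inv (f c) \<otimes> f c [^] m"
      using assms(1) int_pow_mult[OF assms(1), of 1 m] int_pow_mult[OF assms(1), of "-1" m]
      by (simp_all add: int_pow_neg)
    then show ?case
      using m Cons.prems by (intro exI[of _ "if snd l then 1 + m else - 1 + m"]) (simp add: word_eval_Cons)
  qed
  then show ?thesis using that by blast
qed

text \<open>Of any two members of the chain one is a power of the other.\<close>

lemma power_chain_commute:
  fixes Z :: "int \<Rightarrow> 'a" and m :: int
  assumes Z: "\<And>i. Z i \<in> carrier G"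
    and chain: "(\<forall>i. Z (i + 1) = Z i [^] m) \<or> (\<forall>i. Z i = Z (i + 1) [^] m)"
  shows "Z i \<otimes> Z k = Z k \<otimes> Z i"
proof -
  have comm_pow: "x [^] n \<otimes> x = x \<otimes> x [^] n" if "x \<in> carrier G" for x and n :: int
    using int_pow_mult[OF that, of n 1] int_pow_mult[OF that, of 1 n] that by (simp add: add.commute)
  have "Z i \<otimes> Z (i + int n) = Z (i + int n) \<otimes> Z i" for i n
    using chain
  proof
    assume c: "\<forall>i. Z (i + 1) = Z i [^] m"
    have "\<exists>l::int. Z (i + int n) = Z i [^] l"
    proof (induction n)
      case 0
      show ?case using Z by (intro exI[of _ 1]) simp
    next
      case (Suc n)
      then obtain l :: int where "Z (i + int n) = Z i [^] l" by blast
      moreover have "i + int (Suc n) = (i + int n) + 1" by simp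
      ultimately show ?case using c Z by (metis int_pow_pow)
    qed
    then show ?thesis using comm_pow Z by metis
  next
    assume c: "\<forall>i. Z i = Z (i + 1) [^] m"
    have "\<exists>l::int. Z i = Z (i + int n) [^] l"
    proof (induction n)
      case 0
      show ?case using Z by (intro exI[of _ 1]) simp
    next
      case (Suc n)
      then obtain l :: int where "Z i = Z (i + int n) [^] l" by blast
      moreover have "i + int (Suc n) = (i + int n) + 1" by simp
      ultimately show ?case using c Z by (metis int_pow_pow)
    qed
    then show ?thesis using comm_pow Z by metis
  qed
  from this[of i "nat (k - i)"] this[of k "nat (i - k)"] show ?thesis
    by (cases "i \<le> k") auto
qed

lemma solvableI_commutators:
  assumes K: "subgroup K G"
    and comm: "\<And>x y. x \<in> carrier G \<Longrightarrow> y \<in> carrier G \<Longrightarrow> x \<otimes> y \<otimes> inv x \<otimes> inv y \<in> K"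
    and abelian: "\<And>x y. x \<in> K \<Longrightarrow> y \<in> K \<Longrightarrow> x \<otimes> y = y \<otimes> x"
  shows "solvable G"
proof -
  have "derived G (carrier G) \<subseteq> K"
    unfolding derived_def by (rule generate_subgroup_incl[OF _ K]) (use comm in auto)
  then have "derived_set G (derived G (carrier G)) \<subseteq> {\<one>}"
  proof (safe, goal_cases)
    case (1 x y z)
    then have xy: "y \<in> K" "z \<in> K" by auto
    then have yz: "y \<in> carrier G" "z \<in> carrier G" using subgroup.subset[OF K] by auto
    have "y \<otimes> z \<otimes> inv y \<otimes> inv z = z \<otimes> y \<otimes> inv y \<otimes> inv z"
      using abelian[OF xy] by simp
    also have "\<dots> = \<one>" using yz by (simp add: m_assoc)
    finally show ?case .
  qed
  then have "derived G (derived G (carrier G)) \<subseteq> {\<one>}"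
    unfolding derived_def[of G "derived G (carrier G)"]
    by (rule generate_subgroup_incl[OF _ triv_subgroup])
  moreover have "\<one> \<in> derived G (derived G (carrier G))"
    unfolding derived_def[of G "derived G (carrier G)"] by (rule generate.one)
  ultimately have "(derived G ^^ 2) (carrier G) = {\<one>}"
    by (auto simp: numeral_2_eq_2)
  then show ?thesis unfolding solvable_iff_trivial_derived_seq by blast
qed

end

text \<open>The words of height zero represent a subgroup that contains all commutators. Unwinding
  writes it in terms of the \<open>Z i\<close>, which commute by the chain condition, as in a
  Baumslag-Solitar group \<open>BS(1, m)\<close>.\<close>

lemma (in presentation) solvable_two_generators:
  fixes m :: int
  assumes gens: "fst P = {t, y}" and \<phi>: "\<phi> t = 1"
    and rel: "\<And>r. r \<in> set (snd P) \<Longrightarrow> height \<phi> r = 0"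
    and chain: "\<And>i. conj_letter (presented_group P) (generator P t) (generator P) \<phi> (y, i) = Z i"
      "(\<forall>i. Z (i + 1) = Z i [^]\<^bsub>presented_group P\<^esub> m) \<or> (\<forall>i. Z i = Z (i + 1) [^]\<^bsub>presented_group P\<^esub> m)"
  shows "solvable (presented_group P)"
proof -
  let ?G = "presented_group P" and ?g = "generator P"
  let ?C = "conj_letter ?G (?g t) ?g \<phi>"
  define W where "W = {w. fst ` set w \<subseteq> {t, y} \<and> height \<phi> w = 0}"
  have gen: "?g a \<in> carrier ?G" if "a \<in> {t, y}" for a
    using generator_closed that gens by blast
  have gen_image: "?g ` fst ` set w \<subseteq> carrier ?G" if "fst ` set w \<subseteq> {t, y}" for w
    using that gen by blast
  have T: "?g t \<in> carrier ?G" "?g t = ?g t [^]\<^bsub>?G\<^esub> \<phi> t" using gen \<phi> by simp_all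
  have Z: "Z i \<in> carrier ?G" for i
    using gen by (simp flip: chain(1))
  have C: "?C p \<in> carrier ?G" "\<exists>i. ?C p = Z i" if p: "p \<in> fst ` set (unwind t \<phi> 0 w)" and w: "w \<in> W" for p w
  proof -
    obtain a i where ai: "p = (a, i)" by (cases p)
    then have "a \<in> fst ` set w" "a \<noteq> t" using letters_unwind[of a i t \<phi> 0 w] p by auto
    then have "a = y" using w by (auto simp: W_def)
    then show "\<exists>i. ?C p = Z i" using ai chain(1) by blast
    then show "?C p \<in> carrier ?G" using Z by auto
  qed
  have eval: "word_eval ?G ?g w = word_eval ?G ?C (unwind t \<phi> 0 w)" if w: "w \<in> W" for w
    by (rule presented.word_eval_unwind_height_zero[where t = t and \<phi> = \<phi> and \<rho> = "generator P", symmetric, OF T(1) _ T(2)])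
      (use w gen_image in \<open>auto simp only: W_def\<close>)
  have comm: "word_eval ?G ?g v \<otimes>\<^bsub>?G\<^esub> word_eval ?G ?g w = word_eval ?G ?g w \<otimes>\<^bsub>?G\<^esub> word_eval ?G ?g v"
    if v: "v \<in> W" and w: "w \<in> W" for v w
    unfolding eval[OF v] eval[OF w]
  proof (rule presented.word_eval_commute)
    fix p assume p: "p \<in> fst ` set (unwind t \<phi> 0 v)"
    have "word_eval ?G ?C (unwind t \<phi> 0 w) \<otimes>\<^bsub>?G\<^esub> ?C p = ?C p \<otimes>\<^bsub>?G\<^esub> word_eval ?G ?C (unwind t \<phi> 0 w)"
    proof (rule presented.word_eval_commute)
      fix q assume q: "q \<in> fst ` set (unwind t \<phi> 0 w)"
      show "?C q \<otimes>\<^bsub>?G\<^esub> ?C p = ?C p \<otimes>\<^bsub>?G\<^esub> ?C q"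
        using C(2)[OF p v] C(2)[OF q w] presented.power_chain_commute[OF Z chain(2)] by metis
    qed (use C(1) p v w in blast)+
    then show "?C p \<otimes>\<^bsub>?G\<^esub> word_eval ?G ?C (unwind t \<phi> 0 w) = word_eval ?G ?C (unwind t \<phi> 0 w) \<otimes>\<^bsub>?G\<^esub> ?C p" ..
  next
    show "word_eval ?G ?C (unwind t \<phi> 0 w) \<in> carrier ?G"
      by (rule presented.word_eval_closed) (use C(1) w in blast)
  qed (use C(1) v in blast)
  show ?thesis
  proof (rule presented.solvableI_commutators[where K = "word_eval ?G ?g ` W"])
    show "subgroup (word_eval ?G ?g ` W) ?G"
    proof (rule presented.subgroupI)
      show "word_eval ?G ?g ` W \<subseteq> carrier ?G"
      proof (rule image_subsetI)
        fix w assume "w \<in> W"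
        then have "fst ` set w \<subseteq> {t, y}" by (simp add: W_def)
        then show "word_eval ?G ?g w \<in> carrier ?G"
          by (intro presented.word_eval_closed gen_image)
      qed
      show "word_eval ?G ?g ` W \<noteq> {}" by (auto simp: W_def intro!: exI[of _ "[]"])
      fix x assume "x \<in> word_eval ?G ?g ` W"
      then obtain v where v: "x = word_eval ?G ?g v" "fst ` set v \<subseteq> {t, y}" "height \<phi> v = 0"
        by (auto simp only: W_def)
      have "inv\<^bsub>?G\<^esub> x = word_eval ?G ?g (inv_word v)"
        unfolding v(1) using gen_image[OF v(2)] by (simp add: presented.word_eval_inv_word)
      then show "inv\<^bsub>?G\<^esub> x \<in> word_eval ?G ?g ` W"
        using v by (intro image_eqI[of _ _ "inv_word v"]) (simp_all add: W_def letters_inv_word height_inv_word)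
      fix z assume "z \<in> word_eval ?G ?g ` W"
      then obtain w where w: "z = word_eval ?G ?g w" "fst ` set w \<subseteq> {t, y}" "height \<phi> w = 0"
        by (auto simp only: W_def)
      have "x \<otimes>\<^bsub>?G\<^esub> z = word_eval ?G ?g (v @ w)"
        unfolding v(1) w(1) using gen_image[OF v(2)] gen_image[OF w(2)] by (simp add: presented.word_eval_append)
      then show "x \<otimes>\<^bsub>?G\<^esub> z \<in> word_eval ?G ?g ` W"
        using v w by (intro image_eqI[of _ _ "v @ w"]) (simp_all add: W_def height_append image_Un)
    qed
  next
    fix x z assume "x \<in> carrier ?G" "z \<in> carrier ?G"
    then obtain v w where v: "x = word_eval ?G ?g v" "fst ` set v \<subseteq> {t, y}"
      and w: "z = word_eval ?G ?g w" "fst ` set w \<subseteq> {t, y}"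
      using carrier_presented_group gens unfolding free_group_def by (metis (no_types, lifting) mem_Collect_eq partial_object.select_convs(1))
    have "x \<otimes>\<^bsub>?G\<^esub> z \<otimes>\<^bsub>?G\<^esub> inv\<^bsub>?G\<^esub> x \<otimes>\<^bsub>?G\<^esub> inv\<^bsub>?G\<^esub> z
        = word_eval ?G ?g (v @ w @ inv_word v @ inv_word w)"
      unfolding v(1) w(1) using gen_image[OF v(2)] gen_image[OF w(2)]
      by (simp add: presented.word_eval_append presented.word_eval_inv_word letters_inv_word image_Un presented.m_assoc)
    then show "x \<otimes>\<^bsub>?G\<^esub> z \<otimes>\<^bsub>?G\<^esub> inv\<^bsub>?G\<^esub> x \<otimes>\<^bsub>?G\<^esub> inv\<^bsub>?G\<^esub> z \<in> word_eval ?G ?g ` W"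
      using v w by (intro image_eqI[of _ _ "v @ w @ inv_word v @ inv_word w"])
        (simp_all add: W_def height_append height_inv_word letters_inv_word image_Un)
  qed (use comm in blast)
qed

text \<open>\<open>P\<close> may have further relators that follow from \<open>r\<close>. This fits
  the two relators of a cyclic presentation on two generators without passing to another
  group.\<close>

theorem two_generators_one_relator:
  fixes P :: "'a::countable presentation"
  assumes "presentation P" and gens: "fst P = {t, y}" "t \<noteq> y" and r: "r \<in> set (snd P)" "cyclically_reduced r" "y \<in> fst ` set r"
    and cons: "\<And>r'. r' \<in> set (snd P) \<Longrightarrow> one_relator_eval r r' = \<one>\<^bsub>one_relator_group r\<^esub>"
    and \<phi>: "\<phi> t = 1" "height \<phi> r = 0"
  shows "contains_nonabelian_free_subgroup (presented_group P) \<or> solvable (presented_group P)"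
proof -
  interpret presentation P by fact
  define s where "s = unwind t \<phi> 0 r"
  define I where "I = {i. (y, i) \<in> fst ` set s}"
  define lo where "lo = Min I"
  define hi where "hi = Max I"
  have "I \<subseteq> snd ` fst ` set s" unfolding I_def by force
  then have fin: "finite I" by (rule finite_subset) simp
  obtain i0 where "(y, i0) \<in> fst ` set s"
    unfolding s_def by (rule letter_unwind[OF r(3) gens(2)[symmetric]])
  then have ne: "I \<noteq> {}" by (auto simp: I_def)
  have mem: "(y, lo) \<in> fst ` set s" "(y, hi) \<in> fst ` set s"
    using Min_in[OF fin ne] Max_in[OF fin ne] by (auto simp: I_def lo_def hi_def)
  have s_cyc: "cyclically_reduced s"
    unfolding s_def by (rule cyclically_reduced_unwind) (use \<phi> r in auto)
  interpret S: magnus_step s t y \<phi> "{y}" lo hi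
  proof
    show "lo \<le> hi" using fin ne by (simp add: lo_def hi_def)
  qed (use gens freiheitssatz[OF s_cyc] mem in auto)
  have r_letters: "fst ` set r \<subseteq> {t, y}" using relators[OF r(1)] gens by simp
  have s_letters: "a = y \<and> i \<in> I" if "(a, i) \<in> fst ` set s" for a i
  proof -
    have "a = y" using letters_unwind[of a i t \<phi> 0 r] that r_letters unfolding s_def by blast
    then show ?thesis using that by (simp add: I_def)
  qed
  have s_sub: "fst ` set s \<subseteq> S.letters"
  proof
    fix p assume p: "p \<in> fst ` set s"
    obtain a i where ai: "p = (a, i)" by (cases p)
    have "a = y" "i \<in> I" using ai s_letters p by blast+
    moreover from this have "lo \<le> i" "i \<le> hi" using fin by (simp_all add: lo_def hi_def)
    ultimately show "p \<in> S.letters" using ai by (simp add: S.letters_def)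
  qed
  have rep_r: "word_eval perms S.rep r = \<one>\<^bsub>perms\<^esub>"
    using S.rep_relator[OF \<phi>(2) s_def[symmetric] s_sub] by simp
  have range_rep: "range S.rep \<subseteq> carrier perms" using S.rep_closed by blast
  have rels: "word_eval perms S.rep r' = \<one>\<^bsub>perms\<^esub>" if "r' \<in> set (snd P)" for r'
    by (rule one_relator_consequence[OF group_perms range_rep rep_r cons[OF that]])
  have rep_t: "S.rep t = S.stable" using S.rep_stable \<phi>(1) S.stable_closed by simp
  \<comment> \<open>These words in the generators of \<open>P\<close> represent the base generators;
    all free pairs below are built from them and \<open>t\<close>.\<close>
  have rep_conj: "word_eval perms S.rep (conj_word t \<phi> (y, i)) = S.act (S.gen (y, i))" if "lo \<le> i" "i \<le> hi" for i
    using perms.word_eval_conj_word[of S.rep t y \<phi> i, OF S.rep_closed S.rep_closed]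
      S.conj_letter_rep[of y i] that rep_t by (simp add: S.letters_def)
  have conj_letters: "fst ` set (conj_word t \<phi> (y, i)) \<subseteq> fst P" for i
    using letters_conj_word[of t \<phi> y i] gens by blast
  have lower_upper: "hi \<le> lo + 1" "S.gen (y, hi) \<in> S.lower \<or> S.gen (y, lo) \<in> S.upper"
    if no_free: "\<not> contains_nonabelian_free_subgroup (presented_group P)"
  proof -
    show "hi \<le> lo + 1"
    proof (rule ccontr)
      assume wide: "\<not> hi \<le> lo + 1"
      \<comment> \<open>With at least three levels in the window, the two lowest copies of
        \<open>y\<close> both avoid \<open>(y, hi)\<close> and are free by the
        Freiheitssatz.\<close>
      define k where "k b = (if b then lo else lo + 1)" for b
      have k: "lo \<le> k b" "k b \<le> hi" "k b \<noteq> hi" for b using wide by (auto simp: k_def)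
      interpret act: group_hom S.base perms S.act by (rule S.presented.group_hom_translation)
      have "free_family perms (\<lambda>b. S.act (S.gen (y, k b))) UNIV"
        unfolding free_family_def
      proof (intro conjI allI impI)
        show "range (\<lambda>b. S.act (S.gen (y, k b))) \<subseteq> carrier perms"
          using S.act_closed by blast
        fix w :: "bool word"
        let ?w = "map (\<lambda>(b, e). ((y, k b), e)) w"
        assume w: "reduced w \<and> fst ` set w \<subseteq> UNIV \<and> word_eval perms (\<lambda>b. S.act (S.gen (y, k b))) w = \<one>\<^bsub>perms\<^esub>"
        have "S.act (word_eval S.base (\<lambda>b. S.gen (y, k b)) w) = word_eval perms (S.act \<circ> (\<lambda>b. S.gen (y, k b))) w"
          by (rule act.hom_word_eval) auto
        then have "S.act (word_eval S.base (\<lambda>b. S.gen (y, k b)) w) = id"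
          using w by (simp add: comp_def)
        moreover have "word_eval S.base (\<lambda>b. S.gen (y, k b)) w \<in> carrier S.base"
          by (rule S.presented.word_eval_closed) auto
        ultimately have "word_eval S.base (\<lambda>b. S.gen (y, k b)) w = \<one>\<^bsub>S.base\<^esub>"
          using S.presented.translation_eq_id_iff by blast
        then have "one_relator_eval s ?w = \<one>\<^bsub>S.base\<^esub>"
          by (simp add: word_eval_map comp_def)
        moreover have "reduced ?w"
          using w reduced_map_inj[of "\<lambda>b. (y, k b)" w] by (simp add: inj_on_def k_def)
        moreover have "(y, hi) \<notin> fst ` set ?w"
          using k(3) by (force simp: image_iff)
        ultimately have "?w = []" by (intro omits_freelyD[OF S.free_hi])
        then show "w = []" by simp
      qed
      then have "free_family perms (\<lambda>b. word_eval perms S.rep (conj_word t \<phi> (y, k b))) UNIV"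
        using rep_conj k by simp
      then have "contains_nonabelian_free_subgroup (presented_group P)"
        by (intro contains_nonabelian_free_subgroupI[OF group_perms _ rels conj_letters])
          (use range_rep in blast)+
      then show False using no_free by blast
    qed
    show "S.gen (y, hi) \<in> S.lower \<or> S.gen (y, lo) \<in> S.upper"
    proof (rule ccontr)
      assume "\<not> (S.gen (y, hi) \<in> S.lower \<or> S.gen (y, lo) \<in> S.upper)"
      then have out: "S.gen (y, hi) \<notin> one_relator_eval s ` carrier (free_group (S.letters - {(y, hi)}))"
        "S.gen (y, lo) \<notin> word_eval S.base (S.gen \<circ> S.up) ` carrier (free_group (S.letters - {(y, hi)}))"
        by (simp_all add: S.lower_def S.upper_eq)
      \<comment> \<open>Words for the ping-pong pair \<open>\<tau>\<close> and
        \<open>v \<tau> u\<close>, with \<open>v\<close> the copy of \<open>y\<close> at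
        \<open>lo\<close>, outside \<open>upper\<close>, and \<open>u\<close> the copy at
        \<open>hi\<close>, outside \<open>lower\<close>.\<close>
      define u where "u b = (if b then [(t, True)] else conj_word t \<phi> (y, lo) @ (t, True) # conj_word t \<phi> (y, hi))" for b
      have "free_family perms (\<lambda>e. if e then S.stable
          else S.act (S.gen (y, lo)) \<circ> S.stable \<circ> S.act (S.gen (y, hi))) UNIV"
        by (rule S.presented.stable_letter_free_pair[OF group_free_group S.lower_hom S.upper_hom
              S.bij_stable S.stable_carrier _ S.gen_closed out(1) S.gen_closed out(2)])
          (use S.stable_ping_pong in \<open>simp add: S.lower_def S.upper_eq\<close>)
      also have "(\<lambda>e. if e then S.stable else S.act (S.gen (y, lo)) \<circ> S.stable \<circ> S.act (S.gen (y, hi)))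
          = (\<lambda>b. word_eval perms S.rep (u b))"
      proof
        fix b
        have im: "S.rep ` fst ` set v \<subseteq> carrier perms" for v using S.rep_closed by blast
        show "(if b then S.stable else S.act (S.gen (y, lo)) \<circ> S.stable \<circ> S.act (S.gen (y, hi)))
            = word_eval perms S.rep (u b)"
          using rep_conj[of lo] rep_conj[of hi] S.window rep_t
            perms.word_eval_append[OF im im, of "conj_word t \<phi> (y, lo)" "(t, True) # conj_word t \<phi> (y, hi)"]
          by (simp add: u_def word_eval_Cons comp_assoc)
      qed
      finally have "free_family perms (\<lambda>b. word_eval perms S.rep (u b)) UNIV" .
      moreover have "fst ` set (u b) \<subseteq> fst P" for b
        using conj_letters[of lo] conj_letters[of hi] gens by (simp add: u_def image_Un)
      ultimately have "contains_nonabelian_free_subgroup (presented_group P)"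
        by (intro contains_nonabelian_free_subgroupI[OF group_perms _ rels])
          (use range_rep in blast)+
      then show False using no_free by blast
    qed
  qed
  have "solvable (presented_group P)" if "\<not> contains_nonabelian_free_subgroup (presented_group P)"
  proof -
    note narrow = lower_upper[OF that]
    let ?G = "presented_group P" and ?g = "generator P"
    define Z where "Z i = conj_letter ?G (?g t) ?g \<phi> (y, i)" for i
    have gen: "?g t \<in> carrier ?G" "?g y \<in> carrier ?G" using generator_closed gens by auto
    have Z: "Z i \<in> carrier ?G" for i using gen by (simp add: Z_def)
    have Z_shift: "Z (i + k) = ?g t [^]\<^bsub>?G\<^esub> k \<otimes>\<^bsub>?G\<^esub> Z i \<otimes>\<^bsub>?G\<^esub> ?g t [^]\<^bsub>?G\<^esub> (- k)" for i k
    proof -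
      have "?g t [^]\<^bsub>?G\<^esub> k \<otimes>\<^bsub>?G\<^esub> Z i \<otimes>\<^bsub>?G\<^esub> ?g t [^]\<^bsub>?G\<^esub> (- k) =
          (?g t [^]\<^bsub>?G\<^esub> k \<otimes>\<^bsub>?G\<^esub> ?g t [^]\<^bsub>?G\<^esub> i) \<otimes>\<^bsub>?G\<^esub> ?g y \<otimes>\<^bsub>?G\<^esub>
          (?g t [^]\<^bsub>?G\<^esub> (- (i + \<phi> y)) \<otimes>\<^bsub>?G\<^esub> ?g t [^]\<^bsub>?G\<^esub> (- k))"
        using gen by (simp add: Z_def conj_letter_def presented.m_assoc)
      also have "\<dots> = Z (i + k)"
        using gen by (simp add: Z_def conj_letter_def algebra_simps flip: presented.int_pow_mult)
      finally show ?thesis ..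
    qed
    have conj_pow: "h \<otimes>\<^bsub>?G\<^esub> (x [^]\<^bsub>?G\<^esub> m) \<otimes>\<^bsub>?G\<^esub> inv\<^bsub>?G\<^esub> h = (h \<otimes>\<^bsub>?G\<^esub> x \<otimes>\<^bsub>?G\<^esub> inv\<^bsub>?G\<^esub> h) [^]\<^bsub>?G\<^esub> m"
      if "h \<in> carrier ?G" "x \<in> carrier ?G" for h x and m :: int
    proof -
      have "(\<lambda>x. h \<otimes>\<^bsub>?G\<^esub> x \<otimes>\<^bsub>?G\<^esub> inv\<^bsub>?G\<^esub> h) \<in> hom ?G ?G"
      proof (rule homI)
        fix x z assume xz: "x \<in> carrier ?G" "z \<in> carrier ?G"
        have "h \<otimes>\<^bsub>?G\<^esub> x \<otimes>\<^bsub>?G\<^esub> inv\<^bsub>?G\<^esub> h \<otimes>\<^bsub>?G\<^esub> (h \<otimes>\<^bsub>?G\<^esub> z \<otimes>\<^bsub>?G\<^esub> inv\<^bsub>?G\<^esub> h)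
            = h \<otimes>\<^bsub>?G\<^esub> x \<otimes>\<^bsub>?G\<^esub> (inv\<^bsub>?G\<^esub> h \<otimes>\<^bsub>?G\<^esub> h) \<otimes>\<^bsub>?G\<^esub> z \<otimes>\<^bsub>?G\<^esub> inv\<^bsub>?G\<^esub> h"
          using xz that by (simp only: presented.m_assoc presented.m_closed presented.inv_closed)
        then show "h \<otimes>\<^bsub>?G\<^esub> (x \<otimes>\<^bsub>?G\<^esub> z) \<otimes>\<^bsub>?G\<^esub> inv\<^bsub>?G\<^esub> h
            = h \<otimes>\<^bsub>?G\<^esub> x \<otimes>\<^bsub>?G\<^esub> inv\<^bsub>?G\<^esub> h \<otimes>\<^bsub>?G\<^esub> (h \<otimes>\<^bsub>?G\<^esub> z \<otimes>\<^bsub>?G\<^esub> inv\<^bsub>?G\<^esub> h)"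
          using xz that by (simp add: presented.m_assoc)
      qed (use that in simp)
      from hom_int_pow[OF this that(2) presented.group_axioms presented.group_axioms, of m]
      show ?thesis .
    qed
    have Z_pow_shift: "Z (i + k) = Z (j + k) [^]\<^bsub>?G\<^esub> m" if "Z i = Z j [^]\<^bsub>?G\<^esub> m" for i j k and m :: int
      using conj_pow[of "?g t [^]\<^bsub>?G\<^esub> k" "Z j" m] Z_shift[of i k] Z_shift[of j k] gen Z that
      by (simp add: presented.int_pow_neg)
    \<comment> \<open>This carries relations of the base group to relations of the presented group.
      Letters other than copies of \<open>y\<close> do not occur in \<open>s\<close> and are sent to
      the identity.\<close>
    define f where "f p = (if fst p = y then Z (snd p) else \<one>\<^bsub>?G\<^esub>)" for p
    have f: "range f \<subseteq> carrier ?G" using Z by (auto simp: f_def)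
    have "word_eval ?G f s = word_eval ?G (conj_letter ?G (?g t) ?g \<phi>) s"
    proof (rule word_eval_cong)
      fix p assume p: "p \<in> fst ` set s"
      obtain a i where ai: "p = (a, i)" by (cases p)
      then have "a = y" using s_letters p by blast
      then show "f p = conj_letter ?G (?g t) ?g \<phi> p" using ai by (simp add: f_def Z_def)
    qed
    also have "\<dots> = word_eval ?G ?g r"
    proof -
      have "?g ` fst ` set r \<subseteq> carrier ?G" using r_letters gen by blast
      then show ?thesis
        unfolding s_def using gen \<phi>
        by (intro presented.word_eval_unwind_height_zero[where t = t and \<phi> = \<phi>]) simp_all
    qed
    also have "\<dots> = \<one>\<^bsub>?G\<^esub>" by (rule generator_relator[OF r(1)])
    finally have f_s: "word_eval ?G f s = \<one>\<^bsub>?G\<^esub>" .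
    have S_letters: "S.letters = {y} \<times> {lo..hi}" by (auto simp: S.letters_def)
    \<comment> \<open>The window has at most two levels. Membership in the Magnus subgroup that
      omits level \<open>k\<close> thus makes \<open>Z k\<close> a power of the copy at the other
      level; if there is no other level, that subgroup is trivial, whence
      \<open>m = 0\<close>.\<close>
    have power: "\<exists>m::int. Z k = Z l [^]\<^bsub>?G\<^esub> m \<and> (lo = hi \<longrightarrow> m = 0)"
      if S: "S.gen (y, k) \<in> one_relator_eval s ` carrier (free_group (S.letters - {(y, k)}))"
        and kl: "{k, l} = {lo, hi}" for k l
    proof -
      obtain v where v: "S.gen (y, k) = one_relator_eval s v" "fst ` set v \<subseteq> S.letters - {(y, k)}"
        using S by (auto simp: free_group_def)
      have im: "S.gen ` fst ` set x \<subseteq> carrier S.base" for x :: "('a \<times> int) word" using S.gen_closed by blast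
      have im_f: "f ` fst ` set x \<subseteq> carrier ?G" for x :: "('a \<times> int) word" using f by blast
      have "one_relator_eval s (v @ [((y, k), False)]) = \<one>\<^bsub>S.base\<^esub>"
        unfolding S.presented.word_eval_append[OF im im] v(1)[symmetric]
        by (simp add: word_eval_Cons)
      then have "word_eval ?G f (v @ [((y, k), False)]) = \<one>\<^bsub>?G\<^esub>"
        by (rule one_relator_consequence[OF presented.group_axioms f f_s])
      then have "word_eval ?G f v \<otimes>\<^bsub>?G\<^esub> inv\<^bsub>?G\<^esub> Z k = \<one>\<^bsub>?G\<^esub>"
        using presented.word_eval_append[OF im_f im_f, of v "[((y, k), False)]"] Z
        by (simp add: word_eval_Cons f_def)
      then have eq: "word_eval ?G f v = Z k"
        using presented.word_eval_closed[OF im_f, of v] Z[of k]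
        by (metis presented.inv_closed presented.inv_equality presented.inv_inv)
      show ?thesis
      proof (cases "lo = hi")
        case True
        then have "S.letters - {(y, k)} = {}" using kl unfolding S_letters by auto
        with v(2) have "fst ` set v \<subseteq> {}" by (simp only:)
        then have "v = []" by simp
        then show ?thesis using eq by (intro exI[of _ 0]) auto
      next
        case False
        have "S.letters - {(y, k)} \<subseteq> {(y, l)}"
          using kl narrow(1) S.window False unfolding S_letters by (auto simp: doubleton_eq_iff)
        then have "fst ` set v \<subseteq> {(y, l)}" using v(2) by (rule subset_trans[rotated])
        moreover have "f (y, l) = Z l" by (simp add: f_def)
        ultimately obtain m :: int where "word_eval ?G f v = Z l [^]\<^bsub>?G\<^esub> m"
          using presented.word_eval_single_letter[of f "(y, l)" v] Z by metis
        then show ?thesis using eq False by auto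
      qed
    qed
    have chain: "\<exists>m::int. (\<forall>i. Z (i + 1) = Z i [^]\<^bsub>?G\<^esub> m) \<or> (\<forall>i. Z i = Z (i + 1) [^]\<^bsub>?G\<^esub> m)"
    proof (cases "lo = hi")
      case True
      then obtain m :: int where "Z lo = Z lo [^]\<^bsub>?G\<^esub> m" "m = 0"
        using narrow(2) power[of lo lo] unfolding S.lower_def S.upper_def by auto
      \<comment> \<open>\<open>Z lo\<close> is trivial; writing it as a zeroth power of its
        neighbour puts this case into the form of a chain.\<close>
      then have "Z lo = Z (lo - 1) [^]\<^bsub>?G\<^esub> (0 :: int)" by simp
      then have "Z (i + 1) = Z i [^]\<^bsub>?G\<^esub> (0 :: int)" for i
        using Z_pow_shift[of lo "lo - 1" 0 "i + 1 - lo"] by simp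
      then show ?thesis by blast
    next
      case False
      then have hi: "hi = lo + 1" using narrow(1) S.window by simp
      from narrow(2) show ?thesis
      proof
        assume "S.gen (y, hi) \<in> S.lower"
        then obtain m :: int where m: "Z hi = Z lo [^]\<^bsub>?G\<^esub> m"
          using power[of hi lo] unfolding S.lower_def by auto
        have "Z (i + 1) = Z i [^]\<^bsub>?G\<^esub> m" for i
          using Z_pow_shift[OF m, of "i - lo"] hi by (simp add: algebra_simps)
        then show ?thesis by blast
      next
        assume "S.gen (y, lo) \<in> S.upper"
        then obtain m :: int where m: "Z lo = Z hi [^]\<^bsub>?G\<^esub> m"
          using power[of lo hi] unfolding S.upper_def by auto
        have "Z i = Z (i + 1) [^]\<^bsub>?G\<^esub> m" for i
          using Z_pow_shift[OF m, of "i - lo"] hi by (simp add: algebra_simps)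
        then show ?thesis by blast
      qed
    qed
    have "height \<phi> r' = 0" if "r' \<in> set (snd P)" for r'
      by (rule consequence_height[OF \<phi>(2) cons[OF that]])
    then show ?thesis
      using solvable_two_generators[OF gens(1) \<phi>(1) _ Z_def[symmetric]] chain by blast
  qed
  then show ?thesis by blast
qed

section \<open>Presentations of deficiency at least two\<close>

text \<open>Gaussian elimination with cross-multiplication in place of division.\<close>

lemma integer_kernel:
  fixes eq :: "'i \<Rightarrow> 'v \<Rightarrow> int"
  assumes "finite I" "finite V" "card I < card V"
  shows "\<exists>c. (\<exists>v\<in>V. c v \<noteq> 0) \<and> (\<forall>v. v \<notin> V \<longrightarrow> c v = 0) \<and> (\<forall>i\<in>I. (\<Sum>v\<in>V. eq i v * c v) = 0)"
  using assms
proof (induction I arbitrary: V eq rule: finite_induct)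
  case empty
  then have "V \<noteq> {}" by auto
  then show ?case by (intro exI[of _ "\<lambda>v. if v \<in> V then 1 else 0"]) auto
next
  case (insert i I)
  show ?case
  proof (cases "\<forall>v\<in>V. eq i v = 0")
    case True
    obtain c where "\<exists>v\<in>V. c v \<noteq> 0" "\<forall>v. v \<notin> V \<longrightarrow> c v = 0" "\<forall>k\<in>I. (\<Sum>v\<in>V. eq k v * c v) = 0"
      using insert.IH[of V eq] insert.prems insert.hyps by auto
    then show ?thesis using True by (intro exI[of _ c]) auto
  next
    case False
    then obtain p where p: "p \<in> V" "eq i p \<noteq> 0" by auto
    define W where "W = V - {p}"
    have W: "finite W" "p \<notin> W" "V = insert p W" using p insert.prems by (auto simp: W_def)
    have "card I < card W" using insert W by simp
    then obtain c where c: "\<exists>v\<in>W. c v \<noteq> 0" "\<forall>v. v \<notin> W \<longrightarrow> c v = 0"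
      "\<forall>k\<in>I. (\<Sum>v\<in>W. (eq i p * eq k v - eq k p * eq i v) * c v) = 0"
      using insert.IH[of W "\<lambda>k v. eq i p * eq k v - eq k p * eq i v"] W(1) by blast
    \<comment> \<open>Back-substitution: scaling by the pivot \<open>eq i p\<close> keeps the
      coordinate at \<open>p\<close> integral, and the pivot is non-zero, so the solution stays
      non-zero.\<close>
    define b where "b v = (if v = p then - (\<Sum>u\<in>W. eq i u * c u) else eq i p * c v)" for v
    have sum: "(\<Sum>v\<in>V. eq k v * b v) = (\<Sum>v\<in>W. (eq i p * eq k v - eq k p * eq i v) * c v)" for k
    proof -
      have "(\<Sum>v\<in>V. eq k v * b v) = eq k p * b p + (\<Sum>v\<in>W. eq k v * b v)"
        using W by simp
      also have "(\<Sum>v\<in>W. eq k v * b v) = (\<Sum>v\<in>W. eq i p * eq k v * c v)"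
        using W(2) by (intro sum.cong) (auto simp: b_def)
      also have "eq k p * b p = (\<Sum>v\<in>W. - eq k p * eq i v * c v)"
        by (simp add: b_def sum_distrib_left sum_negf mult.assoc)
      finally show ?thesis by (simp add: sum.distrib[symmetric] algebra_simps)
    qed
    show ?thesis
    proof (intro exI[of _ b] conjI)
      show "\<exists>v\<in>V. b v \<noteq> 0" using c(1) p W by (auto simp: b_def)
      show "\<forall>v. v \<notin> V \<longrightarrow> b v = 0" using c(2) W by (auto simp: b_def)
      show "\<forall>k\<in>insert i I. (\<Sum>v\<in>V. eq k v * b v) = 0"
        unfolding sum using c(3) by (auto simp: mult.commute)
    qed
  qed
qed

lemma height_sum:
  assumes "finite V"
  shows "height (\<lambda>p. \<Sum>v\<in>V. \<psi> v p * c v) w = (\<Sum>v\<in>V. height (\<psi> v) w * c v)"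
proof (induction w)
  case (Cons x w)
  then show ?case
    by (cases x) (auto simp: height_Cons sum.distrib[symmetric] sum_negf[symmetric] algebra_simps)
qed simp

lemma height_cong: "(\<And>a. a \<in> fst ` set w \<Longrightarrow> f a = g a) \<Longrightarrow> height f w = height g w"
proof (induction w)
  case (Cons x w)
  then show ?case by (cases x) (simp add: height_Cons)
qed simp

lemma height_zero: "(\<And>a. a \<in> fst ` set w \<Longrightarrow> f a = 0) \<Longrightarrow> height f w = 0"
proof (induction w)
  case (Cons x w)
  then show ?case by (cases x) (simp add: height_Cons)
qed simp

text \<open>On a window of length \<open>m\<close> there are \<open>m\<close> times \<open>card A\<close> unknowns, and all translates of the
  relators that meet the window number \<open>m + 2 M\<close> times \<open>card R\<close>.\<close>

lemma finitely_supported_solution: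
  fixes s :: "'r \<Rightarrow> ('a \<times> int) word" and M :: int
  assumes fin: "finite R" "finite A" and card: "card R < card A" and M: "0 \<le> M"
    and bound: "\<And>r a i. r \<in> R \<Longrightarrow> (a, i) \<in> fst ` set (s r) \<Longrightarrow> \<bar>i\<bar> \<le> M"
  obtains m :: int and c :: "'a \<times> int \<Rightarrow> int" and a k where
    "\<And>a i. a \<notin> A \<or> i < 0 \<or> m \<le> i \<Longrightarrow> c (a, i) = 0" "c (a, k) > 0"
    "\<And>r l. r \<in> R \<Longrightarrow> height (\<lambda>(a, i). c (a, i + l)) (s r) = 0"
proof -
  \<comment> \<open>The least \<open>m\<close> with
    \<open>card R * (m + 2 * M) < (card R + 1) * m\<close>.\<close>
  define m where "m = 2 * int (card R) * M + 1"
  have "m \<ge> 1" using M by (simp add: m_def)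
  define V where "V = A \<times> {0..<m}"
  \<comment> \<open>Letters of a relator have index at most \<open>M\<close> in absolute value, so a
    translate by any other \<open>l\<close> misses the window and its equation holds
    trivially.\<close>
  define I where "I = R \<times> {-M..<m + M}"
  define eq where "eq = (\<lambda>(r, l) v. height (\<lambda>(b, i). if (b, i + l) = v then 1 else 0 :: int) (s r))"
  have "int (card I) = int (card R) * (m + 2 * M)"
    using M \<open>m \<ge> 1\<close> by (simp add: I_def card_cartesian_product)
  also have "\<dots> < (int (card R) + 1) * m"
    by (simp add: m_def algebra_simps)
  also have "\<dots> \<le> int (card A) * m"
    using card \<open>m \<ge> 1\<close> by (intro mult_right_mono) auto
  also have "\<dots> = int (card V)"
    using \<open>m \<ge> 1\<close> by (simp add: V_def card_cartesian_product)
  finally have "card I < card V" by simp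
  have "finite I" "finite V" using fin by (simp_all add: I_def V_def)
  obtain c where c: "\<exists>v\<in>V. c v \<noteq> 0" "\<forall>v. v \<notin> V \<longrightarrow> c v = 0"
    "\<forall>i\<in>I. (\<Sum>v\<in>V. eq i v * c v) = 0"
    using integer_kernel[OF \<open>finite I\<close> \<open>finite V\<close> \<open>card I < card V\<close>, of eq] by blast
  have eq_height: "(\<Sum>v\<in>V. eq (r, l) v * c v) = height (\<lambda>(a, i). c (a, i + l)) (s r)" for r l
  proof -
    have "(\<Sum>v\<in>V. eq (r, l) v * c v)
        = height (\<lambda>p. \<Sum>v\<in>V. (\<lambda>(b, i). if (b, i + l) = v then 1 else 0) p * c v) (s r)"
      unfolding eq_def using height_sum[OF \<open>finite V\<close>, of "\<lambda>v (b, i). if (b, i + l) = v then 1 else 0" c "s r"]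
      by simp
    also have "(\<lambda>p. \<Sum>v\<in>V. (\<lambda>(b, i). if (b, i + l) = v then 1 else 0) p * c v) = (\<lambda>(a, i). c (a, i + l))"
    proof
      fix p :: "'a \<times> int"
      obtain b i where p: "p = (b, i)" by (cases p)
      have "(\<Sum>v\<in>V. (if (b, i + l) = v then 1 else 0) * c v) = (\<Sum>v\<in>V. if (b, i + l) = v then c v else 0)"
        by (intro sum.cong) auto
      also have "\<dots> = c (b, i + l)"
        using c(2) \<open>finite V\<close> by (simp add: sum.delta')
      finally show "(\<Sum>v\<in>V. (\<lambda>(b, i). if (b, i + l) = v then 1 else 0) p * c v) = (\<lambda>(a, i). c (a, i + l)) p"
        by (simp add: p)
    qed
    finally show ?thesis .
  qed
  have out: "c (a, i) = 0" if "a \<notin> A \<or> i < 0 \<or> m \<le> i" for a i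
    using c(2) that by (auto simp: V_def)
  have sol: "height (\<lambda>(a, i). c (a, i + l)) (s r) = 0" if r: "r \<in> R" for r l
  proof (cases "l \<in> {-M..<m + M}")
    case True
    then show ?thesis using c(3) eq_height r by (auto simp: I_def)
  next
    case False
    show ?thesis
    proof (rule height_zero)
      fix p assume p: "p \<in> fst ` set (s r)"
      obtain a i where ai: "p = (a, i)" by (cases p)
      then have "\<bar>i\<bar> \<le> M" using bound r p by blast
      then have "i + l < 0 \<or> m \<le> i + l" using False by auto
      then show "(\<lambda>(a, i). c (a, i + l)) p = 0" using ai out by auto
    qed
  qed
  obtain a k where "c (a, k) \<noteq> 0" using c(1) by auto
  \<comment> \<open>The sign is normalised because this coefficient later serves as a positive
    number of repetitions of a letter.\<close>
  then consider "c (a, k) > 0" | "- c (a, k) > 0" by linarith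
  then show thesis
  proof cases
    case 1
    then show thesis using that[OF out _ sol] by blast
  next
    case 2
    have neg: "height (\<lambda>(a, i). - c (a, i + l)) (s r) = 0" if "r \<in> R" for r l
      using height_linear[of "-1" "\<lambda>(a, i). c (a, i + l)" 0 "\<lambda>_. 0" "s r"] sol[OF that, of l]
      by (simp add: case_prod_unfold)
    show thesis
      by (rule that[of m "\<lambda>p. - c p" a k]) (use out 2 neg in auto)
  qed
qed

text \<open>An element of the unrestricted product of permutation groups indexed by
  \<open>i\<close>, acting fibre by fibre.\<close>

definition diagonal :: "('i \<Rightarrow> 'x \<Rightarrow> 'x) \<Rightarrow> 'i \<times> 'x \<Rightarrow> 'i \<times> 'x" where
  "diagonal F = (\<lambda>(i, x). (i, F i x))"

lemma bij_diagonal: "(\<And>i. bij (F i)) \<Longrightarrow> bij (diagonal F)"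
  by (rule bij_betw_byWitness[of _ "diagonal (\<lambda>i. inv_into UNIV (F i))"])
    (auto simp: diagonal_def bij_is_inj bij_is_surj surj_f_inv_f)

lemma inv_diagonal: "(\<And>i. bij (F i)) \<Longrightarrow> inv_into UNIV (diagonal F) = diagonal (\<lambda>i. inv_into UNIV (F i))"
  by (rule Hilbert_Choice.inv_equality) (auto simp: diagonal_def bij_is_inj bij_is_surj surj_f_inv_f)

lemma word_eval_diagonal:
  assumes "\<And>p i. bij (F p i)"
  shows "word_eval perms (\<lambda>p. diagonal (F p)) w = diagonal (\<lambda>i. word_eval perms (\<lambda>p. F p i) w)"
proof (induction w)
  case (Cons x w)
  then show ?case
    using assms by (auto simp: word_eval_Cons inv_diagonal bij_diagonal) (auto simp: diagonal_def fun_eq_iff)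
qed (auto simp: diagonal_def)

text \<open>Powers of one element turn a relator into a linear equation in the exponents.\<close>

lemma (in group) word_eval_powers:
  assumes "z \<in> carrier G"
  shows "word_eval G (\<lambda>p. z [^] (\<psi> p :: int)) w = z [^] height \<psi> w"
proof (induction w)
  case (Cons x w)
  obtain a e where x: "x = (a, e)" by (cases x)
  have "z [^] (- \<psi> a + height \<psi> w) = inv (z [^] \<psi> a) \<otimes> z [^] height \<psi> w"
    using assms by (simp only: int_pow_mult int_pow_neg)
  moreover have "z [^] (\<psi> a + height \<psi> w) = z [^] \<psi> a \<otimes> z [^] height \<psi> w"
    using assms by (rule int_pow_mult)
  ultimately show ?case
    using Cons x by (cases e) (simp_all only: word_eval_Cons height_Cons fst_conv snd_conv if_True if_False)
qed simp

text \<open>Positive \<open>n\<close>-th powers of free generators are again free generators: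
  repeating each letter creates no cancellation.\<close>

lemma reduced_replicate:
  assumes "reduced w" "n > 0"
  shows "reduced (concat (map (replicate n) w))"
  using assms(1)
proof (induction w)
  case (Cons x w)
  have "reduced (replicate k x @ concat (map (replicate n) w))" for k
  proof (induction k)
    case 0
    then show ?case using Cons by (simp add: reduced_Cons)
  next
    case (Suc k)
    have "hd (replicate k x @ concat (map (replicate n) w)) \<noteq> inv_letter x"
      if ne: "replicate k x @ concat (map (replicate n) w) \<noteq> []"
    proof (cases "k = 0")
      case True
      then obtain y v where w: "w = y # v" using ne assms(2) by (cases w) auto
      then have "hd (concat (map (replicate n) w)) = y"
        using assms(2) by (cases n) auto
      then show ?thesis using True Cons.prems w by (simp add: reduced_Cons)
    next
      case False
      then show ?thesis by (cases k) auto
    qed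
    then show ?case using Suc by (auto simp: reduced_Cons)
  qed
  then show ?case by simp
qed simp

lemma (in group) word_eval_replicate:
  assumes "\<And>a. f a \<in> carrier G"
  shows "word_eval G f (concat (map (replicate n) w)) = word_eval G (\<lambda>a. f a [^] int n) w"
proof -
  have im: "f ` fst ` set v \<subseteq> carrier G" for v using assms by blast
  have "word_eval G f (replicate n (a, e)) = (if e then f a [^] int n else inv (f a [^] int n))" for a e
  proof (induction n)
    case (Suc n)
    have "f a [^] (1 + int n) = f a \<otimes> f a [^] int n" "f a [^] (1 + int n) = f a [^] int n \<otimes> f a"
      using int_pow_mult[OF assms, of a 1 "int n"] int_pow_mult[OF assms, of a "int n" 1] assms
      by (simp_all add: add.commute)
    then show ?case using Suc assms by (cases e) (simp_all add: word_eval_Cons flip: inv_mult_group)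
  qed simp
  then show ?thesis
    by (induction w) (auto simp: word_eval_append[OF im im] word_eval_Cons)
qed

text \<open>\<open>R\<close> is a set of relators that suffices; \<open>cons\<close> states this
  only for the one permutation group used as target. That target contains a product of integer-many
  copies of the free group on two generators, extended by the shift of the copies, a kind of
  unrestricted wreath product.\<close>

theorem deficiency_two_free_subgroup:
  fixes P :: "'a presentation" and R :: "'a word set"
  assumes P: "presentation P" and fin: "finite (fst P)" "finite R" and t: "t \<in> fst P"
    and R: "\<And>r. r \<in> R \<Longrightarrow> fst ` set r \<subseteq> fst P" "card R + 2 \<le> card (fst P)"
    and \<phi>: "\<phi> t = 1" "\<And>r. r \<in> R \<Longrightarrow> height \<phi> r = 0"
    and cons: "\<And>(f :: 'a \<Rightarrow> int \<times> bool word \<times> nat \<Rightarrow> int \<times> bool word \<times> nat) r.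
      \<lbrakk>range f \<subseteq> carrier perms; \<And>r. r \<in> R \<Longrightarrow> word_eval perms f r = \<one>\<^bsub>perms\<^esub>; r \<in> set (snd P)\<rbrakk>
      \<Longrightarrow> word_eval perms f r = \<one>\<^bsub>perms\<^esub>"
  shows "contains_nonabelian_free_subgroup (presented_group P)"
proof -
  interpret presentation P by fact
  \<comment> \<open>One generator is spent on the stable letter; a deficiency of two still leaves
    more unknowns per level than equations.\<close>
  define A where "A = fst P - {t}"
  have "finite A" "card R < card A" using fin t R(2) by (auto simp: A_def)
  define s where "s = unwind t \<phi> 0"
  define M where "M = Max (insert 0 ((\<lambda>p. \<bar>snd p\<bar>) ` (\<Union>r\<in>R. fst ` set (s r))))"
  have M_fin: "finite (insert 0 ((\<lambda>p. \<bar>snd p\<bar>) ` (\<Union>r\<in>R. fst ` set (s r))))" using fin(2) by simp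
  have M: "0 \<le> M" unfolding M_def using M_fin by (rule Max_ge) simp
  have bound: "\<bar>i\<bar> \<le> M" if "r \<in> R" "(a, i) \<in> fst ` set (s r)" for r a i
    unfolding M_def using M_fin
    by (rule Max_ge) (rule insertI2, rule image_eqI[of _ _ "(a, i)"], use that in auto)
  obtain m :: int and c a0 k0 where
    out: "\<And>a i. a \<notin> A \<or> i < 0 \<or> m \<le> i \<Longrightarrow> c (a, i) = 0" and pos: "c (a0, k0) > 0"
    and sol: "\<And>r l. r \<in> R \<Longrightarrow> height (\<lambda>(a, i). c (a, i + l)) (s r) = 0"
  proof (rule finitely_supported_solution[OF fin(2) \<open>finite A\<close> \<open>card R < card A\<close> M bound])
    fix m :: int and c a k
    assume "\<And>a i. a \<notin> A \<or> i < 0 \<or> m \<le> i \<Longrightarrow> c (a, i) = 0" "c (a, k) > 0"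
      "\<And>r l. r \<in> R \<Longrightarrow> height (\<lambda>(a, i). c (a, i + l)) (s r) = 0"
    then show thesis by (rule that)
  qed
  have a0: "a0 \<in> A" "0 \<le> k0" "k0 < m" using out[of a0 k0] pos by fastforce+
  \<comment> \<open>The gap \<open>2 * M\<close> exceeds the reach of a relator: a translate by
    \<open>l < m + M\<close> stays below \<open>m'\<close> and misses the second solution, any other
    stays at or above \<open>m\<close> and misses the first.\<close>
  define m' where "m' = m + 2 * M"
  interpret L: group "free_group (UNIV :: bool set)" by (rule group_free_group)
  interpret tr: group_hom "free_group (UNIV :: bool set)" perms "translation (free_group UNIV)"
    by (rule L.group_hom_translation)
  define z where "z b = translation (free_group UNIV) [(b, True)]" for b :: bool
  have gen_L: "[(b, True)] \<in> carrier (free_group UNIV)" for b :: bool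
    by (simp add: free_group_def reduced_def)
  have z: "z b \<in> carrier perms" for b unfolding z_def by (rule tr.hom_closed[OF gen_L])
  text \<open>Two far apart copies of the solution, on powers of the two free generators.\<close>
  define Y where "Y = (\<lambda>(a, i). z False [^]\<^bsub>perms\<^esub> c (a, i) \<otimes>\<^bsub>perms\<^esub> z True [^]\<^bsub>perms\<^esub> c (a, i - m'))"
  have Y: "Y p \<in> carrier perms" for p
    unfolding Y_def case_prod_unfold by (intro perms.m_closed perms.int_pow_closed z)
  have Y_bij: "bij (Y p)" for p using Y by simp
  have Y_False: "Y (a, i) = z False [^]\<^bsub>perms\<^esub> c (a, i)" if "i < m'" for a i
    using out[of a "i - m'"] that z[of False] by (simp add: Y_def del: carrier_perms mult_perms one_perms)
  have Y_True: "Y (a, i) = z True [^]\<^bsub>perms\<^esub> c (a, i - m')" if "m \<le> i" for a i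
    using out[of a i] that z[of True] by (simp add: Y_def del: carrier_perms mult_perms one_perms)
  \<comment> \<open>The shift goes down, so that conjugation by it raises the index: copy
    \<open>l\<close> of the conjugate is copy \<open>l + 1\<close> of the original.\<close>
  define \<tau> :: "int \<times> bool word \<times> nat \<Rightarrow> int \<times> bool word \<times> nat" where "\<tau> = (\<lambda>(l, x). (l - 1, x))"
  have \<tau>: "\<tau> \<in> carrier perms"
    by (simp, rule bij_betw_byWitness[of _ "\<lambda>(l, x). (l + 1, x)"]) (auto simp: \<tau>_def)
  define g where "g a i = diagonal (\<lambda>l. Y (a, i + l))" for a i
  have g: "g a i \<in> carrier perms" for a i
    by (simp add: g_def bij_diagonal Y_bij)
  have g_step: "g a (i + 1) = \<tau> \<otimes>\<^bsub>perms\<^esub> g a i \<otimes>\<^bsub>perms\<^esub> inv\<^bsub>perms\<^esub> \<tau>" for a i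
  proof -
    have "g a (i + 1) \<otimes>\<^bsub>perms\<^esub> \<tau> = \<tau> \<otimes>\<^bsub>perms\<^esub> g a i"
      by (auto simp: g_def \<tau>_def diagonal_def fun_eq_iff)
    then show ?thesis
      using \<tau> g by (metis perms.inv_solve_right perms.m_closed)
  qed
  \<comment> \<open>Chosen so that the Schreier generator \<open>(a, 0)\<close> becomes
    \<open>g a 0\<close>.\<close>
  define f where "f a = g a 0 \<otimes>\<^bsub>perms\<^esub> \<tau> [^]\<^bsub>perms\<^esub> \<phi> a" for a
  have f: "f a \<in> carrier perms" for a
    unfolding f_def by (intro perms.m_closed perms.int_pow_closed g \<tau>)
  have range_f: "range f \<subseteq> carrier perms" using f by blast
  have conj: "conj_letter perms \<tau> f \<phi> (a, i) = g a i" for a i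
  proof -
    have "f a = \<tau> [^]\<^bsub>perms\<^esub> (- 0 :: int) \<otimes>\<^bsub>perms\<^esub> g a 0 \<otimes>\<^bsub>perms\<^esub> \<tau> [^]\<^bsub>perms\<^esub> (0 + \<phi> a)"
      using g by (simp add: f_def)
    from perms.conj_letter_base[where \<rho> = f and \<phi> = \<phi> and a = a and k = 0, OF \<tau> g[of a 0] this, of i]
    have "conj_letter perms \<tau> f \<phi> (a, i) = \<tau> [^]\<^bsub>perms\<^esub> (i - 0) \<otimes>\<^bsub>perms\<^esub> g a 0 \<otimes>\<^bsub>perms\<^esub> \<tau> [^]\<^bsub>perms\<^esub> (0 - i)" .
    also have "\<dots> = g a i"
      by (rule perms.conj_power_shift[where I = UNIV and g = "g a", OF \<tau> g _ _ g_step]) auto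
    finally show ?thesis .
  qed
  have f_t: "f t = \<tau>"
  proof -
    have "Y (t, i) = id" for i
      using out[of t i] out[of t "i - m'"] by (simp add: Y_def A_def)
    then have "g t 0 = id" by (simp add: g_def diagonal_def fun_eq_iff)
    then show ?thesis using \<tau> \<phi>(1) by (simp add: f_def)
  qed
  have eval_conj: "word_eval perms (conj_letter perms \<tau> f \<phi>) w
      = diagonal (\<lambda>l. word_eval perms (\<lambda>(a, i). Y (a, i + l)) w)" for w
  proof -
    have "conj_letter perms \<tau> f \<phi> = (\<lambda>p. diagonal ((\<lambda>(a, i) l. Y (a, i + l)) p))"
      using conj by (auto simp: g_def fun_eq_iff)
    moreover have "bij ((\<lambda>(a, i) l. Y (a, i + l)) p l)" for p l
      by (cases p) (simp add: Y_bij)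
    ultimately show ?thesis
      by (simp add: word_eval_diagonal case_prod_unfold)
  qed
  have rel: "word_eval perms f r = \<one>\<^bsub>perms\<^esub>" if r: "r \<in> R" for r
  proof -
    have "word_eval perms (\<lambda>(a, i). Y (a, i + l)) (s r) = id" for l
    proof -
      have powers: "word_eval perms (\<lambda>(a, i). Y (a, i + l)) (s r) = id"
        if "\<And>a i. \<bar>i\<bar> \<le> M \<Longrightarrow> Y (a, i + l) = z b [^]\<^bsub>perms\<^esub> c (a, i + k)" for b k
      proof -
        have "word_eval perms (\<lambda>(a, i). Y (a, i + l)) (s r)
            = word_eval perms (\<lambda>p. z b [^]\<^bsub>perms\<^esub> (\<lambda>(a, i). c (a, i + k)) p) (s r)"
        proof (rule word_eval_cong)
          fix p assume p: "p \<in> fst ` set (s r)"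
          obtain a i where ai: "p = (a, i)" by (cases p)
          then have "\<bar>i\<bar> \<le> M" using bound r p by blast
          then show "(\<lambda>(a, i). Y (a, i + l)) p = z b [^]\<^bsub>perms\<^esub> (\<lambda>(a, i). c (a, i + k)) p"
            using that ai by simp
        qed
        also have "\<dots> = id"
          unfolding perms.word_eval_powers[OF z] sol[OF r] by simp
        finally show ?thesis .
      qed
      show ?thesis
      proof (cases "l < m + M")
        case True
        show ?thesis
          by (rule powers[of False l]) (rule Y_False, use True in \<open>auto simp: m'_def\<close>)
      next
        case False
        show ?thesis
        proof (rule powers[of True "l - m'"])
          fix a and i :: int assume "\<bar>i\<bar> \<le> M"
          then have "m \<le> i + l" using False by linarith
          from Y_True[OF this] show "Y (a, i + l) = z True [^]\<^bsub>perms\<^esub> c (a, i + (l - m'))"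
            by (simp add: algebra_simps)
        qed
      qed
    qed
    then have "word_eval perms (conj_letter perms \<tau> f \<phi>) (unwind t \<phi> 0 r) = id"
      unfolding eval_conj by (simp add: s_def diagonal_def fun_eq_iff)
    moreover have "f ` fst ` set r \<subseteq> carrier perms" using f by blast
    moreover have "f t = \<tau> [^]\<^bsub>perms\<^esub> \<phi> t" using f_t \<tau> \<phi>(1) by simp
    ultimately show ?thesis
      using perms.word_eval_unwind_height_zero[of \<tau> f r t \<phi>] \<tau> \<phi>(2)[OF r] by simp
  qed
  \<comment> \<open>One non-zero entry of the solution, taken once from each of the two
    placements.\<close>
  define u where "u b = conj_word t \<phi> (a0, if b then k0 + m' else k0)" for b
  define N where "N = nat (c (a0, k0))"
  have "m \<le> k0 + m'" "k0 < m'" using a0 M by (auto simp: m'_def)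
  then have Y0: "Y (a0, if b then k0 + m' else k0) = z b [^]\<^bsub>perms\<^esub> int N" for b
    using Y_False[of k0 a0] Y_True[of "k0 + m'" a0] pos by (simp add: N_def)
  have eval_u: "word_eval perms f (u b) = g a0 (if b then k0 + m' else k0)" for b
    unfolding u_def using perms.word_eval_conj_word[of f t a0 \<phi>, OF f f] f_t conj by simp
  have "free_family perms (\<lambda>b. word_eval perms f (u b)) UNIV"
    unfolding free_family_def
  proof (intro conjI allI impI)
    show "range (\<lambda>b. word_eval perms f (u b)) \<subseteq> carrier perms"
      unfolding eval_u using g by blast
    fix w :: "bool word"
    assume w: "reduced w \<and> fst ` set w \<subseteq> UNIV \<and> word_eval perms (\<lambda>b. word_eval perms f (u b)) w = \<one>\<^bsub>perms\<^esub>"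
    let ?w = "concat (map (replicate N) w)"
    have "word_eval perms (\<lambda>b. word_eval perms f (u b)) w
        = diagonal (\<lambda>l. word_eval perms (\<lambda>b. Y (a0, (if b then k0 + m' else k0) + l)) w)"
      unfolding eval_u g_def by (rule word_eval_diagonal) (rule Y_bij)
    then have "diagonal (\<lambda>l. word_eval perms (\<lambda>b. Y (a0, (if b then k0 + m' else k0) + l)) w) = id"
      using w by simp
    \<comment> \<open>Copy 0 alone decides: there \<open>u b\<close> acts as the \<open>N\<close>-th
      power of the free generator \<open>z b\<close>.\<close>
    then have "snd (diagonal (\<lambda>l. word_eval perms (\<lambda>b. Y (a0, (if b then k0 + m' else k0) + l)) w) (0, x)) = x" for x
      by (simp only: id_apply snd_conv)
    then have "word_eval perms (\<lambda>b. Y (a0, if b then k0 + m' else k0)) w = id"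
      by (auto simp: diagonal_def fun_eq_iff)
    then have "word_eval perms (\<lambda>b. z b [^]\<^bsub>perms\<^esub> int N) w = id" unfolding Y0 .
    then have "word_eval perms z ?w = id"
      using perms.word_eval_replicate[of z N w] z by simp
    moreover have "word_eval perms z ?w = translation (free_group UNIV) (word_eval (free_group UNIV) (\<lambda>b. [(b, True)]) ?w)"
    proof -
      have "(\<lambda>b. [(b, True)]) ` fst ` set ?w \<subseteq> carrier (free_group UNIV)"
        using gen_L by blast
      then show ?thesis
        using tr.hom_word_eval[of "\<lambda>b. [(b, True)]" ?w] by (simp add: comp_def z_def[abs_def])
    qed
    ultimately have "translation (free_group UNIV) (reduce ?w) = id"
      by (simp add: word_eval_free_group)
    moreover have "reduce ?w \<in> carrier (free_group UNIV)"
      by (rule reduce_in_free_group) simp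
    ultimately have "reduce ?w = \<one>\<^bsub>free_group UNIV\<^esub>"
      using L.translation_eq_id_iff by blast
    moreover have "N > 0" using pos by (simp add: N_def)
    ultimately have "?w = []"
      using reduced_replicate[of w N] w reduce_reduced[of ?w] by (simp add: free_group_def)
    then show "w = []" using \<open>N > 0\<close> by (cases w) auto
  qed
  moreover have "fst ` set (u b) \<subseteq> fst P" for b
    using letters_conj_word[of t \<phi> a0] t a0(1) unfolding u_def A_def by blast
  ultimately show ?thesis
    by (intro contains_nonabelian_free_subgroupI[OF group_perms _ cons[OF range_f rel]])
      (use range_f in blast)+
qed

section \<open>Redundant cyclic presentations\<close>

definition cyclically_equivalent :: "'a word \<Rightarrow> 'a word \<Rightarrow> bool" where
  "cyclically_equivalent u v \<longleftrightarrow> cyclic_permutation u v \<or> cyclic_permutation u (inv_word v)"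

lemma inv_word_inv_word [simp]: "inv_word (inv_word w) = w"
  by (simp add: inv_word_def rev_map comp_def)

lemma cyclic_permutation_iff: "cyclic_permutation u v \<longleftrightarrow> (\<exists>a b. v = a @ b \<and> u = b @ a)"
proof
  assume "cyclic_permutation u v"
  then obtain k where "u = rotate k v" by (auto simp: cyclic_permutation_def)
  then have "u = drop (k mod length v) v @ take (k mod length v) v" by (simp add: rotate_drop_take)
  then show "\<exists>a b. v = a @ b \<and> u = b @ a" by (metis append_take_drop_id)
next
  assume "\<exists>a b. v = a @ b \<and> u = b @ a"
  then obtain a b where "v = a @ b" "u = b @ a" by blast
  then show "cyclic_permutation u v"
    unfolding cyclic_permutation_def using rotate_append[of a b] by metis
qed

lemma cyclic_permutation_sym: "cyclic_permutation u v \<Longrightarrow> cyclic_permutation v u"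
  by (auto simp: cyclic_permutation_iff)

lemma cyclic_permutation_trans:
  "cyclic_permutation u v \<Longrightarrow> cyclic_permutation v w \<Longrightarrow> cyclic_permutation u w"
  by (auto simp: cyclic_permutation_def rotate_rotate)

lemma cyclic_permutation_inv_word:
  "cyclic_permutation u v \<Longrightarrow> cyclic_permutation (inv_word u) (inv_word v)"
  unfolding cyclic_permutation_iff by (metis inv_word_append)

lemma cyclically_equivalent_refl: "cyclically_equivalent w w"
  by (auto simp: cyclically_equivalent_def cyclic_permutation_def intro: exI[of _ 0])

lemma cyclically_equivalent_sym: "cyclically_equivalent u v \<Longrightarrow> cyclically_equivalent v u"
  unfolding cyclically_equivalent_def
  using cyclic_permutation_sym cyclic_permutation_inv_word[of u "inv_word v"] by auto

lemma cyclically_equivalent_trans: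
  "cyclically_equivalent u v \<Longrightarrow> cyclically_equivalent v w \<Longrightarrow> cyclically_equivalent u w"
  unfolding cyclically_equivalent_def
  using cyclic_permutation_trans cyclic_permutation_inv_word[of v w] cyclic_permutation_inv_word[of v "inv_word w"]
  by (metis inv_word_inv_word)

lemma cyclically_equivalent_map:
  assumes "cyclically_equivalent u v"
  shows "cyclically_equivalent (map (\<lambda>(a, e). (g a, e)) u) (map (\<lambda>(a, e). (g a, e)) v)"
proof -
  have "inv_word (map (\<lambda>(a, e). (g a, e)) v) = map (\<lambda>(a, e). (g a, e)) (inv_word v)"
    by (simp add: inv_word_def rev_map inv_letter_def case_prod_unfold comp_def)
  moreover have "cyclic_permutation (map (\<lambda>(a, e). (g a, e)) x) (map (\<lambda>(a, e). (g a, e)) y)"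
    if "cyclic_permutation x y" for x y
    using that by (auto simp: cyclic_permutation_def rotate_map)
  ultimately show ?thesis
    using assms unfolding cyclically_equivalent_def by metis
qed

lemma (in group) word_eval_cyclically_equivalent:
  assumes "cyclically_equivalent u v" "f ` fst ` set v \<subseteq> carrier G" "word_eval G f v = \<one>"
  shows "word_eval G f u = \<one>"
proof -
  have cyc: "word_eval G f x = \<one>"
    if xy: "cyclic_permutation x y" and im: "f ` fst ` set y \<subseteq> carrier G" and y: "word_eval G f y = \<one>" for x y
  proof -
    obtain a b where ab: "y = a @ b" "x = b @ a" using xy by (auto simp: cyclic_permutation_iff)
    have im_ab: "f ` fst ` set a \<subseteq> carrier G" "f ` fst ` set b \<subseteq> carrier G"
      using im unfolding ab(1) by (simp_all add: image_Un)
    then have "word_eval G f a \<otimes> word_eval G f b = \<one>"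
      using y ab(1) by (simp add: word_eval_append)
    then have "word_eval G f b \<otimes> word_eval G f a = \<one>"
      using word_eval_closed[OF im_ab(1)] word_eval_closed[OF im_ab(2)] by (rule inv_comm)
    then show ?thesis using ab(2) im_ab by (simp add: word_eval_append)
  qed
  from assms(1) show ?thesis
    unfolding cyclically_equivalent_def
  proof
    assume "cyclic_permutation u v"
    then show ?thesis using assms(2,3) by (rule cyc)
  next
    assume "cyclic_permutation u (inv_word v)"
    then show ?thesis
      by (rule cyc) (use assms(2,3) in \<open>simp_all add: letters_inv_word word_eval_inv_word\<close>)
  qed
qed

text \<open>The sign only records whether an inversion took place, so a single
  \<open>\<epsilon>\<close> serves all exponent sums at once.\<close>

lemma height_cyclically_equivalent:
  assumes "cyclically_equivalent u v"
  obtains \<epsilon> :: int where "\<epsilon> * \<epsilon> = 1" "\<forall>\<psi>. height \<psi> u = \<epsilon> * height \<psi> v"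
proof -
  have cyc: "height \<psi> x = height \<psi> y" if "cyclic_permutation x y" for x y :: "'a word" and \<psi>
    using that by (auto simp: cyclic_permutation_iff height_append)
  from assms show ?thesis
    unfolding cyclically_equivalent_def
  proof
    assume "cyclic_permutation u v"
    then show ?thesis using cyc that[of 1] by simp
  next
    assume "cyclic_permutation u (inv_word v)"
    then show ?thesis using cyc that[of "-1"] by (simp add: height_inv_word)
  qed
qed

lemma height_map: "height \<psi> (map (\<lambda>(a, e). (g a, e)) w) = height (\<lambda>a. \<psi> (g a)) w"
  by (induction w) (auto simp: height_Cons)

section \<open>The period of a word under the shift\<close>

lemma shift_power:
  assumes "fst ` set w \<subseteq> {..<n}"
  shows "(shift n ^^ k) w = map (\<lambda>(a, e). ((a + k) mod n, e)) w"
proof (induction k)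
  case 0
  show ?case using assms by (induction w) auto
next
  case (Suc k)
  have "(shift n ^^ Suc k) w = shift n (map (\<lambda>(a, e). ((a + k) mod n, e)) w)"
    by (simp add: Suc)
  then show ?case by (simp add: shift_def case_prod_unfold comp_def mod_Suc_eq)
qed

lemma shift_power_full:
  assumes "fst ` set w \<subseteq> {..<n}"
  shows "(shift n ^^ n) w = w"
  unfolding shift_power[OF assms] using assms by (induction w) auto

lemma cyclically_equivalent_shift:
  "cyclically_equivalent u v \<Longrightarrow> cyclically_equivalent ((shift n ^^ k) u) ((shift n ^^ k) v)"
  by (induction k) (auto simp: shift_def intro: cyclically_equivalent_map)

lemma reduced_shift:
  assumes "fst ` set w \<subseteq> {..<n}" "reduced w" "k \<le> n"
  shows "reduced ((shift n ^^ k) w)"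
proof -
  have "((a + k) mod n + (n - k)) mod n = a" if "a < n" for a
  proof -
    have "((a + k) mod n + (n - k)) mod n = (a + k + (n - k)) mod n" by (rule mod_add_left_eq)
    then show ?thesis using that assms(3) by simp
  qed
  then have "inj_on (\<lambda>a. (a + k) mod n) {..<n}"
    by (intro inj_on_inverseI[of _ "\<lambda>b. (b + (n - k)) mod n"]) simp
  then have "inj_on (\<lambda>a. (a + k) mod n) (fst ` set w)"
    using assms(1) by (rule inj_on_subset)
  then show ?thesis
    unfolding shift_power[OF assms(1)] using assms(2) by (simp add: reduced_map_inj)
qed

text \<open>Multiples of a period are periods, and so are remainders on division by one; hence the
  least positive period divides the trivial period \<open>n\<close>.\<close>

lemma shift_period:
  assumes w: "fst ` set w \<subseteq> {..<n}" and p: "0 < p" "p < n" "cyclically_equivalent ((shift n ^^ p) w) w"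
  obtains d where "0 < d" "d < n" "d dvd n" "cyclically_equivalent ((shift n ^^ d) w) w"
    "\<forall>k. cyclically_equivalent ((shift n ^^ k) w) ((shift n ^^ (k mod d)) w)"
proof -
  define per where "per d \<longleftrightarrow> 0 < d \<and> cyclically_equivalent ((shift n ^^ d) w) w" for d
  define d where "d = (LEAST d. per d)"
  have "per p" using p by (simp add: per_def)
  then have d: "per d" "d \<le> p" unfolding d_def by (rule LeastI, rule Least_le)
  have mult: "cyclically_equivalent ((shift n ^^ (d * q)) w) w" for q
  proof (induction q)
    case 0
    show ?case by (simp add: cyclically_equivalent_refl)
  next
    case (Suc q)
    have "cyclically_equivalent ((shift n ^^ d) ((shift n ^^ (d * q)) w)) ((shift n ^^ d) w)"
      using Suc by (rule cyclically_equivalent_shift)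
    then show ?case
      using d(1) cyclically_equivalent_trans unfolding per_def by (simp add: funpow_add) blast
  qed
  have rem: "cyclically_equivalent ((shift n ^^ k) w) ((shift n ^^ (k mod d)) w)" for k
  proof -
    have "(shift n ^^ k) w = (shift n ^^ (k mod d)) ((shift n ^^ (d * (k div d))) w)"
      using funpow_add[of "k mod d" "d * (k div d)" "shift n"] by simp
    then show ?thesis using cyclically_equivalent_shift[OF mult] by simp
  qed
  have "d dvd n"
  proof (rule ccontr)
    assume "\<not> d dvd n"
    then have "0 < n mod d" by (simp add: dvd_eq_mod_eq_0)
    moreover have "cyclically_equivalent ((shift n ^^ (n mod d)) w) w"
      using rem[of n] cyclically_equivalent_sym by (simp add: shift_power_full[OF w])
    ultimately have "per (n mod d)" by (simp add: per_def)
    then have "d \<le> n mod d" unfolding d_def by (rule Least_le)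
    moreover have "n mod d < d" using d(1) by (simp add: per_def)
    ultimately show False by simp
  qed
  then show ?thesis
    by (rule that[rotated 2]) (use d p(2) rem in \<open>simp_all add: per_def\<close>)
qed

text \<open>Shifts of a non-empty reduced word are non-empty and reduced, so redundancy means a
  repeated relator. Shifting by \<open>n - j\<close> moves one of the two equivalent relators back
  to \<open>w\<close>.\<close>

lemma redundant_shift:
  assumes w: "fst ` set w \<subseteq> {..<n}" "reduced w" "w \<noteq> []" and "redundant (cyclic_presentation n w)"
  obtains p where "0 < p" "p < n" "cyclically_equivalent ((shift n ^^ p) w) w"
proof -
  have nth: "snd (cyclic_presentation n w) ! i = (shift n ^^ i) w" if "i < n" for i
    using that by (simp add: cyclic_presentation_def)
  have len: "length (snd (cyclic_presentation n w)) = n"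
    by (simp add: cyclic_presentation_def)
  obtain i where i: "i < n" and red: "reduce ((shift n ^^ i) w) = [] \<or>
      (\<exists>j<n. j \<noteq> i \<and> cyclically_equivalent ((shift n ^^ i) w) ((shift n ^^ j) w))"
    using assms(4) nth unfolding redundant_def len cyclically_equivalent_def by metis
  have "reduce ((shift n ^^ i) w) = (shift n ^^ i) w"
    using reduced_shift[OF w(1,2)] i by (simp add: reduce_reduced)
  then have "reduce ((shift n ^^ i) w) \<noteq> []"
    using w(3) by (simp add: shift_power[OF w(1)])
  then obtain j where j: "j < n" "j \<noteq> i" "cyclically_equivalent ((shift n ^^ i) w) ((shift n ^^ j) w)"
    using red by blast
  have "cyclically_equivalent ((shift n ^^ (n - j)) ((shift n ^^ i) w)) ((shift n ^^ (n - j)) ((shift n ^^ j) w))"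
    using j(3) by (rule cyclically_equivalent_shift)
  moreover have "(shift n ^^ (n - j)) ((shift n ^^ j) w) = w"
    using funpow_add[of "n - j" j "shift n"] j(1) shift_power_full[OF w(1)] by simp
  moreover have "(shift n ^^ (n - j)) ((shift n ^^ i) w) = (shift n ^^ (n - j + i)) w"
    by (simp add: funpow_add)
  ultimately have eq: "cyclically_equivalent ((shift n ^^ (n - j + i)) w) w" by simp
  \<comment> \<open>The shift \<open>n - j + i\<close> lies below \<open>n\<close> when
    \<open>i < j\<close>; otherwise a full turn is removed.\<close>
  show ?thesis
  proof (cases "i < j")
    case True
    then show ?thesis using that[of "n - j + i"] eq j(1) by simp
  next
    case False
    have "n - j + i = i - j + n" using False j(1) by simp
    then have "(shift n ^^ (n - j + i)) w = (shift n ^^ (i - j + n)) w" by (simp only:)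
    also have "\<dots> = (shift n ^^ (i - j)) w"
      by (simp add: funpow_add shift_power_full[OF w(1)])
    finally show ?thesis using that[of "i - j"] eq False i j by simp
  qed
qed

theorem corollary4p2:
  fixes n :: nat and w :: "nat word"
  assumes "n \<ge> 1"
    and "w \<in> carrier (free_group {..<n})"
    and "w \<noteq> []"
    and "cyclically_reduced w"
    and "redundant (cyclic_presentation n w)"
  shows "contains_nonabelian_free_subgroup (cyclically_presented_group n w) \<or> solvable (cyclically_presented_group n w)"
proof -
  have w: "fst ` set w \<subseteq> {..<n}" "reduced w" using assms(2) by (auto simp: free_group_def)
  obtain p where p: "0 < p" "p < n" "cyclically_equivalent ((shift n ^^ p) w) w"
    using redundant_shift[OF w assms(3,5)] .
  obtain d where d: "0 < d" "d < n" "d dvd n" "cyclically_equivalent ((shift n ^^ d) w) w"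
    and rem: "\<forall>k. cyclically_equivalent ((shift n ^^ k) w) ((shift n ^^ (k mod d)) w)"
    using shift_period[OF w(1) p] .
  obtain \<epsilon> :: int where \<epsilon>: "\<epsilon> * \<epsilon> = 1" "\<forall>\<psi>. height \<psi> ((shift n ^^ d) w) = \<epsilon> * height \<psi> w"
    using height_cyclically_equivalent[OF d(4)] .
  let ?P = "cyclic_presentation n w"
  have gens: "fst ?P = {..<n}" by (simp add: cyclic_presentation_def)
  have rels: "set (snd ?P) = (\<lambda>k. (shift n ^^ k) w) ` {..<n}"
    by (auto simp: cyclic_presentation_def)
  have letters: "fst ` set ((shift n ^^ k) w) \<subseteq> {..<n}" for k
    using letters_shift[OF assms(1) w(1)] .
  have pres: "presentation ?P"
    by (rule presentation.intro) (use letters in \<open>auto simp only: gens rels\<close>)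
  text \<open>The exponent sums of a relator in \<open>x\<^sub>0\<close> and \<open>x\<^sub>d\<close> differ by the factor \<open>\<epsilon>\<close>.\<close>
  define \<phi> :: "nat \<Rightarrow> int" where
    "\<phi> = (\<lambda>a. 1 * (if a = 0 then 1 else 0) + (- \<epsilon>) * (if a = d then 1 else 0))"
  have \<phi>0: "\<phi> 0 = 1" using d(1) by (simp add: \<phi>_def)
  have height_shift: "height \<phi> ((shift n ^^ k) w) = 0" for k
  proof -
    let ?u = "(shift n ^^ k) w"
    \<comment> \<open>The exponent of \<open>x_d\<close> in the relator shifted by \<open>d\<close>
      is computed twice: as \<open>\<epsilon>\<close> times its exponent in \<open>?u\<close>, and,
      undoing the shift, as the exponent of \<open>x_0\<close> in \<open>?u\<close>.\<close>
    have "height (\<lambda>a. if a = d then 1 else 0) ((shift n ^^ d) ?u) = \<epsilon> * height (\<lambda>a. if a = d then 1 else 0) ?u"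
    proof -
      have "(shift n ^^ d) ?u = (shift n ^^ k) ((shift n ^^ d) w)"
        by (metis add.commute comp_apply funpow_add)
      also have "\<dots> = map (\<lambda>(a, e). ((a + k) mod n, e)) ((shift n ^^ d) w)"
        by (rule shift_power[OF letters])
      finally show ?thesis
        using \<epsilon>(2) by (simp add: height_map shift_power[OF w(1), of k])
    qed
    moreover have "height (\<lambda>a. if a = d then 1 else 0) ((shift n ^^ d) ?u)
        = height (\<lambda>a. if a = 0 then 1 else 0 :: int) ?u"
      unfolding shift_power[OF letters, of d] height_map
    proof (rule height_cong)
      fix a assume "a \<in> fst ` set ?u"
      then have "a < n" using letters by blast
      then have "(a + d) mod n = d \<longleftrightarrow> a = 0"
        using d by (cases "a + d < n") (auto simp: mod_if)
      then show "(if (a + d) mod n = d then 1 else 0 :: int) = (if a = 0 then 1 else 0)" by simp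
    qed
    ultimately show ?thesis
      using \<epsilon>(1) unfolding \<phi>_def height_linear by (simp flip: mult.assoc)
  qed
  have "2 * d \<le> n"
    using d by (auto simp: dvd_def)
  show ?thesis
  proof (cases "n = 2")
    case True
    then have "d = 1" using d by simp
    \<comment> \<open>Otherwise \<open>w\<close> is a reduced power of \<open>x_0\<close> of height
      zero, hence empty.\<close>
    have "1 \<in> fst ` set w"
    proof (rule ccontr)
      assume "1 \<notin> fst ` set w"
      then have zero: "a = 0" if "a \<in> fst ` set w" for a
        using that subsetD[OF w(1) that] True by (cases "a = 1") (simp_all add: less_2_cases_iff)
      have "fst ` set w \<subseteq> {0}" by (simp add: image_subset_iff zero)
      then have "w = []"
        by (rule height_stable_word[OF w(2)]) (use \<phi>0 height_shift[of 0] in simp_all)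
      then show False using assms(3) by simp
    qed
    moreover have "{..<n} = {0, 1}" using True by auto
    moreover have "w \<in> set (snd ?P)" unfolding rels using assms(1) by (intro image_eqI[of _ _ 0]) auto
    moreover have "one_relator_eval w r = \<one>\<^bsub>one_relator_group w\<^esub>" if r: "r \<in> set (snd ?P)" for r
    proof -
      interpret presentation "one_relator w" by (rule presentation_one_relator)
      obtain k where k: "r = (shift n ^^ k) w" using r unfolding rels by blast
      \<comment> \<open>With period 1 both relators are equivalent to \<open>w\<close>.\<close>
      have "cyclically_equivalent r w" using rem k \<open>d = 1\<close> by (metis funpow_0 mod_by_1)
      then show ?thesis
        by (rule presented.word_eval_cyclically_equivalent)
          (use generator_closed generator_relator[of w] in auto)
    qed
    ultimately show ?thesis
      unfolding cyclically_presented_group_def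
      using two_generators_one_relator[where t = 0 and y = 1 and \<phi> = \<phi>, OF pres]
        gens assms(4) \<phi>0 height_shift[of 0] by simp
  next
    case False
    define R where "R = (\<lambda>k. (shift n ^^ k) w) ` {..<d}"
    have "card R \<le> d" unfolding R_def using card_image_le[of "{..<d}"] by simp
    \<comment> \<open>For \<open>n = 3\<close> the period is 1, and \<open>n / 2 \<le> n - 2\<close>
      from \<open>n = 4\<close> on.\<close>
    moreover have "d + 2 \<le> n" using False d \<open>2 * d \<le> n\<close> by linarith
    ultimately have "card R + 2 \<le> card (fst ?P)" by (simp add: gens)
    have "contains_nonabelian_free_subgroup (presented_group ?P)"
    proof (rule deficiency_two_free_subgroup[OF pres, where t = 0 and R = R and \<phi> = \<phi>])
      fix f :: "nat \<Rightarrow> int \<times> bool word \<times> nat \<Rightarrow> int \<times> bool word \<times> nat" and r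
      assume f: "range f \<subseteq> carrier perms" and one: "\<And>r. r \<in> R \<Longrightarrow> word_eval perms f r = \<one>\<^bsub>perms\<^esub>"
        and "r \<in> set (snd ?P)"
      then obtain k where k: "r = (shift n ^^ k) w" unfolding rels by blast
      \<comment> \<open>Every relator is equivalent to the one whose index is reduced modulo the
        period, so the first \<open>d\<close> relators imply all.\<close>
      have "(shift n ^^ (k mod d)) w \<in> R" using d(1) by (simp add: R_def)
      from one[OF this] show "word_eval perms f r = \<one>\<^bsub>perms\<^esub>"
        unfolding k by (rule perms.word_eval_cyclically_equivalent[OF rem[rule_format], rotated]) (use f in blast)
    qed (use assms(1) letters \<phi>0 height_shift \<open>card R + 2 \<le> card (fst ?P)\<close> gens in \<open>auto simp: R_def\<close>)
    then show ?thesis unfolding cyclically_presented_group_def by blast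
  qed
qed

end
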